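(* Let $K\ge 1$, let $\rho_S$ be a state of the $n$-qubit system, let $O$ be an observable on the system, and let $\mathcal{M}_K$ be the Markovian $K$-collision map determined by the collision Hamiltonians $H_1,\dots,H_K$, the sub-environment states $\rho_{E_1},\dots,\rho_{E_K}$ and the collision time $\Delta t$, as defined in the context. Let $\varepsilon,\delta\in(0,1)$ and set $\varepsilon'=\varepsilon/(6K\|O\|)$. Then the algorithm described in the context (run with precision $\varepsilon'$ and a suitable choice of its LCU segment parameters $r_1,\dots,r_K$) outputs, with probability at least $1-\delta$, a number $\mu$ such that $$\left|\mu-\mathrm{Tr}\big[O\,\mathcal{M}_K[\rho_S]\big]\right|\le\varepsilon ,$$ using $T$ repetitions (coherent runs) of its circuit, where $$T=\mathcal{O}\left(\frac{\|O\|^2\log(1/\delta)}{\varepsilon^2}\right),$$ and each coherent run has circuit depth $$\tau_d=\mathcal{O}\left(\beta^2K^2\Delta t^2\,\frac{\log(\beta K\|O\|\Delta t/\varepsilon)}{\log\log(\beta K\|O\|\Delta t/\varepsilon)}+K\tau_{\rho_E}\right),$$ where $\beta=\max_j\beta_j$ and $\tau_{\rho_E}=\max_j\tau_{\rho_{E_j}}$, with $\tau_{\rho_{E_j}}$ the circuit depth of the unitary preparing the sub-environment $E_j$ in the state $\rho_{E_j}$.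
   Context: **Notation.** $\|\cdot\|$ is the spectral norm. $g=\mathcal{O}(f)$ means $g\le k_2 f$ for a constant $k_2$ once the parameters exceed a constant. **Collision model.** $S$ is an $n$-qubit system with Hamiltonian $H_S$. For $1\le j\le K$, $E_j$ is a sub-environment (a register of qubits) with Hamiltonian $H_{E_j}$ and initial state $\rho_{E_j}$, and $H_{I_j}$ is an interaction Hamiltonian on $S\otimes E_j$. The total Hamiltonian of the $j$-th collision is $H_j=H_S+H_{E_j}+H_{I_j}=\sum_{i=1}^{L_j}h_{i,j}P_{i,j}$, where each $P_{i,j}$ is a signed Pauli string on the qubits of $S\otimes E_j$ and $h_{i,j}>0$. Put $\beta_j=\sum_i h_{i,j}$, $\overline{H}_j=H_j/\beta_j$ (a convex combination of signed Pauli strings), and $U_j=e^{-i\beta_j\overline{H}_j\Delta t}$. The $j$-th collision map is $\Phi_j[\cdot]=\mathrm{Tr}_{E_j}[U_j(\cdot\otimes\rho_{E_j})U_j^\dagger]$, and the Markovian $K$-collision map is $\mathcal{M}_K=\Phi_K\circ\cdots\circ\Phi_1$. **LCU decomposition used by the algorithm.** Let $\overline{H}=\sum_{\ell=1}^L p_\ell P_\ell$ be a convex combination of signed Pauli strings, $\tau>0$, and $r$ a positive integer with $\tau/r<1$. Truncating the Taylor series of $e^{-i\tau \overline{H}/r}$ and pairing consecutive orders gives a segment $$\widetilde S_r=\sum_{\substack{0\le k\le q\\ k\text{ even}}}\ \sum_{\ell_1,\dots,\ell_k,m=1}^{L}\frac{(\tau/r)^k}{k!}\sqrt{1+\Big(\tfrac{\tau/r}{k+1}\Big)^2}\;p_{\ell_1}\cdots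 p_{\ell_k}p_m\;\,(-i)^kP_{\ell_1}\cdots P_{\ell_k}e^{-i\theta_kP_m},$$ with $\theta_k=\arccos\big([1+(\tfrac{\tau/r}{k+1})^2]^{-1/2}\big)$. Expanding $\widetilde U=\widetilde S_r^{\,r}=\sum_i\alpha_iW_i$ expresses $\widetilde U$ as a combination, with positive coefficients, of unitaries $W_i$, each a product of $r$ blocks consisting of at most $q$ Pauli strings and one Pauli rotation. The truncation order is $q=\mathcal{O}\big(\log(r/\varepsilon')/\log\log(r/\varepsilon')\big)$, chosen so that $\|\widetilde U-e^{-i\tau\overline{H}}\|\le\varepsilon'$; moreover $\sum_i|\alpha_i|\le e^{\tau^2/r}$. For each $j$ this is applied with $\overline H=\overline{H}_j$, $\tau=\beta_j\Delta t$ and a segment parameter $r=r_j$ (free parameter of the algorithm), giving $\widetilde U_j=\sum_k\alpha_{jk}W_{jk}$ with $\|\widetilde U_j-U_j\|\le\varepsilon'$. Put $\alpha^{(j)}=\sum_k|\alpha_{jk}|$ and $\zeta=\prod_{j=1}^K\alpha^{(j)}$. **Algorithm.** One coherent run: (1) initialize the system in $\rho_S$ and a single ancilla qubit in $|+\rangle$. (2) For $j=1,\dots,K$: (a) prepare the environment register in $\rho_{E_j}$; (b) draw two i.i.d. samples $X_j,Y_j$ from the distribution in which $W_{jk}$ has probability $\alpha_{jk}/\alpha^{(j)}$; (c) apply $X_j^{(c)}=|0\rangle\langle0|\otimes I+|1\rangle\langle1|\otimes X_j$ and then $Y_j^{(a)}=|0\rangle\langle0|\otimes Y_j+|1\rangle\langle1|\otimes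 I$, controlled on the ancilla and acting on system and environment register; (d) trace out the environment register. (3) Measure $\sigma^x\otimes O$ on ancilla and system and record the outcome. The run is repeated independently $T$ times, giving outcomes $\mu_1,\dots,\mu_T$, and the output is $\mu=\frac{\zeta^2}{T}\sum_{i=1}^T\mu_i$. **Circuit depth convention.** The depth of a coherent run counts each controlled (or anti-controlled) Pauli string and each controlled Pauli rotation as $\mathcal{O}(1)$, plus the depths of preparing the states $\rho_{E_j}$. *)

theory Defs
  imports
    "HOL-Probability.Product_PMF"
    "Jordan_Normal_Form.Schur_Decomposition"
begin

hide_type (open) Finite_Cartesian_Product.vec
hide_const (open) Finite_Cartesian_Product.mat Finite_Cartesian_Product.vec

section \<open>Matrices\<close>

text \<open>Basis state \<open>a\<close> of the first and \<open>b\<close> of the second factor (dimension \<open>D\<close>) of a tensor product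
  have the joint index \<open>a * D + b\<close>.\<close>

definition kron :: "complex mat \<Rightarrow> complex mat \<Rightarrow> complex mat" (infixl "\<Otimes>" 72) where
  "A \<Otimes> B = mat (dim_row A * dim_row B) (dim_col A * dim_col B)
     (\<lambda>(i, j). A $$ (i div dim_row B, j div dim_col B) * B $$ (i mod dim_row B, j mod dim_col B))"

definition ptrace_snd :: "nat \<Rightarrow> nat \<Rightarrow> complex mat \<Rightarrow> complex mat" where
  "ptrace_snd d e M = mat d d (\<lambda>(i, j). \<Sum>k<e. M $$ (i * e + k, j * e + k))"

definition mat_trace :: "complex mat \<Rightarrow> complex" where
  "mat_trace A = (\<Sum>i<dim_row A. A $$ (i, i))"

definition mat_sum :: "nat \<Rightarrow> 'a set \<Rightarrow> ('a \<Rightarrow> complex mat) \<Rightarrow> complex mat" where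
  "mat_sum d J f = mat d d (\<lambda>ij. \<Sum>x\<in>J. f x $$ ij)"

definition mat_prod :: "nat \<Rightarrow> complex mat list \<Rightarrow> complex mat" where
  "mat_prod d As = foldr (*) As (1\<^sub>m d)"

definition mat_exp :: "complex mat \<Rightarrow> complex mat" where
  "mat_exp A = mat (dim_row A) (dim_row A) (\<lambda>ij. \<Sum>k. (A ^\<^sub>m k) $$ ij / fact k)"

definition vec_l2 :: "complex vec \<Rightarrow> real" where
  "vec_l2 v = sqrt (\<Sum>i<dim_vec v. (cmod (vec_index v i))\<^sup>2)"

definition spectral_norm :: "complex mat \<Rightarrow> real" where
  "spectral_norm A = (SUP v\<in>{v \<in> carrier_vec (dim_col A). vec_l2 v \<le> 1}. vec_l2 (A *\<^sub>v v))"

definition hermitian_mat :: "nat \<Rightarrow> complex mat \<Rightarrow> bool" where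
  "hermitian_mat d A \<longleftrightarrow> A \<in> carrier_mat d d \<and> mat_adjoint A = A"

definition density_mat :: "nat \<Rightarrow> complex mat \<Rightarrow> bool" where
  "density_mat d \<rho> \<longleftrightarrow> hermitian_mat d \<rho> \<and> (\<forall>v\<in>carrier_vec d. 0 \<le> Re ((\<rho> *\<^sub>v v) \<bullet>c v)) \<and> mat_trace \<rho> = 1"


section \<open>Projective measurement of an observable\<close>

text \<open>The orthogonal projection onto the eigenspace of a Hermitian matrix (zero if \<open>a\<close> is not an
  eigenvalue).\<close>

definition eigenspace_projection :: "complex mat \<Rightarrow> real \<Rightarrow> complex mat" where
  "eigenspace_projection A a = (THE P. hermitian_mat (dim_row A) P \<and> P * P = P \<and>
     (\<forall>v\<in>carrier_vec (dim_row A). P *\<^sub>v v = v \<longleftrightarrow> A *\<^sub>v v = complex_of_real a \<cdot>\<^sub>v v))"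

definition measure_observable :: "complex mat \<Rightarrow> complex mat \<Rightarrow> real pmf" where
  "measure_observable A \<rho> = embed_pmf (\<lambda>a. Re (mat_trace (eigenspace_projection A a * \<rho>)))"


section \<open>Pauli strings\<close>

datatype pauli = Pauli_I | Pauli_X | Pauli_Y | Pauli_Z

fun pauli_mat :: "pauli \<Rightarrow> complex mat" where
  "pauli_mat Pauli_I = 1\<^sub>m 2"
| "pauli_mat Pauli_X = mat_of_rows_list 2 [[0, 1], [1, 0]]"
| "pauli_mat Pauli_Y = mat_of_rows_list 2 [[0, - \<i>], [\<i>, 0]]"
| "pauli_mat Pauli_Z = mat_of_rows_list 2 [[1, 0], [0, - 1]]"

text \<open>A signed Pauli string is a pair of a flag for a minus sign and the list of its tensor factors.\<close>

type_synonym signed_pauli = "bool \<times> pauli list"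

definition signed_pauli_mat :: "signed_pauli \<Rightarrow> complex mat" where
  "signed_pauli_mat P =
     (if fst P then - 1 else 1) \<cdot>\<^sub>m foldr (\<lambda>p A. pauli_mat p \<Otimes> A) (snd P) (1\<^sub>m 1)"


section \<open>The collision model\<close>

text \<open>The fields \<open>terms\<close>, \<open>coef\<close>, \<open>str\<close> hold the Pauli decomposition of the total Hamiltonian of the
  collision, with terms indexed by \<open>1, ..., terms\<close>; \<open>prep_depth\<close> is the depth of the circuit
  that prepares \<open>env_state\<close>.\<close>

record collision =
  env_qubits :: nat
  env_ham :: "complex mat"
  int_ham :: "complex mat"
  env_state :: "complex mat"
  terms :: nat
  coef :: "nat \<Rightarrow> real"
  str :: "nat \<Rightarrow> signed_pauli"
  prep_depth :: nat

definition joint_dim :: "nat \<Rightarrow> collision \<Rightarrow> nat" where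
  "joint_dim n c = 2 ^ (n + env_qubits c)"

definition total_ham :: "nat \<Rightarrow> complex mat \<Rightarrow> collision \<Rightarrow> complex mat" where
  "total_ham n HS c = HS \<Otimes> 1\<^sub>m (2 ^ env_qubits c) + 1\<^sub>m (2 ^ n) \<Otimes> env_ham c + int_ham c"

definition valid_collision :: "nat \<Rightarrow> complex mat \<Rightarrow> collision \<Rightarrow> bool" where
  "valid_collision n HS c \<longleftrightarrow>
     hermitian_mat (2 ^ env_qubits c) (env_ham c) \<and>
     hermitian_mat (joint_dim n c) (int_ham c) \<and>
     density_mat (2 ^ env_qubits c) (env_state c) \<and>
     1 \<le> terms c \<and>
     (\<forall>i\<in>{1..terms c}. 0 < coef c i \<and> length (snd (str c i)) = n + env_qubits c) \<and>
     total_ham n HS c = mat_sum (joint_dim n c) {1..terms c}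
       (\<lambda>i. complex_of_real (coef c i) \<cdot>\<^sub>m signed_pauli_mat (str c i))"

definition coef_sum :: "collision \<Rightarrow> real" where
  "coef_sum c = (\<Sum>i=1..terms c. coef c i)"

definition normalized_ham :: "nat \<Rightarrow> complex mat \<Rightarrow> collision \<Rightarrow> complex mat" where
  "normalized_ham n HS c = complex_of_real (1 / coef_sum c) \<cdot>\<^sub>m total_ham n HS c"

definition collision_unitary :: "nat \<Rightarrow> complex mat \<Rightarrow> real \<Rightarrow> collision \<Rightarrow> complex mat" where
  "collision_unitary n HS \<Delta>t c =
     mat_exp ((- \<i> * complex_of_real (coef_sum c * \<Delta>t)) \<cdot>\<^sub>m normalized_ham n HS c)"

definition collision_map ::
  "nat \<Rightarrow> complex mat \<Rightarrow> real \<Rightarrow> collision \<Rightarrow> complex mat \<Rightarrow> complex mat" where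
  "collision_map n HS \<Delta>t c \<rho> =
     (let U = collision_unitary n HS \<Delta>t c
      in ptrace_snd (2 ^ n) (2 ^ env_qubits c) (U * (\<rho> \<Otimes> env_state c) * mat_adjoint U))"

primrec markov_map ::
  "nat \<Rightarrow> complex mat \<Rightarrow> real \<Rightarrow> (nat \<Rightarrow> collision) \<Rightarrow> nat \<Rightarrow> complex mat \<Rightarrow> complex mat" where
  "markov_map n HS \<Delta>t coll 0 = id"
| "markov_map n HS \<Delta>t coll (Suc k) = collision_map n HS \<Delta>t (coll (Suc k)) \<circ> markov_map n HS \<Delta>t coll k"


section \<open>LCU decomposition\<close>

text \<open>A block \<open>([l\<^sub>1, ..., l\<^sub>k], m)\<close> indexes a summand of the segment, with \<open>k\<close> Pauli strings and one
  Pauli rotation.  A word, i.e. a list of \<open>r\<close> blocks, indexes a summand of the \<open>r\<close>-th power of the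
  segment.  Below \<open>x\<close> is the evolution time of one segment.  The square root and the rotation angle
  arise from pairing the Taylor orders \<open>k\<close> and \<open>k + 1\<close>, as
  \<open>1 - \<i> (x / (k + 1)) P = sqrt (1 + (x / (k + 1))\<^sup>2) exp (- \<i> \<theta> P)\<close> for a signed Pauli string \<open>P\<close>.\<close>

type_synonym block = "nat list \<times> nat"

definition blocks :: "nat \<Rightarrow> collision \<Rightarrow> block set" where
  "blocks q c = {(ls, m). even (length ls) \<and> length ls \<le> q \<and> set ls \<subseteq> {1..terms c} \<and> m \<in> {1..terms c}}"

definition weight :: "collision \<Rightarrow> nat \<Rightarrow> real" where
  "weight c l = coef c l / coef_sum c"

definition segment_angle :: "real \<Rightarrow> nat \<Rightarrow> real" where
  "segment_angle x k = arccos (1 / sqrt (1 + (x / real (k + 1))\<^sup>2))"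

definition block_coef :: "collision \<Rightarrow> real \<Rightarrow> block \<Rightarrow> real" where
  "block_coef c x = (\<lambda>(ls, m). x ^ length ls / fact (length ls)
      * sqrt (1 + (x / real (length ls + 1))\<^sup>2) * prod_list (map (weight c) ls) * weight c m)"

definition block_unitary :: "nat \<Rightarrow> collision \<Rightarrow> real \<Rightarrow> block \<Rightarrow> complex mat" where
  "block_unitary n c x = (\<lambda>(ls, m). (- \<i>) ^ length ls \<cdot>\<^sub>m
      (mat_prod (joint_dim n c) (map (\<lambda>l. signed_pauli_mat (str c l)) ls)
       * mat_exp ((- \<i> * complex_of_real (segment_angle x (length ls))) \<cdot>\<^sub>m signed_pauli_mat (str c m))))"

definition segment :: "nat \<Rightarrow> collision \<Rightarrow> real \<Rightarrow> nat \<Rightarrow> complex mat" where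
  "segment n c x q = mat_sum (joint_dim n c) (blocks q c)
     (\<lambda>b. complex_of_real (block_coef c x b) \<cdot>\<^sub>m block_unitary n c x b)"

definition segment_time :: "real \<Rightarrow> nat \<Rightarrow> collision \<Rightarrow> real" where
  "segment_time \<Delta>t r c = coef_sum c * \<Delta>t / real r"

definition lcu_approx :: "nat \<Rightarrow> real \<Rightarrow> nat \<Rightarrow> nat \<Rightarrow> collision \<Rightarrow> complex mat" where
  "lcu_approx n \<Delta>t r q c = segment n c (segment_time \<Delta>t r c) q ^\<^sub>m r"

definition words :: "nat \<Rightarrow> nat \<Rightarrow> collision \<Rightarrow> block list set" where
  "words r q c = {w. length w = r \<and> set w \<subseteq> blocks q c}"

definition word_coef :: "real \<Rightarrow> nat \<Rightarrow> collision \<Rightarrow> block list \<Rightarrow> real" where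
  "word_coef \<Delta>t r c w = prod_list (map (block_coef c (segment_time \<Delta>t r c)) w)"

definition word_unitary :: "nat \<Rightarrow> real \<Rightarrow> nat \<Rightarrow> collision \<Rightarrow> block list \<Rightarrow> complex mat" where
  "word_unitary n \<Delta>t r c w =
     mat_prod (joint_dim n c) (map (block_unitary n c (segment_time \<Delta>t r c)) w)"

definition lcu_norm :: "real \<Rightarrow> nat \<Rightarrow> nat \<Rightarrow> collision \<Rightarrow> real" where
  "lcu_norm \<Delta>t r q c = (\<Sum>w\<in>words r q c. \<bar>word_coef \<Delta>t r c w\<bar>)"

definition sample_word :: "real \<Rightarrow> nat \<Rightarrow> nat \<Rightarrow> collision \<Rightarrow> block list pmf" where
  "sample_word \<Delta>t r q c =
     embed_pmf (\<lambda>w. if w \<in> words r q c then word_coef \<Delta>t r c w / lcu_norm \<Delta>t r q c else 0)"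

definition word_gates :: "block list \<Rightarrow> nat" where
  "word_gates w = sum_list (map (\<lambda>(ls, m). length ls + 1) w)"


section \<open>The randomized algorithm\<close>

text \<open>The registers are ordered as ancilla, system, environment.  Controlled on the ancilla:
  \<open>ctrl\<close> applies its argument on \<open>|1>\<close>, \<open>anti_ctrl\<close> applies it on \<open>|0>\<close>.\<close>

definition proj0 :: "complex mat" where "proj0 = mat_of_rows_list 2 [[1, 0], [0, 0]]"
definition proj1 :: "complex mat" where "proj1 = mat_of_rows_list 2 [[0, 0], [0, 1]]"
definition plus_state :: "complex mat" where "plus_state = mat 2 2 (\<lambda>_. 1 / 2)"

definition ctrl :: "complex mat \<Rightarrow> complex mat" where
  "ctrl W = proj0 \<Otimes> 1\<^sub>m (dim_row W) + proj1 \<Otimes> W"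

definition anti_ctrl :: "complex mat \<Rightarrow> complex mat" where
  "anti_ctrl W = proj0 \<Otimes> W + proj1 \<Otimes> 1\<^sub>m (dim_row W)"

definition coherent_step ::
  "nat \<Rightarrow> collision \<Rightarrow> complex mat \<Rightarrow> complex mat \<Rightarrow> complex mat \<Rightarrow> complex mat" where
  "coherent_step n c X Y \<sigma> = (let V = anti_ctrl Y * ctrl X
     in ptrace_snd (2 * 2 ^ n) (2 ^ env_qubits c) (V * (\<sigma> \<Otimes> env_state c) * mat_adjoint V))"

text \<open>The joint distribution of the ancilla-system state and the circuit depth after the given number of
  collisions, where every controlled Pauli string or Pauli rotation has depth \<open>\<kappa>\<close>.\<close>

primrec coherent_state ::
  "nat \<Rightarrow> nat \<Rightarrow> real \<Rightarrow> (nat \<Rightarrow> collision) \<Rightarrow> complex mat \<Rightarrow> (nat \<Rightarrow> nat) \<Rightarrow> (nat \<Rightarrow> nat) \<Rightarrow> nat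
    \<Rightarrow> (complex mat \<times> nat) pmf" where
  "coherent_state \<kappa> n \<Delta>t coll \<rho>S r q 0 = return_pmf (plus_state \<Otimes> \<rho>S, 0)"
| "coherent_state \<kappa> n \<Delta>t coll \<rho>S r q (Suc j) =
     (let c = coll (Suc j); rj = r (Suc j); qj = q (Suc j) in
      do {
        (\<sigma>, d) \<leftarrow> coherent_state \<kappa> n \<Delta>t coll \<rho>S r q j;
        x \<leftarrow> sample_word \<Delta>t rj qj c;
        y \<leftarrow> sample_word \<Delta>t rj qj c;
        return_pmf
          (coherent_step n c (word_unitary n \<Delta>t rj c x) (word_unitary n \<Delta>t rj c y) \<sigma>,
           d + prep_depth c + \<kappa> * (word_gates x + word_gates y))
      })"

text \<open>The outcome and the depth of one run.\<close>

definition coherent_run ::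
  "nat \<Rightarrow> nat \<Rightarrow> nat \<Rightarrow> real \<Rightarrow> (nat \<Rightarrow> collision) \<Rightarrow> complex mat \<Rightarrow> complex mat
    \<Rightarrow> (nat \<Rightarrow> nat) \<Rightarrow> (nat \<Rightarrow> nat) \<Rightarrow> (real \<times> nat) pmf" where
  "coherent_run \<kappa> n K \<Delta>t coll \<rho>S Obs r q =
     do {
       (\<sigma>, d) \<leftarrow> coherent_state \<kappa> n \<Delta>t coll \<rho>S r q K;
       \<mu> \<leftarrow> measure_observable (pauli_mat Pauli_X \<Otimes> Obs) \<sigma>;
       return_pmf (\<mu>, d)
     }"

definition algorithm_output ::
  "nat \<Rightarrow> nat \<Rightarrow> nat \<Rightarrow> real \<Rightarrow> (nat \<Rightarrow> collision) \<Rightarrow> complex mat \<Rightarrow> complex mat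
    \<Rightarrow> (nat \<Rightarrow> nat) \<Rightarrow> (nat \<Rightarrow> nat) \<Rightarrow> nat \<Rightarrow> real pmf" where
  "algorithm_output \<kappa> n K \<Delta>t coll \<rho>S Obs r q T =
     (let \<zeta> = (\<Prod>j=1..K. lcu_norm \<Delta>t (r j) (q j) (coll j))
      in map_pmf (\<lambda>\<omega>. \<zeta>\<^sup>2 / real T * (\<Sum>i=1..T. fst (\<omega> i)))
           (Pi_pmf {1..T} (0, 0) (\<lambda>_. coherent_run \<kappa> n K \<Delta>t coll \<rho>S Obs r q)))"


definition log_ratio :: "real \<Rightarrow> real" where
  "log_ratio x = ln x / ln (ln x)"

end

theory Submission
  imports "HOL-Probability.Characteristic_Functions" "HOL-Probability.Hoeffding" "HOL-Real_Asymp.Real_Asymp" Defs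
begin

text \<open>Dualising each collision to the Heisenberg picture turns all error bounds into operator norm bounds:
  if every LCU approximation is \<open>e\<close>-close to the collision unitary, the expectation of an observable of norm
  \<open>M\<close> after \<open>K\<close> collisions moves by at most \<open>((1 + e) ^ (2 * K) - 1) * M\<close>.  The off-diagonal ancilla block
  of the state evolves by \<open>B \<mapsto> Tr (V (B \<Otimes> \<rho>) W\<^sup>\<dagger>)\<close> with independent samples \<open>V\<close>, \<open>W\<close>, so by bilinearity the
  outcome of a run, rescaled by \<open>\<zeta>\<^sup>2\<close>, has the expectation belonging to the LCU approximations, and Hoeffding's
  inequality gives the number of runs.  The segment is a polynomial in the normalised Hamiltonian, whose
  spectrum lies in \<open>[-1, 1]\<close>, so its error is that of the Taylor polynomial of \<open>exp\<close>.  Taking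
  \<open>K (\<beta> \<Delta>t)\<^sup>2\<close> segments per collision keeps \<open>\<zeta>\<close> below \<open>exp 1\<close>.\<close>

text \<open>The LCU approximations are not unitary, so their channels need not preserve the trace,
  and the off-diagonal ancilla block is in general not even Hermitian. Passing to observables avoids
  trace norm estimates for such matrices: in the comparison of the two evolutions only the exact one
  has to stay among the states. The error budget explains the precision \<epsilon>/(6 K M), where M
  is the norm of the observable: with e at most this value, ((1 + e)^(2 K) - 1) M is at most 4 K e M
  and hence at most 2 \<epsilon>/3, and sampling may use the remaining \<epsilon>/3. As \<zeta> is
  at most exp 1, rescaling by \<zeta>^2 costs a factor of at most exp 4 in the number of runs. The
  truncation order is governed by R/\<epsilon>' for R segments, whereas the depth bound speaks of z
  = \<beta> K M \<Delta>t/\<epsilon>. Since R/\<epsilon>' is at most 12 z^2 and squaring changes ln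
  z / ln (ln z) only by a bounded factor, the two agree up to a constant. Accuracy is claimed for
  all parameters but the cost only asymptotically, so the parameters are chosen differently inside
  and outside the asymptotic regime.\<close>

notation mat_adjoint ("_\<^sup>\<dagger>" [1000] 999)

section \<open>Joint indices of tensor products\<close>

lemma sum_product_index:
  fixes f :: "nat \<Rightarrow> 'a::comm_monoid_add"
  shows "(\<Sum>l<m * e. f l) = (\<Sum>a<m. \<Sum>b<e. f (a * e + b))"
proof -
  have "(\<Sum>l<m * e. f l) = (\<Sum>a<m. sum f {a*e..<a*e+e})"
    by (rule sum.nat_group [symmetric])
  also have "\<dots> = (\<Sum>a<m. \<Sum>b<e. f (a * e + b))"
  proof (rule sum.cong [OF refl])
    fix a
    show "sum f {a*e..<a*e+e} = (\<Sum>b<e. f (a * e + b))"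
      by (rule sum.reindex_bij_witness [of _ "\<lambda>b. a * e + b" "\<lambda>l. l - a * e"]) auto
  qed
  finally show ?thesis .
qed

lemma product_index_less: "a < m \<Longrightarrow> b < e \<Longrightarrow> a * e + b < m * (e::nat)"
proof -
  assume "a < m" "b < e"
  then have "a * e + b < (a + 1) * e" by simp
  also have "\<dots> \<le> m * e" using \<open>a < m\<close> by (intro mult_right_mono) auto
  finally show ?thesis .
qed

lemma less_product_div: "i < m * e \<Longrightarrow> i div e < (m::nat)"
  by (simp add: less_mult_imp_div_less)

lemma less_product_mod: "i < m * e \<Longrightarrow> i mod e < (e::nat)"
  by (metis mod_less_divisor mult_0_right neq0_conv not_less0)

section \<open>Adjoint, trace and finite sums of matrices\<close>

lemma adjoint_carrier [simp]: "A \<in> carrier_mat n m \<Longrightarrow> A\<^sup>\<dagger> \<in> carrier_mat m n"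
  unfolding mat_adjoint_def by auto

lemma dim_adjoint [simp]: "dim_row (A\<^sup>\<dagger>) = dim_col A" "dim_col (A\<^sup>\<dagger>) = dim_row A"
  unfolding mat_adjoint_def by auto

lemma index_adjoint [simp]:
  "i < dim_col A \<Longrightarrow> j < dim_row A \<Longrightarrow> (A\<^sup>\<dagger> :: complex mat) $$ (i, j) = cnj (A $$ (j, i))"
  unfolding mat_adjoint_def by (simp add: mat_of_rows_def)

lemma index_mult [simp]:
  "i < dim_row A \<Longrightarrow> j < dim_col B \<Longrightarrow> dim_col A = dim_row B \<Longrightarrow>
    (A * B) $$ (i, j) = (\<Sum>l<dim_row B. A $$ (i, l) * B $$ (l, j))"
  by (simp add: scalar_prod_def lessThan_atLeast0)

lemma index_mult_vec:
  "i < dim_row A \<Longrightarrow> dim_col A = dim_vec v \<Longrightarrow>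
    vec_index (A *\<^sub>v v) i = (\<Sum>l<dim_vec v. A $$ (i, l) * vec_index v l)"
  by (simp add: scalar_prod_def lessThan_atLeast0)

lemma adjoint_adjoint [simp]: "(A\<^sup>\<dagger>)\<^sup>\<dagger> = (A :: complex mat)"
  by (rule eq_matI) auto

lemma adjoint_mult:
  fixes A B :: "complex mat"
  assumes "A \<in> carrier_mat n m" "B \<in> carrier_mat m k"
  shows "(A * B)\<^sup>\<dagger> = B\<^sup>\<dagger> * A\<^sup>\<dagger>"
  by (rule eq_matI) (use assms in \<open>auto simp del: index_mult_mat(1) simp: mult.commute\<close>)

lemma adjoint_minus:
  fixes A B :: "complex mat"
  assumes "A \<in> carrier_mat n m" "B \<in> carrier_mat n m"
  shows "(A - B)\<^sup>\<dagger> = A\<^sup>\<dagger> - B\<^sup>\<dagger>"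
  by (rule eq_matI) (use assms in auto)

lemma adjoint_smult: "(c \<cdot>\<^sub>m A)\<^sup>\<dagger> = cnj c \<cdot>\<^sub>m (A :: complex mat)\<^sup>\<dagger>"
  by (rule eq_matI) auto

lemma adjoint_one [simp]: "(1\<^sub>m n :: complex mat)\<^sup>\<dagger> = 1\<^sub>m n"
  by (rule eq_matI) auto

lemma hermitian_carrier: "hermitian_mat d A \<Longrightarrow> A \<in> carrier_mat d d"
  and hermitian_adjoint: "hermitian_mat d A \<Longrightarrow> A\<^sup>\<dagger> = A"
  by (auto simp: hermitian_mat_def)

lemma mat_sum_carrier [simp]: "mat_sum d J f \<in> carrier_mat d d"
  by (simp add: mat_sum_def)

lemma dim_mat_sum [simp]: "dim_row (mat_sum d J f) = d" "dim_col (mat_sum d J f) = d"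
  by (simp_all add: mat_sum_def)

lemma index_mat_sum [simp]: "i < d \<Longrightarrow> j < d \<Longrightarrow> mat_sum d J f $$ (i, j) = (\<Sum>x\<in>J. f x $$ (i, j))"
  by (simp add: mat_sum_def)

lemma mat_sum_cong: "(\<And>x. x \<in> J \<Longrightarrow> f x = g x) \<Longrightarrow> mat_sum d J f = mat_sum d J g"
  by (rule eq_matI) auto

lemma mat_sum_empty: "mat_sum d {} f = 0\<^sub>m d d"
  by (rule eq_matI) auto

lemma mat_sum_insert:
  "finite J \<Longrightarrow> x \<notin> J \<Longrightarrow> f x \<in> carrier_mat d d \<Longrightarrow> mat_sum d (insert x J) f = f x + mat_sum d J f"
  by (rule eq_matI) auto

lemma mult_mat_sum:
  assumes "B \<in> carrier_mat d d" "\<And>x. x \<in> J \<Longrightarrow> f x \<in> carrier_mat d d"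
  shows "B * mat_sum d J f = mat_sum d J (\<lambda>x. B * f x)"
proof (rule eq_matI)
  fix i j assume "i < dim_row (mat_sum d J (\<lambda>x. B * f x))" "j < dim_col (mat_sum d J (\<lambda>x. B * f x))"
  then have ij: "i < d" "j < d" by auto
  have "(B * mat_sum d J f) $$ (i, j) = (\<Sum>l<d. \<Sum>x\<in>J. B $$ (i, l) * f x $$ (l, j))"
    using ij assms by (simp add: sum_distrib_left del: index_mult_mat(1))
  also have "\<dots> = (\<Sum>x\<in>J. \<Sum>l<d. B $$ (i, l) * f x $$ (l, j))" by (rule sum.swap)
  also have "\<dots> = (\<Sum>x\<in>J. (B * f x) $$ (i, j))"
    by (rule sum.cong [OF refl]) (use ij assms in \<open>fastforce simp del: index_mult_mat(1)\<close>)
  finally show "(B * mat_sum d J f) $$ (i, j) = mat_sum d J (\<lambda>x. B * f x) $$ (i, j)"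
    using ij by simp
qed (use assms in auto)

lemma mat_sum_mult:
  assumes "B \<in> carrier_mat d d" "\<And>x. x \<in> J \<Longrightarrow> f x \<in> carrier_mat d d"
  shows "mat_sum d J f * B = mat_sum d J (\<lambda>x. f x * B)"
proof (rule eq_matI)
  fix i j assume "i < dim_row (mat_sum d J (\<lambda>x. f x * B))" "j < dim_col (mat_sum d J (\<lambda>x. f x * B))"
  then have ij: "i < d" "j < d" by auto
  have "(mat_sum d J f * B) $$ (i, j) = (\<Sum>l<d. \<Sum>x\<in>J. f x $$ (i, l) * B $$ (l, j))"
    using ij assms by (simp add: sum_distrib_right del: index_mult_mat(1))
  also have "\<dots> = (\<Sum>x\<in>J. \<Sum>l<d. f x $$ (i, l) * B $$ (l, j))" by (rule sum.swap)
  also have "\<dots> = (\<Sum>x\<in>J. (f x * B) $$ (i, j))"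
    by (rule sum.cong [OF refl]) (use ij assms in \<open>fastforce simp del: index_mult_mat(1)\<close>)
  finally show "(mat_sum d J f * B) $$ (i, j) = mat_sum d J (\<lambda>x. f x * B) $$ (i, j)"
    using ij by simp
qed (use assms in auto)

lemma smult_mat_sum:
  assumes "\<And>x. x \<in> J \<Longrightarrow> f x \<in> carrier_mat d d"
  shows "c \<cdot>\<^sub>m mat_sum d J f = mat_sum d J (\<lambda>x. c \<cdot>\<^sub>m f x)"
proof (rule eq_matI)
  fix i j assume "i < dim_row (mat_sum d J (\<lambda>x. c \<cdot>\<^sub>m f x))" "j < dim_col (mat_sum d J (\<lambda>x. c \<cdot>\<^sub>m f x))"
  then have ij: "i < d" "j < d" by auto
  have e: "(c \<cdot>\<^sub>m f x) $$ (i, j) = c * f x $$ (i, j)" if "x \<in> J" for x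
    using assms[OF that] ij by auto
  show "(c \<cdot>\<^sub>m mat_sum d J f) $$ (i, j) = mat_sum d J (\<lambda>x. c \<cdot>\<^sub>m f x) $$ (i, j)"
    using ij e by (simp add: sum_distrib_left)
qed auto

lemma adjoint_mat_sum:
  assumes "\<And>x. x \<in> J \<Longrightarrow> f x \<in> carrier_mat d d"
  shows "(mat_sum d J f)\<^sup>\<dagger> = mat_sum d J (\<lambda>x. (f x)\<^sup>\<dagger>)"
proof (rule eq_matI)
  fix i j assume "i < dim_row (mat_sum d J (\<lambda>x. (f x)\<^sup>\<dagger>))" "j < dim_col (mat_sum d J (\<lambda>x. (f x)\<^sup>\<dagger>))"
  then have ij: "i < d" "j < d" by auto
  have e: "(f x)\<^sup>\<dagger> $$ (i, j) = cnj (f x $$ (j, i))" if "x \<in> J" for x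
    using assms[OF that] ij by auto
  show "(mat_sum d J f)\<^sup>\<dagger> $$ (i, j) = mat_sum d J (\<lambda>x. (f x)\<^sup>\<dagger>) $$ (i, j)"
    using ij e by simp
qed auto

lemma mat_trace_sum:
  assumes "\<And>x. x \<in> J \<Longrightarrow> f x \<in> carrier_mat d d"
  shows "mat_trace (mat_sum d J f) = (\<Sum>x\<in>J. mat_trace (f x))"
proof -
  have "mat_trace (mat_sum d J f) = (\<Sum>i<d. \<Sum>x\<in>J. f x $$ (i, i))"
    by (simp add: mat_trace_def)
  also have "\<dots> = (\<Sum>x\<in>J. \<Sum>i<d. f x $$ (i, i))" by (rule sum.swap)
  also have "\<dots> = (\<Sum>x\<in>J. mat_trace (f x))"
    by (rule sum.cong [OF refl]) (use assms in \<open>fastforce simp: mat_trace_def\<close>)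
  finally show ?thesis .
qed

lemma mat_trace_minus:
  "A \<in> carrier_mat d d \<Longrightarrow> B \<in> carrier_mat d d \<Longrightarrow> mat_trace (A - B) = mat_trace A - mat_trace B"
  by (auto simp: mat_trace_def sum_subtractf)

lemma mat_trace_smult: "A \<in> carrier_mat d d \<Longrightarrow> mat_trace (c \<cdot>\<^sub>m A) = c * mat_trace A"
  by (auto simp: mat_trace_def sum_distrib_left)

lemma mat_trace_comm:
  assumes "A \<in> carrier_mat n m" "B \<in> carrier_mat m n"
  shows "mat_trace (A * B) = mat_trace (B * A)"
proof -
  have "mat_trace (A * B) = (\<Sum>i<n. \<Sum>l<m. A $$ (i, l) * B $$ (l, i))"
    using assms by (simp add: mat_trace_def del: index_mult_mat(1))
  also have "\<dots> = (\<Sum>l<m. \<Sum>i<n. A $$ (i, l) * B $$ (l, i))" by (rule sum.swap)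
  also have "\<dots> = mat_trace (B * A)"
    using assms by (simp add: mat_trace_def mult.commute del: index_mult_mat(1))
  finally show ?thesis .
qed

section \<open>Euclidean and operator norm\<close>

lemma vec_l2_L2_set: "vec_l2 v = L2_set (\<lambda>i. cmod (vec_index v i)) {..<dim_vec v}"
  by (simp add: vec_l2_def L2_set_def)

lemma vec_l2_nonneg [simp]: "0 \<le> vec_l2 v"
  by (simp add: vec_l2_def sum_nonneg)

lemma vec_l2_sq: "(vec_l2 v)\<^sup>2 = (\<Sum>i<dim_vec v. (cmod (vec_index v i))\<^sup>2)"
  by (simp add: vec_l2_def sum_nonneg)

lemma cscalar_prod_index:
  fixes v w :: "complex vec"
  shows "dim_vec v = dim_vec w \<Longrightarrow> v \<bullet>c w = (\<Sum>i<dim_vec w. vec_index v i * cnj (vec_index w i))"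
  by (simp add: scalar_prod_def lessThan_atLeast0)

lemma cscalar_prod_self: "v \<bullet>c v = complex_of_real ((vec_l2 v)\<^sup>2)"
  unfolding vec_l2_sq by (simp only: cscalar_prod_index complex_norm_square of_real_sum)

lemma vec_l2_smult: "vec_l2 (c \<cdot>\<^sub>v v) = cmod c * vec_l2 v"
proof -
  have "vec_l2 (c \<cdot>\<^sub>v v) = L2_set (\<lambda>i. cmod c * cmod (vec_index v i)) {..<dim_vec v}"
    unfolding vec_l2_L2_set by (intro L2_set_cong) (auto simp: norm_mult)
  then show ?thesis by (simp add: vec_l2_L2_set L2_set_right_distrib)
qed

lemma vec_l2_add: "dim_vec v = dim_vec w \<Longrightarrow> vec_l2 (v + w) \<le> vec_l2 v + vec_l2 w"
proof -
  assume d: "dim_vec v = dim_vec w"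
  have "vec_l2 (v + w) \<le> L2_set (\<lambda>i. cmod (vec_index v i) + cmod (vec_index w i)) {..<dim_vec w}"
    unfolding vec_l2_L2_set using d by (auto intro!: L2_set_mono norm_triangle_ineq)
  also have "\<dots> \<le> vec_l2 v + vec_l2 w"
    unfolding vec_l2_L2_set d by (rule L2_set_triangle_ineq)
  finally show ?thesis .
qed

lemma vec_l2_zero [simp]: "vec_l2 (0\<^sub>v d) = 0"
  by (simp add: vec_l2_def)

lemma vec_l2_eq_0: "vec_l2 v = 0 \<Longrightarrow> v = 0\<^sub>v (dim_vec v)"
  by (rule eq_vecI) (auto simp: vec_l2_L2_set L2_set_eq_0_iff)

lemma cmod_cscalar_prod_le:
  fixes v w :: "complex vec"
  shows "dim_vec v = dim_vec w \<Longrightarrow> cmod (v \<bullet>c w) \<le> vec_l2 v * vec_l2 w"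
proof -
  assume d: "dim_vec v = dim_vec w"
  have "cmod (v \<bullet>c w) \<le> (\<Sum>i<dim_vec w. \<bar>cmod (vec_index v i)\<bar> * \<bar>cmod (vec_index w i)\<bar>)"
    unfolding cscalar_prod_index[OF d] by (rule sum_norm_le) (simp add: norm_mult)
  also have "\<dots> \<le> vec_l2 v * vec_l2 w"
    unfolding vec_l2_L2_set d by (rule L2_set_mult_ineq)
  finally show ?thesis .
qed

lemma cscalar_prod_adjoint:
  fixes A :: "complex mat"
  assumes "A \<in> carrier_mat n m" "v \<in> carrier_vec m" "w \<in> carrier_vec n"
  shows "(A *\<^sub>v v) \<bullet>c w = v \<bullet>c (A\<^sup>\<dagger> *\<^sub>v w)"
proof -
  have "(A *\<^sub>v v) \<bullet>c w = (\<Sum>i<n. \<Sum>l<m. A $$ (i, l) * vec_index v l * cnj (vec_index w i))"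
    using assms by (simp add: cscalar_prod_index index_mult_vec sum_distrib_right del: index_mult_mat_vec)
  also have "\<dots> = (\<Sum>l<m. \<Sum>i<n. A $$ (i, l) * vec_index v l * cnj (vec_index w i))" by (rule sum.swap)
  also have "\<dots> = v \<bullet>c (A\<^sup>\<dagger> *\<^sub>v w)"
    using assms by (simp add: cscalar_prod_index index_mult_vec sum_distrib_left mult_ac del: index_mult_mat_vec)
  finally show ?thesis .
qed

text \<open>Upper bounds are easier to propagate through sums, products and adjoints than the
  supremum \<open>spectral_norm\<close>, whose use requires boundedness.
  \<open>op_bound_spectral_norm\<close> and \<open>spectral_norm_le\<close> translate between the
  two.\<close>

definition op_bound :: "complex mat \<Rightarrow> real \<Rightarrow> bool" where
  "op_bound A c \<longleftrightarrow> (\<forall>v\<in>carrier_vec (dim_col A). vec_l2 (A *\<^sub>v v) \<le> c * vec_l2 v)"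

lemma op_boundI: "A \<in> carrier_mat n m \<Longrightarrow> (\<And>v. v \<in> carrier_vec m \<Longrightarrow> vec_l2 (A *\<^sub>v v) \<le> c * vec_l2 v) \<Longrightarrow> op_bound A c"
  by (auto simp: op_bound_def)

lemma op_boundD: "op_bound A c \<Longrightarrow> A \<in> carrier_mat n m \<Longrightarrow> v \<in> carrier_vec m \<Longrightarrow> vec_l2 (A *\<^sub>v v) \<le> c * vec_l2 v"
  by (auto simp: op_bound_def)

text \<open>A crude bound whose purpose is to show that the supremum in \<open>spectral_norm\<close>
  is taken over a bounded set.\<close>

lemma op_bound_entries: "op_bound A (\<Sum>i<dim_row A. \<Sum>l<dim_col A. cmod (A $$ (i, l)))"
proof (rule op_boundI)
  fix v :: "complex vec" assume v: "v \<in> carrier_vec (dim_col A)"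
  have le: "cmod (vec_index v l) \<le> vec_l2 v" if "l < dim_vec v" for l
    unfolding vec_l2_L2_set using member_le_L2_set[of "{..<dim_vec v}" l] that by simp
  have "vec_l2 (A *\<^sub>v v) \<le> (\<Sum>i<dim_row A. cmod (vec_index (A *\<^sub>v v) i))"
    unfolding vec_l2_L2_set dim_mult_mat_vec by (rule L2_set_le_sum) auto
  also have "\<dots> \<le> (\<Sum>i<dim_row A. \<Sum>l<dim_col A. cmod (A $$ (i, l)) * vec_l2 v)"
    using v le by (intro sum_mono)
      (auto simp: index_mult_vec norm_mult simp del: index_mult_mat_vec intro!: sum_norm_le mult_left_mono)
  finally show "vec_l2 (A *\<^sub>v v) \<le> (\<Sum>i<dim_row A. \<Sum>l<dim_col A. cmod (A $$ (i, l))) * vec_l2 v"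
    by (simp add: sum_distrib_right)
qed auto

lemma spectral_norm_le:
  assumes "op_bound A c" "0 \<le> c"
  shows "spectral_norm A \<le> c"
  unfolding spectral_norm_def
proof (rule cSUP_least)
  show "{v \<in> carrier_vec (dim_col A). vec_l2 v \<le> 1} \<noteq> {}"
    using vec_l2_zero[of "dim_col A"] by (auto intro!: exI[of _ "0\<^sub>v (dim_col A)"])
  fix v assume "v \<in> {v \<in> carrier_vec (dim_col A). vec_l2 v \<le> 1}"
  then have "vec_l2 (A *\<^sub>v v) \<le> c * vec_l2 v" "c * vec_l2 v \<le> c * 1"
    using assms mult_left_mono[of "vec_l2 v" 1 c] by (auto simp: op_bound_def)
  then show "vec_l2 (A *\<^sub>v v) \<le> c" by simp
qed

lemma bdd_above_spectral_norm:
  "bdd_above ((\<lambda>v. vec_l2 (A *\<^sub>v v)) ` {v \<in> carrier_vec (dim_col A). vec_l2 v \<le> 1})"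
proof (rule bdd_aboveI)
  let ?c = "\<Sum>i<dim_row A. \<Sum>l<dim_col A. cmod (A $$ (i, l))"
  fix y assume "y \<in> (\<lambda>v. vec_l2 (A *\<^sub>v v)) ` {v \<in> carrier_vec (dim_col A). vec_l2 v \<le> 1}"
  then obtain v where v: "v \<in> carrier_vec (dim_col A)" "vec_l2 v \<le> 1" "y = vec_l2 (A *\<^sub>v v)" by auto
  have "y \<le> ?c * vec_l2 v" using op_bound_entries[of A] v by (auto simp: op_bound_def)
  also have "\<dots> \<le> ?c * 1" using v by (intro mult_left_mono sum_nonneg) auto
  finally show "y \<le> ?c" by simp
qed

lemma op_bound_spectral_norm: "op_bound A (spectral_norm A)"
proof (rule op_boundI)
  fix v :: "complex vec" assume v: "v \<in> carrier_vec (dim_col A)"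
  show "vec_l2 (A *\<^sub>v v) \<le> spectral_norm A * vec_l2 v"
  proof (cases "vec_l2 v = 0")
    case True
    then have "v = 0\<^sub>v (dim_col A)" using vec_l2_eq_0[of v] v by auto
    then have "A *\<^sub>v v = 0\<^sub>v (dim_row A)" by (auto intro!: eq_vecI)
    then show ?thesis using True by simp
  next
    case False
    then have pos: "0 < vec_l2 v" using vec_l2_nonneg[of v] by linarith
    let ?u = "complex_of_real (1 / vec_l2 v) \<cdot>\<^sub>v v"
    have u: "?u \<in> carrier_vec (dim_col A)" "vec_l2 ?u \<le> 1"
      using v pos by (auto simp: vec_l2_smult norm_divide)
    have "vec_l2 (A *\<^sub>v ?u) \<le> spectral_norm A"
      unfolding spectral_norm_def by (rule cSUP_upper[OF _ bdd_above_spectral_norm]) (use u in auto)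
    moreover have "A *\<^sub>v ?u = complex_of_real (1 / vec_l2 v) \<cdot>\<^sub>v (A *\<^sub>v v)"
      using v by (intro mult_mat_vec) auto
    ultimately show ?thesis using pos by (simp add: vec_l2_smult norm_divide field_simps)
  qed
qed auto

lemma spectral_norm_nonneg [simp]: "0 \<le> spectral_norm A"
proof -
  have "vec_l2 (A *\<^sub>v 0\<^sub>v (dim_col A)) \<le> spectral_norm A"
    unfolding spectral_norm_def by (rule cSUP_upper[OF _ bdd_above_spectral_norm]) auto
  then show ?thesis by (rule order_trans[OF vec_l2_nonneg])
qed

lemma op_bound_add:
  assumes "A \<in> carrier_mat n m" "B \<in> carrier_mat n m" "op_bound A a" "op_bound B b"
  shows "op_bound (A + B) (a + b)"
proof (rule op_boundI)
  fix v :: "complex vec" assume v: "v \<in> carrier_vec m"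
  have "vec_l2 ((A + B) *\<^sub>v v) = vec_l2 (A *\<^sub>v v + B *\<^sub>v v)"
    using assms v by (simp add: add_mult_distrib_mat_vec)
  also have "\<dots> \<le> vec_l2 (A *\<^sub>v v) + vec_l2 (B *\<^sub>v v)" using assms by (intro vec_l2_add) auto
  also have "\<dots> \<le> a * vec_l2 v + b * vec_l2 v" using assms v by (intro add_mono op_boundD) auto
  finally show "vec_l2 ((A + B) *\<^sub>v v) \<le> (a + b) * vec_l2 v" by (simp add: algebra_simps)
qed (use assms in auto)

lemma op_bound_smult:
  assumes "A \<in> carrier_mat n m" "op_bound A a"
  shows "op_bound (c \<cdot>\<^sub>m A) (cmod c * a)"
proof (rule op_boundI)
  fix v :: "complex vec" assume v: "v \<in> carrier_vec m"
  have "(c \<cdot>\<^sub>m A) *\<^sub>v v = c \<cdot>\<^sub>v (A *\<^sub>v v)" using assms v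
    by (intro eq_vecI) (auto simp: index_mult_vec sum_distrib_left mult_ac simp del: index_mult_mat_vec)
  then show "vec_l2 ((c \<cdot>\<^sub>m A) *\<^sub>v v) \<le> cmod c * a * vec_l2 v"
    using op_boundD[OF assms(2,1) v] by (simp add: vec_l2_smult mult_left_mono mult.assoc)
qed (use assms in auto)

lemma op_bound_mult:
  assumes "A \<in> carrier_mat n m" "B \<in> carrier_mat m k" "op_bound A a" "op_bound B b" "0 \<le> a"
  shows "op_bound (A * B) (a * b)"
proof (rule op_boundI)
  fix v :: "complex vec" assume v: "v \<in> carrier_vec k"
  have "vec_l2 ((A * B) *\<^sub>v v) = vec_l2 (A *\<^sub>v (B *\<^sub>v v))"
    using assms v by (simp add: assoc_mult_mat_vec)
  also have "\<dots> \<le> a * vec_l2 (B *\<^sub>v v)" using assms v by (intro op_boundD[of A a n m]) auto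
  also have "\<dots> \<le> a * (b * vec_l2 v)" using assms v by (intro mult_left_mono op_boundD) auto
  finally show "vec_l2 ((A * B) *\<^sub>v v) \<le> (a * b) * vec_l2 v" by (simp add: mult.assoc)
qed (use assms in auto)

lemma op_bound_mat_sum:
  assumes "finite J" "\<And>x. x \<in> J \<Longrightarrow> f x \<in> carrier_mat d d" "\<And>x. x \<in> J \<Longrightarrow> op_bound (f x) (g x)"
  shows "op_bound (mat_sum d J f) (sum g J)"
  using assms
proof (induction rule: finite_induct)
  case empty
  have "0\<^sub>m d d *\<^sub>v v = 0\<^sub>v d" if "v \<in> carrier_vec d" for v :: "complex vec"
    using that by auto
  then show ?case by (auto simp: mat_sum_empty op_bound_def)
next
  case (insert x J)
  then show ?case
    by (simp add: mat_sum_insert) (rule op_bound_add[of _ d d], auto)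
qed

text \<open>For w the image of v under the adjoint, |w|^2 = <v, A w>, which Cauchy-Schwarz bounds by
  |v| a |w|; dividing by |w| gives the claim.\<close>

lemma op_bound_adjoint:
  assumes A: "A \<in> carrier_mat n m" and a: "op_bound A a" "0 \<le> a"
  shows "op_bound (A\<^sup>\<dagger>) a"
proof (rule op_boundI)
  fix v :: "complex vec" assume v: "v \<in> carrier_vec n"
  let ?w = "A\<^sup>\<dagger> *\<^sub>v v"
  have w: "?w \<in> carrier_vec m" by (rule mult_mat_vec_carrier[OF adjoint_carrier[OF A] v])
  have "(vec_l2 ?w)\<^sup>2 = cmod (?w \<bullet>c ?w)" by (simp add: cscalar_prod_self norm_power)
  also have "?w \<bullet>c ?w = v \<bullet>c (A *\<^sub>v ?w)"
    using cscalar_prod_adjoint[of "A\<^sup>\<dagger>" m n v ?w] A v w by simp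
  also have "cmod \<dots> \<le> vec_l2 v * vec_l2 (A *\<^sub>v ?w)" using A v by (intro cmod_cscalar_prod_le) auto
  also have "\<dots> \<le> vec_l2 v * (a * vec_l2 ?w)" using A w a by (intro mult_left_mono op_boundD) auto
  finally have "vec_l2 ?w * vec_l2 ?w \<le> (a * vec_l2 v) * vec_l2 ?w" by (simp add: power2_eq_square mult_ac)
  then show "vec_l2 ?w \<le> a * vec_l2 v"
    using vec_l2_nonneg[of ?w] a mult_right_le_imp_le[of "vec_l2 ?w" "vec_l2 ?w" "a * vec_l2 v"]
    by (cases "vec_l2 ?w = 0") auto
qed (use A in auto)

lemma op_bound_isometry:
  assumes "A \<in> carrier_mat n m" "A\<^sup>\<dagger> * A = 1\<^sub>m m"
  shows "op_bound A 1"
proof (rule op_boundI)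
  fix v :: "complex vec" assume v: "v \<in> carrier_vec m"
  have "(A *\<^sub>v v) \<bullet>c (A *\<^sub>v v) = v \<bullet>c (A\<^sup>\<dagger> *\<^sub>v (A *\<^sub>v v))"
    using assms v by (intro cscalar_prod_adjoint) auto
  also have "A\<^sup>\<dagger> *\<^sub>v (A *\<^sub>v v) = v" using assms v assoc_mult_mat_vec[of "A\<^sup>\<dagger>" m n A m v] by simp
  finally have "(vec_l2 (A *\<^sub>v v))\<^sup>2 = (vec_l2 v)\<^sup>2"
    unfolding cscalar_prod_self of_real_eq_iff .
  then show "vec_l2 (A *\<^sub>v v) \<le> 1 * vec_l2 v" by simp
qed (use assms in auto)

lemma op_bound_sesquilinear:
  assumes "A \<in> carrier_mat n m" "op_bound A a" "v \<in> carrier_vec m" "w \<in> carrier_vec n"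
  shows "cmod ((A *\<^sub>v v) \<bullet>c w) \<le> a * vec_l2 v * vec_l2 w"
proof -
  have "cmod ((A *\<^sub>v v) \<bullet>c w) \<le> vec_l2 (A *\<^sub>v v) * vec_l2 w"
    using assms by (intro cmod_cscalar_prod_le) auto
  also have "\<dots> \<le> a * vec_l2 v * vec_l2 w" using assms by (intro mult_right_mono op_boundD) auto
  finally show ?thesis .
qed

text \<open>Test with w = A v. Matrices such as \<open>slice\<close>, known through their traces
  against rank-one matrices, are bounded in this way.\<close>

lemma op_bound_of_sesquilinear:
  assumes A: "A \<in> carrier_mat n m"
    and le: "\<And>v w. v \<in> carrier_vec m \<Longrightarrow> w \<in> carrier_vec n \<Longrightarrow> cmod ((A *\<^sub>v v) \<bullet>c w) \<le> a * vec_l2 v * vec_l2 w"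
    and "0 \<le> a"
  shows "op_bound A a"
proof (rule op_boundI[OF A])
  fix v :: "complex vec" assume v: "v \<in> carrier_vec m"
  let ?w = "A *\<^sub>v v"
  have "vec_l2 ?w * vec_l2 ?w \<le> (a * vec_l2 v) * vec_l2 ?w"
    using le[OF v, of ?w] A v by (simp add: cscalar_prod_self norm_mult power2_eq_square)
  then show "vec_l2 ?w \<le> a * vec_l2 v"
    using vec_l2_nonneg[of ?w] \<open>0 \<le> a\<close> mult_right_le_imp_le[of "vec_l2 ?w" "vec_l2 ?w" "a * vec_l2 v"]
    by (cases "vec_l2 ?w = 0") auto
qed

section \<open>Tensor products and partial traces\<close>

lemma product_index_div: "b < e \<Longrightarrow> (a * e + b) div e = (a::nat)"
  and product_index_mod: "b < e \<Longrightarrow> (a * e + b) mod e = (b::nat)"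
  by auto

lemma kron_carrier [simp]:
  "A \<in> carrier_mat n m \<Longrightarrow> B \<in> carrier_mat n' m' \<Longrightarrow> A \<Otimes> B \<in> carrier_mat (n * n') (m * m')"
  by (auto simp: kron_def)

lemma dim_kron [simp]:
  "dim_row (A \<Otimes> B) = dim_row A * dim_row B" "dim_col (A \<Otimes> B) = dim_col A * dim_col B"
  by (simp_all add: kron_def)

lemma index_kron:
  assumes "A \<in> carrier_mat n m" "B \<in> carrier_mat n' m'" "a < n" "b < n'" "a' < m" "b' < m'"
  shows "(A \<Otimes> B) $$ (a * n' + b, a' * m' + b') = A $$ (a, a') * B $$ (b, b')"
  using assms product_index_less[of a n b n'] product_index_less[of a' m b' m']
  by (auto simp: kron_def product_index_div product_index_mod)

lemma eq_mat_productI: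
  assumes M: "M \<in> carrier_mat (n * e) (m * f)" and N: "N \<in> carrier_mat (n * e) (m * f)"
    and eq: "\<And>a b a' b'. a < n \<Longrightarrow> b < e \<Longrightarrow> a' < m \<Longrightarrow> b' < f \<Longrightarrow>
      M $$ (a * e + b, a' * f + b') = N $$ (a * e + b, a' * f + b')"
  shows "M = N"
proof (rule eq_matI)
  fix i j assume "i < dim_row N" "j < dim_col N"
  then have ij: "i < n * e" "j < m * f" using N by auto
  show "M $$ (i, j) = N $$ (i, j)"
    using eq[of "i div e" "i mod e" "j div f" "j mod f"]
      less_product_div[OF ij(1)] less_product_div[OF ij(2)] less_product_mod[OF ij(1)] less_product_mod[OF ij(2)]
    by simp
qed (use M N in auto)

lemma index_mult_product:
  assumes "A \<in> carrier_mat n (m * f)" "B \<in> carrier_mat (m * f) k" "i < n" "j < k"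
  shows "(A * B) $$ (i, j) = (\<Sum>a<m. \<Sum>b<f. A $$ (i, a * f + b) * B $$ (a * f + b, j))"
proof -
  have "(A * B) $$ (i, j) = (\<Sum>l<m * f. A $$ (i, l) * B $$ (l, j))" using assms by (simp del: index_mult_mat(1))
  then show ?thesis by (simp only: sum_product_index)
qed

lemma kron_mult:
  assumes A: "A \<in> carrier_mat n m" and B: "B \<in> carrier_mat n' m'"
    and C: "C \<in> carrier_mat m k" and D: "D \<in> carrier_mat m' k'"
  shows "(A \<Otimes> B) * (C \<Otimes> D) = (A * C) \<Otimes> (B * D)"
proof (rule eq_mat_productI)
  show "(A \<Otimes> B) * (C \<Otimes> D) \<in> carrier_mat (n * n') (k * k')"
    using mult_carrier_mat[OF kron_carrier[OF A B] kron_carrier[OF C D]] .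
  show "(A * C) \<Otimes> (B * D) \<in> carrier_mat (n * n') (k * k')" using assms by (intro kron_carrier) auto
  fix a b a' b' assume ab: "a < n" "b < n'" "a' < k" "b' < k'"
  have "((A \<Otimes> B) * (C \<Otimes> D)) $$ (a * n' + b, a' * k' + b')
    = (\<Sum>l<m. \<Sum>l'<m'. (A \<Otimes> B) $$ (a * n' + b, l * m' + l') * (C \<Otimes> D) $$ (l * m' + l', a' * k' + b'))"
    by (rule index_mult_product[OF kron_carrier[OF A B] kron_carrier[OF C D]])
      (use ab product_index_less in auto)
  also have "\<dots> = (\<Sum>l<m. \<Sum>l'<m'. (A $$ (a, l) * C $$ (l, a')) * (B $$ (b, l') * D $$ (l', b')))"
    using ab by (intro sum.cong refl) (simp add: index_kron[OF A B] index_kron[OF C D] mult_ac)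
  also have "\<dots> = (A * C) $$ (a, a') * (B * D) $$ (b, b')"
    using ab assms by (simp add: sum_product del: index_mult_mat(1))
  also have "\<dots> = ((A * C) \<Otimes> (B * D)) $$ (a * n' + b, a' * k' + b')"
    using ab assms by (intro index_kron[symmetric] mult_carrier_mat)
  finally show "((A \<Otimes> B) * (C \<Otimes> D)) $$ (a * n' + b, a' * k' + b') = ((A * C) \<Otimes> (B * D)) $$ (a * n' + b, a' * k' + b')" .
qed

lemma kron_adjoint:
  assumes A: "A \<in> carrier_mat n m" and B: "B \<in> carrier_mat n' m'"
  shows "(A \<Otimes> B)\<^sup>\<dagger> = A\<^sup>\<dagger> \<Otimes> B\<^sup>\<dagger>"
proof (rule eq_mat_productI)
  show "(A \<Otimes> B)\<^sup>\<dagger> \<in> carrier_mat (m * m') (n * n')" "A\<^sup>\<dagger> \<Otimes> B\<^sup>\<dagger> \<in> carrier_mat (m * m') (n * n')"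
    using assms by (auto intro!: kron_carrier adjoint_carrier)
  fix a b a' b' assume ab: "a < m" "b < m'" "a' < n" "b' < n'"
  have "(A \<Otimes> B)\<^sup>\<dagger> $$ (a * m' + b, a' * n' + b') = cnj ((A \<Otimes> B) $$ (a' * n' + b', a * m' + b))"
    using ab assms product_index_less by (intro index_adjoint) auto
  also have "\<dots> = (A\<^sup>\<dagger> \<Otimes> B\<^sup>\<dagger>) $$ (a * m' + b, a' * n' + b')"
    using ab assms
    by (simp add: index_kron[OF A B] index_kron[OF adjoint_carrier[OF A] adjoint_carrier[OF B]])
  finally show "(A \<Otimes> B)\<^sup>\<dagger> $$ (a * m' + b, a' * n' + b') = (A\<^sup>\<dagger> \<Otimes> B\<^sup>\<dagger>) $$ (a * m' + b, a' * n' + b')" .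
qed

lemma one_kron_one: "(1\<^sub>m n \<Otimes> 1\<^sub>m m) = 1\<^sub>m (n * m)"
proof (rule eq_mat_productI[of _ n m n m])
  fix a b a' b' assume ab: "a < n" "b < m" "a' < n" "b' < m"
  have "a * m + b = a' * m + b' \<longleftrightarrow> a = a' \<and> b = b'"
    using ab by (metis product_index_div product_index_mod)
  then show "(1\<^sub>m n \<Otimes> 1\<^sub>m m) $$ (a * m + b, a' * m + b') = 1\<^sub>m (n * m) $$ (a * m + b, a' * m + b')"
    using ab product_index_less[of a n b m] product_index_less[of a' n b' m]
    by (subst index_kron[of _ n n _ m m]) auto
qed (auto intro!: carrier_matI)

lemma kron_trace:
  assumes A: "A \<in> carrier_mat n n" and B: "B \<in> carrier_mat m m"
  shows "mat_trace (A \<Otimes> B) = mat_trace A * mat_trace B"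
proof -
  have "mat_trace (A \<Otimes> B) = (\<Sum>a<n. \<Sum>b<m. (A \<Otimes> B) $$ (a * m + b, a * m + b))"
    using assms by (simp add: mat_trace_def sum_product_index)
  also have "\<dots> = (\<Sum>a<n. \<Sum>b<m. A $$ (a, a) * B $$ (b, b))"
    by (intro sum.cong refl) (simp add: index_kron[OF A B])
  also have "\<dots> = mat_trace A * mat_trace B" using assms by (simp add: mat_trace_def sum_product)
  finally show ?thesis .
qed

lemma mat_trace_mult:
  assumes "A \<in> carrier_mat n m" "B \<in> carrier_mat m n"
  shows "mat_trace (A * B) = (\<Sum>i<n. \<Sum>l<m. A $$ (i, l) * B $$ (l, i))"
  using assms by (simp add: mat_trace_def del: index_mult_mat(1))

lemma mat_trace_mult_product:
  assumes "A \<in> carrier_mat (n * e) (m * f)" "B \<in> carrier_mat (m * f) (n * e)"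
  shows "mat_trace (A * B) =
    (\<Sum>i<n. \<Sum>k<e. \<Sum>j<m. \<Sum>l<f. A $$ (i * e + k, j * f + l) * B $$ (j * f + l, i * e + k))"
  using mat_trace_mult[OF assms] by (simp only: sum_product_index)

lemma ptrace_carrier [simp]: "ptrace_snd d e M \<in> carrier_mat d d"
  by (simp add: ptrace_snd_def)

lemma index_ptrace [simp]:
  "i < d \<Longrightarrow> j < d \<Longrightarrow> ptrace_snd d e M $$ (i, j) = (\<Sum>k<e. M $$ (i * e + k, j * e + k))"
  by (simp add: ptrace_snd_def)

lemma mat_trace_ptrace:
  assumes "M \<in> carrier_mat (d * e) (d * e)"
  shows "mat_trace (ptrace_snd d e M) = mat_trace M"
  using assms by (simp add: mat_trace_def sum_product_index) (simp add: ptrace_snd_def)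

text \<open>Under the trace pairing the partial trace is dual to tensoring with the identity. This
  moves the environment from the state to the observable.\<close>

lemma mat_trace_mult_ptrace:
  assumes A: "A \<in> carrier_mat d d" and M: "M \<in> carrier_mat (d * e) (d * e)"
  shows "mat_trace (A * ptrace_snd d e M) = mat_trace ((A \<Otimes> 1\<^sub>m e) * M)"
proof -
  have "mat_trace ((A \<Otimes> 1\<^sub>m e) * M) =
    (\<Sum>i<d. \<Sum>k<e. \<Sum>j<d. \<Sum>l<e. (A \<Otimes> 1\<^sub>m e) $$ (i * e + k, j * e + l) * M $$ (j * e + l, i * e + k))"
    by (rule mat_trace_mult_product[OF kron_carrier[OF A one_carrier_mat] M])
  also have "\<dots> = (\<Sum>i<d. \<Sum>k<e. \<Sum>j<d. \<Sum>l<e. if k = l then A $$ (i, j) * M $$ (j * e + k, i * e + k) else 0)"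
    by (intro sum.cong refl) (auto simp: index_kron[OF A one_carrier_mat])
  also have "\<dots> = (\<Sum>i<d. \<Sum>k<e. \<Sum>j<d. A $$ (i, j) * M $$ (j * e + k, i * e + k))"
    by (intro sum.cong refl) (simp add: sum.delta')
  also have "\<dots> = (\<Sum>i<d. \<Sum>j<d. \<Sum>k<e. A $$ (i, j) * M $$ (j * e + k, i * e + k))"
    by (intro sum.cong refl sum.swap)
  also have "\<dots> = mat_trace (A * ptrace_snd d e M)"
    unfolding mat_trace_mult[OF A ptrace_carrier] by (intro sum.cong refl) (simp add: sum_distrib_left)
  finally show ?thesis ..
qed

text \<open>The partial trace of \<open>(1 \<Otimes> \<rho>) B\<close> over the second factor.\<close>

definition slice :: "nat \<Rightarrow> nat \<Rightarrow> complex mat \<Rightarrow> complex mat \<Rightarrow> complex mat" where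
  "slice d e \<rho> B = mat d d (\<lambda>(i, j). \<Sum>k<e. \<Sum>l<e. B $$ (i * e + k, j * e + l) * \<rho> $$ (l, k))"

lemma slice_carrier [simp]: "slice d e \<rho> B \<in> carrier_mat d d"
  by (simp add: slice_def)

text \<open>The duality that motivates \<open>slice\<close>: it is the adjoint of tensoring with
  \<rho>, hence the last step of a channel in the Heisenberg picture.\<close>

lemma mat_trace_slice:
  assumes B: "B \<in> carrier_mat (d * e) (d * e)" and X: "X \<in> carrier_mat d d" and R: "\<rho> \<in> carrier_mat e e"
  shows "mat_trace (slice d e \<rho> B * X) = mat_trace (B * (X \<Otimes> \<rho>))"
proof -
  have "mat_trace (B * (X \<Otimes> \<rho>)) =
    (\<Sum>i<d. \<Sum>k<e. \<Sum>j<d. \<Sum>l<e. B $$ (i * e + k, j * e + l) * (X \<Otimes> \<rho>) $$ (j * e + l, i * e + k))"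
    by (rule mat_trace_mult_product[OF B kron_carrier[OF X R]])
  also have "\<dots> = (\<Sum>i<d. \<Sum>k<e. \<Sum>j<d. \<Sum>l<e. B $$ (i * e + k, j * e + l) * \<rho> $$ (l, k) * X $$ (j, i))"
    by (intro sum.cong refl) (simp add: index_kron[OF X R])
  also have "\<dots> = (\<Sum>i<d. \<Sum>j<d. \<Sum>k<e. \<Sum>l<e. B $$ (i * e + k, j * e + l) * \<rho> $$ (l, k) * X $$ (j, i))"
    by (intro sum.cong refl sum.swap)
  also have "\<dots> = mat_trace (slice d e \<rho> B * X)"
    unfolding mat_trace_mult[OF slice_carrier X]
    by (intro sum.cong refl) (simp add: slice_def sum_distrib_right)
  finally show ?thesis ..
qed

definition outer :: "complex vec \<Rightarrow> complex vec \<Rightarrow> complex mat" where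
  "outer v w = mat (dim_vec v) (dim_vec w) (\<lambda>(i, j). vec_index v i * cnj (vec_index w j))"

lemma outer_carrier [simp]: "v \<in> carrier_vec n \<Longrightarrow> w \<in> carrier_vec m \<Longrightarrow> outer v w \<in> carrier_mat n m"
  by (auto simp: outer_def)

text \<open>Makes the duality rules for traces available for sesquilinear forms.\<close>

lemma mat_trace_outer:
  assumes "A \<in> carrier_mat n m" "v \<in> carrier_vec m" "w \<in> carrier_vec n"
  shows "mat_trace (A * outer v w) = (A *\<^sub>v v) \<bullet>c w"
  unfolding mat_trace_mult[OF assms(1) outer_carrier[OF assms(2,3)]]
  using assms
  by (auto simp: cscalar_prod_index index_mult_vec outer_def sum_distrib_right mult.assoc
      simp del: index_mult_mat_vec intro!: sum.cong)

definition vec_kron :: "complex vec \<Rightarrow> complex vec \<Rightarrow> complex vec" where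
  "vec_kron v c = vec (dim_vec v * dim_vec c)
     (\<lambda>i. vec_index v (i div dim_vec c) * vec_index c (i mod dim_vec c))"

lemma vec_kron_carrier [simp]:
  "v \<in> carrier_vec n \<Longrightarrow> c \<in> carrier_vec m \<Longrightarrow> vec_kron v c \<in> carrier_vec (n * m)"
  by (auto simp: vec_kron_def)

lemma index_vec_kron:
  "v \<in> carrier_vec n \<Longrightarrow> c \<in> carrier_vec m \<Longrightarrow> a < n \<Longrightarrow> b < m \<Longrightarrow>
    vec_index (vec_kron v c) (a * m + b) = vec_index v a * vec_index c b"
  using product_index_less[of a n b m]
  by (auto simp: vec_kron_def product_index_div product_index_mod)

lemma vec_l2_kron: "vec_l2 (vec_kron v c) = vec_l2 v * vec_l2 c"
proof -
  have "(vec_l2 (vec_kron v c))\<^sup>2 = (\<Sum>a<dim_vec v. \<Sum>b<dim_vec c. (cmod (vec_index (vec_kron v c) (a * dim_vec c + b)))\<^sup>2)"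
  proof -
    have "dim_vec (vec_kron v c) = dim_vec v * dim_vec c" by (simp add: vec_kron_def)
    then show ?thesis by (simp only: vec_l2_sq sum_product_index)
  qed
  also have "\<dots> = (\<Sum>a<dim_vec v. \<Sum>b<dim_vec c. (cmod (vec_index v a))\<^sup>2 * (cmod (vec_index c b))\<^sup>2)"
    by (intro sum.cong refl) (simp add: index_vec_kron[OF carrier_vec_dim_vec carrier_vec_dim_vec] norm_mult power_mult_distrib)
  also have "\<dots> = (vec_l2 v * vec_l2 c)\<^sup>2" by (simp add: power_mult_distrib vec_l2_sq sum_product)
  finally show ?thesis using power2_eq_imp_eq[of "vec_l2 (vec_kron v c)" "vec_l2 v * vec_l2 c"] by simp
qed

text \<open>A Gram factor C splits the environment matrix into rank-one pieces, one for each column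
  of C. Estimates then only see product vectors, as if the environment were in one of finitely many
  unnormalised pure states.\<close>

lemma outer_kron_gram:
  assumes v: "v \<in> carrier_vec d" and w: "w \<in> carrier_vec d" and C: "C \<in> carrier_mat e f"
  shows "outer v w \<Otimes> (C * C\<^sup>\<dagger>) =
    mat_sum (d * e) {..<f} (\<lambda>k. outer (vec_kron v (col C k)) (vec_kron w (col C k)))"
proof (rule eq_mat_productI)
  have CC: "C * C\<^sup>\<dagger> \<in> carrier_mat e e" using C adjoint_carrier[OF C] by (rule mult_carrier_mat)
  show "outer v w \<Otimes> (C * C\<^sup>\<dagger>) \<in> carrier_mat (d * e) (d * e)"
    using v w CC by (intro kron_carrier outer_carrier)
  show "mat_sum (d * e) {..<f} (\<lambda>k. outer (vec_kron v (col C k)) (vec_kron w (col C k))) \<in> carrier_mat (d * e) (d * e)"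
    by simp
  fix a b a' b' assume ab: "a < d" "b < e" "a' < d" "b' < e"
  have c: "col C k \<in> carrier_vec e" for k using C by auto
  have "(outer v w \<Otimes> (C * C\<^sup>\<dagger>)) $$ (a * e + b, a' * e + b')
     = vec_index v a * cnj (vec_index w a') * (\<Sum>k<f. C $$ (b, k) * cnj (C $$ (b', k)))"
    using ab v w C by (subst index_kron[OF outer_carrier[OF v w] CC]) (auto simp: outer_def simp del: index_mult_mat(1))
  also have "\<dots> = (\<Sum>k<f. outer (vec_kron v (col C k)) (vec_kron w (col C k)) $$ (a * e + b, a' * e + b'))"
    unfolding sum_distrib_left
  proof (rule sum.cong [OF refl])
    fix k assume k: "k \<in> {..<f}"
    have l: "a * e + b < d * e" "a' * e + b' < d * e" using ab product_index_less by auto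
    have "outer (vec_kron v (col C k)) (vec_kron w (col C k)) $$ (a * e + b, a' * e + b')
      = vec_index (vec_kron v (col C k)) (a * e + b) * cnj (vec_index (vec_kron w (col C k)) (a' * e + b'))"
      using l vec_kron_carrier[OF v c[of k]] vec_kron_carrier[OF w c[of k]] by (auto simp: outer_def)
    then show "vec_index v a * cnj (vec_index w a') * (C $$ (b, k) * cnj (C $$ (b', k))) =
        outer (vec_kron v (col C k)) (vec_kron w (col C k)) $$ (a * e + b, a' * e + b')"
      using ab k C by (simp add: index_vec_kron[OF v c[of k]] index_vec_kron[OF w c[of k]])
  qed
  also have "\<dots> = mat_sum (d * e) {..<f} (\<lambda>k. outer (vec_kron v (col C k)) (vec_kron w (col C k))) $$ (a * e + b, a' * e + b')"
    using ab product_index_less by simp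
  finally show "(outer v w \<Otimes> (C * C\<^sup>\<dagger>)) $$ (a * e + b, a' * e + b') =
    mat_sum (d * e) {..<f} (\<lambda>k. outer (vec_kron v (col C k)) (vec_kron w (col C k))) $$ (a * e + b, a' * e + b')" .
qed

lemma mat_trace_gram:
  assumes C: "C \<in> carrier_mat e f"
  shows "mat_trace (C * C\<^sup>\<dagger>) = complex_of_real (\<Sum>k<f. (vec_l2 (col C k))\<^sup>2)"
proof -
  have "mat_trace (C * C\<^sup>\<dagger>) = (\<Sum>i<e. \<Sum>k<f. C $$ (i, k) * C\<^sup>\<dagger> $$ (k, i))"
    by (rule mat_trace_mult[OF C adjoint_carrier[OF C]])
  also have "\<dots> = (\<Sum>k<f. \<Sum>i<e. complex_of_real ((cmod (C $$ (i, k)))\<^sup>2))"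
    using C by (subst sum.swap) (auto intro!: sum.cong simp: complex_norm_square simp del: of_real_power)
  also have "\<dots> = complex_of_real (\<Sum>k<f. (vec_l2 (col C k))\<^sup>2)"
    using C by (auto simp: vec_l2_sq intro!: sum.cong)
  finally show ?thesis .
qed

text \<open>With c_k the columns of C, the form of the slice at (v, w) is the sum over k of the form
  of B at v tensor c_k and w tensor c_k. The squared norms of the c_k add up to the trace 1, so this
  averaging cannot increase the bound.\<close>

lemma op_bound_slice:
  assumes B: "B \<in> carrier_mat (d * e) (d * e)" "op_bound B b" "0 \<le> b"
    and C: "C \<in> carrier_mat e f" "\<rho> = C * C\<^sup>\<dagger>" "mat_trace \<rho> = 1"
  shows "op_bound (slice d e \<rho> B) b"
proof (rule op_bound_of_sesquilinear[OF slice_carrier _ B(3)])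
  fix v w :: "complex vec" assume v: "v \<in> carrier_vec d" and w: "w \<in> carrier_vec d"
  have c: "col C k \<in> carrier_vec e" for k using C by auto
  have R: "\<rho> \<in> carrier_mat e e" unfolding C(2) using C(1) adjoint_carrier[OF C(1)] by (rule mult_carrier_mat)
  let ?o = "\<lambda>k. outer (vec_kron v (col C k)) (vec_kron w (col C k))"
  have o: "?o k \<in> carrier_mat (d * e) (d * e)" for k using v w c by (intro outer_carrier vec_kron_carrier)
  have "(slice d e \<rho> B *\<^sub>v v) \<bullet>c w = mat_trace (slice d e \<rho> B * outer v w)"
    by (rule mat_trace_outer[OF slice_carrier v w, symmetric])
  also have "\<dots> = mat_trace (B * (outer v w \<Otimes> \<rho>))"
    by (rule mat_trace_slice[OF B(1) outer_carrier[OF v w] R])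
  also have "B * (outer v w \<Otimes> \<rho>) = mat_sum (d * e) {..<f} (\<lambda>k. B * ?o k)"
    unfolding C(2) outer_kron_gram[OF v w C(1)] using B(1) o by (rule mult_mat_sum)
  also have "mat_trace \<dots> = (\<Sum>k<f. mat_trace (B * ?o k))"
    using mult_carrier_mat[OF B(1) o] by (intro mat_trace_sum)
  also have "cmod \<dots> \<le> (\<Sum>k<f. b * vec_l2 v * vec_l2 w * (vec_l2 (col C k))\<^sup>2)"
  proof (rule sum_norm_le)
    fix k
    have "cmod (mat_trace (B * ?o k)) \<le> b * vec_l2 (vec_kron v (col C k)) * vec_l2 (vec_kron w (col C k))"
      using B v w c by (subst mat_trace_outer[OF B(1)]) (auto intro!: op_bound_sesquilinear vec_kron_carrier)
    then show "cmod (mat_trace (B * ?o k)) \<le> b * vec_l2 v * vec_l2 w * (vec_l2 (col C k))\<^sup>2"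
      by (simp add: vec_l2_kron power2_eq_square mult_ac)
  qed
  also have "\<dots> = b * vec_l2 v * vec_l2 w * (\<Sum>k<f. (vec_l2 (col C k))\<^sup>2)" by (simp add: sum_distrib_left)
  also have "(\<Sum>k<f. (vec_l2 (col C k))\<^sup>2) = 1"
    using mat_trace_gram[OF C(1)] C by (metis of_real_eq_1_iff)
  finally show "cmod ((slice d e \<rho> B *\<^sub>v v) \<bullet>c w) \<le> b * vec_l2 v * vec_l2 w" by simp
qed

text \<open>The vector is cut into its e components \<open>u k\<close>, one for each basis state of
  the second factor. A acts on each of them separately, and their squared norms add up to that of
  v.\<close>

lemma op_bound_kron_one:
  assumes A: "A \<in> carrier_mat d d" "op_bound A a" "0 \<le> a"
  shows "op_bound (A \<Otimes> 1\<^sub>m e) a"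
proof (rule op_boundI)
  show K: "A \<Otimes> 1\<^sub>m e \<in> carrier_mat (d * e) (d * e)" using A by (intro kron_carrier) auto
  fix v :: "complex vec" assume v: "v \<in> carrier_vec (d * e)"
  define u where "u k = vec d (\<lambda>i. vec_index v (i * e + k))" for k
  have u: "u k \<in> carrier_vec d" for k by (simp add: u_def)
  have entry: "vec_index ((A \<Otimes> 1\<^sub>m e) *\<^sub>v v) (i * e + k) = vec_index (A *\<^sub>v u k) i" if ik: "i < d" "k < e" for i k
  proof -
    have "vec_index ((A \<Otimes> 1\<^sub>m e) *\<^sub>v v) (i * e + k) = (\<Sum>l<d * e. (A \<Otimes> 1\<^sub>m e) $$ (i * e + k, l) * vec_index v l)"
      using K v product_index_less[OF ik] A by (subst index_mult_vec) auto
    also have "\<dots> = (\<Sum>j<d. \<Sum>l<e. if k = l then A $$ (i, j) * vec_index v (j * e + k) else 0)"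
      unfolding sum_product_index
      by (intro sum.cong refl) (auto simp: index_kron[OF A(1) one_carrier_mat] ik)
    also have "\<dots> = vec_index (A *\<^sub>v u k) i"
      using A ik by (simp add: index_mult_vec sum.delta' u_def del: index_mult_mat_vec)
    finally show ?thesis .
  qed
  have "(vec_l2 ((A \<Otimes> 1\<^sub>m e) *\<^sub>v v))\<^sup>2 = (\<Sum>i<d. \<Sum>k<e. (cmod (vec_index (A *\<^sub>v u k) i))\<^sup>2)"
  proof -
    have "dim_vec ((A \<Otimes> 1\<^sub>m e) *\<^sub>v v) = d * e" using A by simp
    then show ?thesis unfolding vec_l2_sq using entry
      by (simp add: sum_product_index del: index_mult_mat_vec dim_mult_mat_vec)
  qed
  also have "\<dots> = (\<Sum>k<e. \<Sum>i<d. (cmod (vec_index (A *\<^sub>v u k) i))\<^sup>2)" by (rule sum.swap)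
  also have "\<dots> = (\<Sum>k<e. (vec_l2 (A *\<^sub>v u k))\<^sup>2)"
    unfolding vec_l2_sq using A by simp
  also have "\<dots> \<le> (\<Sum>k<e. (a * vec_l2 (u k))\<^sup>2)"
    using op_boundD[OF A(2,1) u] by (intro sum_mono power_mono) auto
  also have "\<dots> = a\<^sup>2 * (\<Sum>k<e. \<Sum>i<d. (cmod (vec_index v (i * e + k)))\<^sup>2)"
    by (simp add: power_mult_distrib sum_distrib_left vec_l2_sq) (simp add: u_def)
  also have "\<dots> = a\<^sup>2 * (\<Sum>i<d. \<Sum>k<e. (cmod (vec_index v (i * e + k)))\<^sup>2)" by (intro arg_cong2[of _ _ _ _ "(*)"] refl sum.swap)
  also have "\<dots> = (a * vec_l2 v)\<^sup>2"
    by (simp only: power_mult_distrib vec_l2_sq carrier_vecD[OF v] sum_product_index)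
  finally show "vec_l2 ((A \<Otimes> 1\<^sub>m e) *\<^sub>v v) \<le> a * vec_l2 v"
    by (rule power2_le_imp_le) (use A in auto)
qed

lemma op_bound_one_kron:
  assumes A: "A \<in> carrier_mat d d" "op_bound A a" "0 \<le> a"
  shows "op_bound (1\<^sub>m e \<Otimes> A) a"
proof (rule op_boundI)
  show K: "1\<^sub>m e \<Otimes> A \<in> carrier_mat (e * d) (e * d)" using A by (intro kron_carrier) auto
  fix v :: "complex vec" assume v: "v \<in> carrier_vec (e * d)"
  define u where "u k = vec d (\<lambda>i. vec_index v (k * d + i))" for k
  have u: "u k \<in> carrier_vec d" for k by (simp add: u_def)
  have entry: "vec_index ((1\<^sub>m e \<Otimes> A) *\<^sub>v v) (k * d + i) = vec_index (A *\<^sub>v u k) i" if ik: "i < d" "k < e" for i k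
  proof -
    have "vec_index ((1\<^sub>m e \<Otimes> A) *\<^sub>v v) (k * d + i) = (\<Sum>l<e * d. (1\<^sub>m e \<Otimes> A) $$ (k * d + i, l) * vec_index v l)"
      using K v product_index_less[OF ik(2,1)] A by (subst index_mult_vec) auto
    also have "\<dots> = (\<Sum>l<e. if k = l then \<Sum>j<d. A $$ (i, j) * vec_index v (k * d + j) else 0)"
      unfolding sum_product_index
      by (intro sum.cong refl) (auto simp: index_kron[OF one_carrier_mat A(1)] ik)
    also have "\<dots> = vec_index (A *\<^sub>v u k) i"
      using A ik by (simp add: index_mult_vec sum.delta' u_def del: index_mult_mat_vec)
    finally show ?thesis .
  qed
  have "(vec_l2 ((1\<^sub>m e \<Otimes> A) *\<^sub>v v))\<^sup>2 = (\<Sum>k<e. \<Sum>i<d. (cmod (vec_index (A *\<^sub>v u k) i))\<^sup>2)"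
  proof -
    have "dim_vec ((1\<^sub>m e \<Otimes> A) *\<^sub>v v) = e * d" using A by simp
    then show ?thesis unfolding vec_l2_sq using entry
      by (simp add: sum_product_index del: index_mult_mat_vec dim_mult_mat_vec)
  qed
  also have "\<dots> = (\<Sum>k<e. (vec_l2 (A *\<^sub>v u k))\<^sup>2)"
    unfolding vec_l2_sq using A by simp
  also have "\<dots> \<le> (\<Sum>k<e. (a * vec_l2 (u k))\<^sup>2)"
    using op_boundD[OF A(2,1) u] by (intro sum_mono power_mono) auto
  also have "\<dots> = a\<^sup>2 * (\<Sum>k<e. \<Sum>i<d. (cmod (vec_index v (k * d + i)))\<^sup>2)"
    by (simp add: power_mult_distrib sum_distrib_left vec_l2_sq) (simp add: u_def)
  also have "\<dots> = (a * vec_l2 v)\<^sup>2"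
    by (simp only: power_mult_distrib vec_l2_sq carrier_vecD[OF v] sum_product_index)
  finally show "vec_l2 ((1\<^sub>m e \<Otimes> A) *\<^sub>v v) \<le> a * vec_l2 v"
    by (rule power2_le_imp_le) (use A in auto)
qed

section \<open>Spectral decomposition of Hermitian matrices\<close>

lemma smult_smult_mat: "a \<cdot>\<^sub>m (b \<cdot>\<^sub>m M) = (a * b :: complex) \<cdot>\<^sub>m M"
  by (rule eq_matI) auto

abbreviation shift_mat :: "complex mat \<Rightarrow> complex \<Rightarrow> complex mat" where
  "shift_mat A c \<equiv> A - c \<cdot>\<^sub>m 1\<^sub>m (dim_row A)"

text \<open>A polynomial in A applied to X, kept as a list of linear factors with the head applied
  first. Later inductions peel off one factor at a time.\<close>

primrec shift_prod :: "complex mat \<Rightarrow> complex list \<Rightarrow> complex mat \<Rightarrow> complex mat" where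
  "shift_prod A [] X = X"
| "shift_prod A (c # cs) X = shift_prod A cs (shift_mat A c * X)"

lemma shift_mat_mult:
  assumes "A \<in> carrier_mat d d" "X \<in> carrier_mat d d"
  shows "shift_mat A c * X = A * X - c \<cdot>\<^sub>m X"
  using assms minus_mult_distrib_mat[of A d d "c \<cdot>\<^sub>m 1\<^sub>m d" X d]
  by (simp add: mult_smult_assoc_mat[of "1\<^sub>m d" d d X d c])

text \<open>The Cayley-Hamilton argument for triangular matrices: if the rows of X below row k
  vanish, the factor for the k-th diagonal entry clears row k as well. The diagonal is therefore
  used from the bottom upwards.\<close>

lemma shift_prod_upper_triangular:
  assumes B: "B \<in> carrier_mat d d" "upper_triangular B"
  shows "k \<le> d \<Longrightarrow> X \<in> carrier_mat d d \<Longrightarrow> (\<And>i j. k \<le> i \<Longrightarrow> i < d \<Longrightarrow> j < d \<Longrightarrow> X $$ (i, j) = 0) \<Longrightarrow>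
    shift_prod B (map (\<lambda>i. B $$ (i, i)) (rev [0..<k])) X = 0\<^sub>m d d"
proof (induction k arbitrary: X)
  case 0
  then show ?case by (auto intro!: eq_matI)
next
  case (Suc k)
  let ?Y = "shift_mat B (B $$ (k, k)) * X"
  have Y: "?Y \<in> carrier_mat d d" using Suc.prems B by auto
  have "?Y $$ (i, j) = 0" if ij: "k \<le> i" "i < d" "j < d" for i j
  proof -
    have "?Y $$ (i, j) = (\<Sum>l<d. shift_mat B (B $$ (k, k)) $$ (i, l) * X $$ (l, j))"
      using ij B Suc.prems by (simp del: index_mult_mat(1) index_minus_mat(1))
    also have "\<dots> = 0"
    proof (rule sum.neutral, rule ballI)
      fix l assume l: "l \<in> {..<d}"
      show "shift_mat B (B $$ (k, k)) $$ (i, l) * X $$ (l, j) = 0"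
      proof (cases "Suc k \<le> l")
        case True
        then show ?thesis using Suc.prems(3)[of l j] l ij by simp
      next
        case False
        have "B $$ (i, l) = 0" if "l < i" using B that ij by auto
        moreover have "l < i \<or> (l = i \<and> i = k)" using False ij by linarith
        ultimately show ?thesis using B l ij by auto
      qed
    qed
    finally show ?thesis .
  qed
  then have "shift_prod B (map (\<lambda>i. B $$ (i, i)) (rev [0..<k])) ?Y = 0\<^sub>m d d"
    using Suc.IH[OF _ Y] Suc.prems by simp
  then show ?case by simp
qed

text \<open>An intertwiner P can be pulled through every linear factor; this carries the
  annihilation from the triangular form to A.\<close>

lemma shift_prod_similar:
  assumes A: "A \<in> carrier_mat d d" and B: "B \<in> carrier_mat d d" and P: "P \<in> carrier_mat d d"
    and AP: "A * P = P * B"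
  shows "Y \<in> carrier_mat d d \<Longrightarrow> shift_prod A cs (P * Y) = P * shift_prod B cs Y"
proof (induction cs arbitrary: Y)
  case (Cons c cs)
  have Y: "Y \<in> carrier_mat d d" by fact
  have "shift_mat A c * (P * Y) = A * (P * Y) - c \<cdot>\<^sub>m (P * Y)"
    using A P Y by (intro shift_mat_mult) auto
  also have "A * (P * Y) = P * (B * Y)"
    unfolding assoc_mult_mat[OF A P Y, symmetric] AP by (rule assoc_mult_mat[OF P B Y])
  also have "P * (B * Y) - c \<cdot>\<^sub>m (P * Y) = P * (B * Y - c \<cdot>\<^sub>m Y)"
    by (simp only: mult_minus_distrib_mat[OF P mult_carrier_mat[OF B Y] smult_carrier_mat[OF Y]] mult_smult_distrib[OF P Y])
  also have "B * Y - c \<cdot>\<^sub>m Y = shift_mat B c * Y"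
    by (rule shift_mat_mult[OF B Y, symmetric])
  finally have "shift_mat A c * (P * Y) = P * (shift_mat B c * Y)" .
  moreover have "shift_mat B c * Y \<in> carrier_mat d d" using B Y by auto
  ultimately show ?case using Cons.IH by simp
qed simp

text \<open>Schur triangularisation over the complex numbers gives \<open>A = P * B * Q\<close>.
  Pulling P out of the product starting at \<open>P * Q = 1\<^sub>m d\<close> leaves the triangular
  case.\<close>

lemma shift_prod_annihilates:
  assumes A: "A \<in> carrier_mat d d"
  obtains cs where "shift_prod A cs (1\<^sub>m d) = 0\<^sub>m d d"
proof -
  obtain es where "char_poly A = (\<Prod>a\<leftarrow>es. [:- a, 1:])" using char_poly_factorized[OF A] by blast
  then obtain B where B: "B \<in> carrier_mat d d" "upper_triangular B" "similar_mat A B"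
    using schur_decomposition_exists[OF A] by blast
  then obtain P Q where PQ: "similar_mat_wit A B P Q" unfolding similar_mat_def by blast
  have car: "P \<in> carrier_mat d d" "Q \<in> carrier_mat d d" and one: "P * Q = 1\<^sub>m d" "Q * P = 1\<^sub>m d" and eq: "A = P * B * Q"
    using similar_mat_witD2[OF A PQ] by auto
  have "A * P = P * B * (Q * P)" unfolding eq using car B by (intro assoc_mult_mat[of _ d d _ d _ d]) auto
  also have "\<dots> = P * B" unfolding one using car B by (intro right_mult_one_mat[of _ d d]) auto
  finally have AP: "A * P = P * B" .
  let ?cs = "map (\<lambda>i. B $$ (i, i)) (rev [0..<d])"
  have "shift_prod A ?cs (P * Q) = P * shift_prod B ?cs Q"
    by (rule shift_prod_similar[OF A B(1) car(1) AP car(2)])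
  also have "shift_prod B ?cs Q = 0\<^sub>m d d"
    by (rule shift_prod_upper_triangular[OF B(1,2) order_refl car(2)]) auto
  finally have "shift_prod A ?cs (1\<^sub>m d) = 0\<^sub>m d d" using car one by simp
  then show ?thesis by (rule that)
qed

text \<open>The diagonal entries of the Gram matrix are the squared norms of the columns of
  M.\<close>

lemma gram_eq_zero:
  fixes M :: "complex mat"
  assumes M: "M \<in> carrier_mat d d" and z: "M\<^sup>\<dagger> * M = 0\<^sub>m d d"
  shows "M = 0\<^sub>m d d"
proof (rule eq_matI)
  fix i j assume "i < dim_row (0\<^sub>m d d :: complex mat)" "j < dim_col (0\<^sub>m d d :: complex mat)"
  then have ij: "i < d" "j < d" by auto
  have "complex_of_real (\<Sum>l<d. (cmod (M $$ (l, j)))\<^sup>2) = (M\<^sup>\<dagger> * M) $$ (j, j)"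
    using ij M by (simp add: complex_norm_square mult.commute del: index_mult_mat(1) of_real_power)
  then have "(\<Sum>l<d. (cmod (M $$ (l, j)))\<^sup>2) = 0" using ij z by (metis index_zero_mat(1) of_real_eq_0_iff)
  then have "\<forall>l\<in>{..<d}. (cmod (M $$ (l, j)))\<^sup>2 = 0" by (subst (asm) sum_nonneg_eq_0_iff) auto
  then show "M $$ (i, j) = 0\<^sub>m d d $$ (i, j)" using ij by auto
qed (use M in auto)

text \<open>The absence of Jordan blocks. For B = A - r Hermitian, the Gram matrix of B W is the
  adjoint of W times B B W, which is zero.\<close>

lemma hermitian_kernel_shift_sq:
  assumes A: "hermitian_mat d A" and W: "W \<in> carrier_mat d d"
    and z: "shift_mat A (complex_of_real r) * (shift_mat A (complex_of_real r) * W) = 0\<^sub>m d d"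
  shows "shift_mat A (complex_of_real r) * W = 0\<^sub>m d d"
proof -
  let ?B = "shift_mat A (complex_of_real r)"
  have Ac: "A \<in> carrier_mat d d" using A by (rule hermitian_carrier)
  then have B: "?B \<in> carrier_mat d d" by auto
  have Ba: "?B\<^sup>\<dagger> = ?B"
    using Ac hermitian_adjoint[OF A] by (subst adjoint_minus[of _ d d]) (auto simp: adjoint_smult)
  have BW: "?B * W \<in> carrier_mat d d" using B W by simp
  have "(?B * W)\<^sup>\<dagger> * (?B * W) = (W\<^sup>\<dagger> * ?B) * (?B * W)"
    using adjoint_mult[OF B W] Ba by simp
  also have "\<dots> = W\<^sup>\<dagger> * (?B * (?B * W))"
    using B W BW by (intro assoc_mult_mat[of _ d d _ d _ d]) auto
  also have "\<dots> = 0\<^sub>m d d" using z W adjoint_carrier[OF W] by simp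
  finally show ?thesis by (rule gram_eq_zero[OF BW])
qed

lemma smult_mat_cong_index:
  fixes M :: "complex mat"
  assumes "a \<cdot>\<^sub>m M = b \<cdot>\<^sub>m M" "M \<in> carrier_mat d d" "i < d" "j < d"
  shows "a * M $$ (i, j) = b * M $$ (i, j)"
  using arg_cong[OF assms(1), of "\<lambda>Z. Z $$ (i, j)"] assms(2-4) by simp

text \<open>Moving A to the other side of the Gram matrix of W shows that c and its conjugate
  multiply that Gram matrix to the same result; for non-real c it must vanish.\<close>

lemma hermitian_eigenvalue_real:
  assumes A: "hermitian_mat d A" and W: "W \<in> carrier_mat d d"
    and e: "A * W = c \<cdot>\<^sub>m W" and c: "c \<noteq> cnj c"
  shows "W = 0\<^sub>m d d"
proof (rule gram_eq_zero[OF W])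
  have Ac: "A \<in> carrier_mat d d" using A by (rule hermitian_carrier)
  have W': "W\<^sup>\<dagger> \<in> carrier_mat d d" using W by (rule adjoint_carrier)
  have "c \<cdot>\<^sub>m (W\<^sup>\<dagger> * W) = W\<^sup>\<dagger> * (A * W)"
    unfolding e by (rule mult_smult_distrib[OF W' W, symmetric])
  also have "\<dots> = (W\<^sup>\<dagger> * A) * W" by (rule assoc_mult_mat[OF W' Ac W, symmetric])
  also have "W\<^sup>\<dagger> * A = (A * W)\<^sup>\<dagger>" using adjoint_mult[OF Ac W] hermitian_adjoint[OF A] by simp
  also have "\<dots> = cnj c \<cdot>\<^sub>m W\<^sup>\<dagger>" unfolding e by (rule adjoint_smult)
  also have "\<dots> * W = cnj c \<cdot>\<^sub>m (W\<^sup>\<dagger> * W)" by (rule mult_smult_assoc_mat[OF W' W])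
  finally have "c \<cdot>\<^sub>m (W\<^sup>\<dagger> * W) = cnj c \<cdot>\<^sub>m (W\<^sup>\<dagger> * W)" .
  then have eq: "c * (W\<^sup>\<dagger> * W) $$ (i, j) = cnj c * (W\<^sup>\<dagger> * W) $$ (i, j)" if "i < d" "j < d" for i j
    using smult_mat_cong_index[OF _ mult_carrier_mat[OF W' W] that] by blast
  show "W\<^sup>\<dagger> * W = 0\<^sub>m d d"
  proof (rule eq_matI)
    fix i j assume "i < dim_row (0\<^sub>m d d :: complex mat)" "j < dim_col (0\<^sub>m d d :: complex mat)"
    then show "(W\<^sup>\<dagger> * W) $$ (i, j) = 0\<^sub>m d d $$ (i, j)" using eq[of i j] c by auto
  qed (use W in auto)
qed

text \<open>Splitting off one linear factor of an annihilating polynomial at a time decomposes the identity into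
  eigenmatrices; by orthogonality these are the spectral projections, so no eigenbasis is needed.\<close>

lemma hermitian_eigen_decomposition:
  assumes A: "hermitian_mat d A"
  shows "X \<in> carrier_mat d d \<Longrightarrow> shift_prod A cs X = 0\<^sub>m d d \<Longrightarrow>
    \<exists>(S :: real set) F. finite S \<and> (\<forall>a. F a \<in> carrier_mat d d) \<and>
      (\<forall>a\<in>S. A * F a = complex_of_real a \<cdot>\<^sub>m F a) \<and> X = mat_sum d S F"
proof (induction cs arbitrary: X)
  case Nil
  then show ?case
    by (intro exI[of _ "{}"] exI[of _ "\<lambda>_. 0\<^sub>m d d"]) (auto simp: mat_sum_empty)
next
  case (Cons c cs)
  have Ac: "A \<in> carrier_mat d d" using A by (rule hermitian_carrier)
  have X: "X \<in> carrier_mat d d" by fact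
  let ?B = "shift_mat A c"
  have B: "?B \<in> carrier_mat d d" using Ac by auto
  have "shift_prod A cs (?B * X) = 0\<^sub>m d d" using Cons.prems by simp
  then obtain S F where SF: "finite (S :: real set)" "\<And>a. F a \<in> carrier_mat d d"
    "\<And>a. a \<in> S \<Longrightarrow> A * F a = complex_of_real a \<cdot>\<^sub>m F a" "?B * X = mat_sum d S F"
    using Cons.IH[of "?B * X"] B X by auto
  \<comment> \<open>The eigencomponents of (A - c) X with eigenvalue a different from c are divided
    by a - c and subtracted from X; \<open>W\<close> is what remains, and (A - c) W only contains
    components for c.\<close>
  define T where "T = {a \<in> S. complex_of_real a \<noteq> c}"
  define G where "G a = (1 / (complex_of_real a - c)) \<cdot>\<^sub>m F a" for a
  have G: "G a \<in> carrier_mat d d" for a using SF(2) by (simp add: G_def)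
  define W where "W = X - mat_sum d T G"
  have W: "W \<in> carrier_mat d d" unfolding W_def by (intro minus_carrier_mat mat_sum_carrier)
  have T: "finite T" "T \<subseteq> S" using SF(1) by (auto simp: T_def)
  have BF: "?B * F a = (complex_of_real a - c) \<cdot>\<^sub>m F a" if "a \<in> S" for a
    unfolding shift_mat_mult[OF Ac SF(2)] SF(3)[OF that] using SF(2)[of a] by (auto intro!: eq_matI simp: algebra_simps)
  have AG: "A * G a = complex_of_real a \<cdot>\<^sub>m G a" if "a \<in> T" for a
    using SF(3)[of a] SF(2)[of a] Ac that T
    by (auto simp: G_def mult_smult_distrib[of A d d _ d] smult_smult_mat mult.commute)
  have "?B * mat_sum d T G = mat_sum d T F"
  proof -
    have "?B * mat_sum d T G = mat_sum d T (\<lambda>a. ?B * G a)"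
      using B G by (rule mult_mat_sum)
    also have "\<dots> = mat_sum d T F"
    proof (rule mat_sum_cong)
      fix a assume a: "a \<in> T"
      have "?B * G a = (1 / (complex_of_real a - c)) \<cdot>\<^sub>m (?B * F a)"
        unfolding G_def by (rule mult_smult_distrib[OF B SF(2)])
      also have "\<dots> = F a" using BF[of a] a T by (auto simp: smult_smult_mat T_def)
      finally show "?B * G a = F a" .
    qed
    finally show ?thesis .
  qed
  then have BW: "?B * W = mat_sum d S F - mat_sum d T F"
    unfolding W_def using mult_minus_distrib_mat[OF B X, of "mat_sum d T G"] SF(4) by simp
  also have "\<dots> = mat_sum d (S - T) F"
    using T SF(1) by (intro eq_matI) (auto simp: sum_diff)
  finally have BW: "?B * W = mat_sum d (S - T) F" .
  have ST: "complex_of_real a = c" if "a \<in> S - T" for a using that by (auto simp: T_def)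
  have XW: "X = W + mat_sum d T G" using X by (auto simp: W_def)
  \<comment> \<open>The matrix (A - c) W is itself annihilated by A - c. If such components occur
    then c is real, so the Hermitian case reduces the square of the factor to a single one.\<close>
  have BW0: "?B * W = 0\<^sub>m d d"
  proof (cases "S - T = {}")
    case True
    show ?thesis unfolding BW True by (rule mat_sum_empty)
  next
    case False
    then obtain r where r: "c = complex_of_real r" using ST by blast
    have "?B * (?B * W) = mat_sum d (S - T) (\<lambda>a. ?B * F a)"
      unfolding BW using B SF(2) by (rule mult_mat_sum)
    also have "\<dots> = mat_sum d (S - T) (\<lambda>a. 0\<^sub>m d d)"
    proof (rule mat_sum_cong)
      fix a assume a: "a \<in> S - T"
      then show "?B * F a = 0\<^sub>m d d" using BF[of a] ST[of a] SF(2)[of a] by (auto intro!: eq_matI)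
    qed
    also have "\<dots> = 0\<^sub>m d d" by (auto intro!: eq_matI)
    finally show ?thesis using hermitian_kernel_shift_sq[OF A W, of r] unfolding r by simp
  qed
  have AW: "A * W = c \<cdot>\<^sub>m W"
  proof (rule eq_matI)
    fix i j assume "i < dim_row (c \<cdot>\<^sub>m W)" "j < dim_col (c \<cdot>\<^sub>m W)"
    then have ij: "i < d" "j < d" using W by auto
    have "A * W - c \<cdot>\<^sub>m W = 0\<^sub>m d d" using BW0 shift_mat_mult[OF Ac W] by simp
    then have "(A * W - c \<cdot>\<^sub>m W) $$ (i, j) = 0" using ij by simp
    then show "(A * W) $$ (i, j) = (c \<cdot>\<^sub>m W) $$ (i, j)" using ij Ac W by (simp del: index_mult_mat(1) index_mult)
  qed (use Ac W in auto)
  show ?case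
  \<comment> \<open>A non-real c contributes nothing, because its eigenmatrix is zero; a real c
    joins the index set with eigenmatrix \<open>W\<close>.\<close>
  proof (cases "c = cnj c")
    case False
    then have "W = 0\<^sub>m d d" using hermitian_eigenvalue_real[OF A W AW] by simp
    then have "X = mat_sum d T G" using XW left_add_zero_mat[OF mat_sum_carrier[of d T G]] by simp
    then show ?thesis using T AG G by blast
  next
    case True
    then obtain r where r: "c = complex_of_real r" using that[of "Re c"] by (simp add: complex_eq_iff)
    define G' where "G' = G(r := W)"
    have nT: "r \<notin> T" by (auto simp: T_def r)
    have "X = mat_sum d (insert r T) G'"
    proof -
      have "mat_sum d T G' = mat_sum d T G" by (rule mat_sum_cong) (use nT in \<open>auto simp: G'_def\<close>)
      then show ?thesis using XW W T nT by (simp add: mat_sum_insert G'_def)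
    qed
    moreover have "A * G' a = complex_of_real a \<cdot>\<^sub>m G' a" if "a \<in> insert r T" for a
      using that AG AW nT r by (auto simp: G'_def)
    moreover have "G' a \<in> carrier_mat d d" for a using G W by (auto simp: G'_def)
    ultimately show ?thesis using T by (intro exI[of _ "insert r T"] exI[of _ G']) auto
  qed
qed

text \<open>The set \<open>S\<close> may contain values whose projection is zero and which are then
  not eigenvalues. For this reason many statements below carry the condition that \<open>P a\<close>
  is nonzero.\<close>

definition spectral :: "nat \<Rightarrow> complex mat \<Rightarrow> real set \<Rightarrow> (real \<Rightarrow> complex mat) \<Rightarrow> bool" where
  "spectral d A S P \<longleftrightarrow> finite S \<and> (\<forall>a\<in>S. hermitian_mat d (P a)) \<and>
     (\<forall>a\<in>S. \<forall>b\<in>S. P a * P b = (if a = b then P a else 0\<^sub>m d d)) \<and>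
     mat_sum d S P = 1\<^sub>m d \<and> A \<in> carrier_mat d d \<and> (\<forall>a\<in>S. A * P a = complex_of_real a \<cdot>\<^sub>m P a)"

text \<open>Eigenmatrices P a that sum to the identity are automatically projections. Hermiticity of
  A makes the adjoint of P a times P b vanish for distinct a and b, so multiplying the sum by the
  adjoint of P a shows that this adjoint equals its product with P a, which is Hermitian.\<close>

theorem spectral_decomposition:
  assumes A: "hermitian_mat d A"
  obtains S P where "spectral d A S P"
proof -
  have Ac: "A \<in> carrier_mat d d" using A by (rule hermitian_carrier)
  obtain cs where "shift_prod A cs (1\<^sub>m d) = 0\<^sub>m d d" using shift_prod_annihilates[OF Ac] .
  then obtain S :: "real set" and P where fin: "finite S" and P: "\<And>a. P a \<in> carrier_mat d d"
    and AP: "\<And>a. a \<in> S \<Longrightarrow> A * P a = complex_of_real a \<cdot>\<^sub>m P a" and one: "1\<^sub>m d = mat_sum d S P"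
    using hermitian_eigen_decomposition[OF A, of "1\<^sub>m d" cs] by auto
  have P': "(P a)\<^sup>\<dagger> \<in> carrier_mat d d" for a using P by (rule adjoint_carrier)
  have orth: "(P a)\<^sup>\<dagger> * P b = 0\<^sub>m d d" if ab: "a \<in> S" "b \<in> S" "a \<noteq> b" for a b
  proof (rule eq_matI)
    fix i j assume "i < dim_row (0\<^sub>m d d :: complex mat)" "j < dim_col (0\<^sub>m d d :: complex mat)"
    then have ij: "i < d" "j < d" by auto
    have "complex_of_real b \<cdot>\<^sub>m ((P a)\<^sup>\<dagger> * P b) = (P a)\<^sup>\<dagger> * (A * P b)"
      unfolding AP[OF ab(2)] by (rule mult_smult_distrib[OF P' P, symmetric])
    also have "\<dots> = ((P a)\<^sup>\<dagger> * A) * P b" by (rule assoc_mult_mat[OF P' Ac P, symmetric])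
    also have "(P a)\<^sup>\<dagger> * A = (A * P a)\<^sup>\<dagger>" using adjoint_mult[OF Ac P] hermitian_adjoint[OF A] by simp
    also have "\<dots> = complex_of_real a \<cdot>\<^sub>m (P a)\<^sup>\<dagger>" unfolding AP[OF ab(1)] by (simp add: adjoint_smult)
    also have "\<dots> * P b = complex_of_real a \<cdot>\<^sub>m ((P a)\<^sup>\<dagger> * P b)" by (rule mult_smult_assoc_mat[OF P' P])
    finally have "complex_of_real b \<cdot>\<^sub>m ((P a)\<^sup>\<dagger> * P b) = complex_of_real a \<cdot>\<^sub>m ((P a)\<^sup>\<dagger> * P b)" .
    then have "complex_of_real b * ((P a)\<^sup>\<dagger> * P b) $$ (i, j) = complex_of_real a * ((P a)\<^sup>\<dagger> * P b) $$ (i, j)"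
      by (rule smult_mat_cong_index[OF _ mult_carrier_mat[OF P' P] ij])
    then show "((P a)\<^sup>\<dagger> * P b) $$ (i, j) = 0\<^sub>m d d $$ (i, j)" using ab ij by auto
  qed (use P'[of a] P[of b] in auto)
  have self: "(P a)\<^sup>\<dagger> = (P a)\<^sup>\<dagger> * P a" if a: "a \<in> S" for a
  proof -
    have "(P a)\<^sup>\<dagger> = (P a)\<^sup>\<dagger> * mat_sum d S P" using P' one by (metis right_mult_one_mat)
    also have "\<dots> = mat_sum d S (\<lambda>b. (P a)\<^sup>\<dagger> * P b)" using P' P by (rule mult_mat_sum)
    also have "\<dots> = (P a)\<^sup>\<dagger> * P a"
    proof (rule eq_matI)
      fix i j assume "i < dim_row ((P a)\<^sup>\<dagger> * P a)" "j < dim_col ((P a)\<^sup>\<dagger> * P a)"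
      then have ij: "i < d" "j < d" using P'[of a] P[of a] by auto
      have "(\<Sum>b\<in>S. ((P a)\<^sup>\<dagger> * P b) $$ (i, j)) = (\<Sum>b\<in>S. if b = a then ((P a)\<^sup>\<dagger> * P a) $$ (i, j) else 0)"
        using orth[OF a] ij by (intro sum.cong refl) (auto simp del: index_mult_mat(1) index_mult)
      then show "mat_sum d S (\<lambda>b. (P a)\<^sup>\<dagger> * P b) $$ (i, j) = ((P a)\<^sup>\<dagger> * P a) $$ (i, j)"
        using ij fin a by (simp del: index_mult_mat(1) index_mult)
    qed (use P'[of a] P[of a] in auto)
    finally show ?thesis .
  qed
  have herm: "(P a)\<^sup>\<dagger> = P a" if "a \<in> S" for a
    using self[OF that] adjoint_mult[OF P' P, of a a] by simp
  have "P a * P b = (if a = b then P a else 0\<^sub>m d d)" if "a \<in> S" "b \<in> S" for a b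
  proof (cases "a = b")
    case True
    then show ?thesis using self[OF that(1)] herm[OF that(1)] by metis
  next
    case False
    then show ?thesis using orth[OF that] herm[OF that(1)] by simp
  qed
  then have "spectral d A S P"
    unfolding spectral_def hermitian_mat_def using fin P herm Ac one AP by simp
  then show ?thesis by (rule that)
qed

section \<open>Functional calculus of a Hermitian matrix\<close>

definition fcalc :: "nat \<Rightarrow> real set \<Rightarrow> (real \<Rightarrow> complex mat) \<Rightarrow> (real \<Rightarrow> complex) \<Rightarrow> complex mat" where
  "fcalc d S P f = mat_sum d S (\<lambda>a. f a \<cdot>\<^sub>m P a)"

lemma fcalc_carrier [simp]: "fcalc d S P f \<in> carrier_mat d d"
  by (simp add: fcalc_def)

lemma dim_fcalc [simp]: "dim_row (fcalc d S P f) = d" "dim_col (fcalc d S P f) = d"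
  by (simp_all add: fcalc_def)

lemma spectral_carrier: "spectral d A S P \<Longrightarrow> a \<in> S \<Longrightarrow> P a \<in> carrier_mat d d"
  by (auto simp: spectral_def hermitian_mat_def)

lemma index_fcalc:
  assumes "spectral d A S P" "i < d" "j < d"
  shows "fcalc d S P f $$ (i, j) = (\<Sum>a\<in>S. f a * P a $$ (i, j))"
  unfolding fcalc_def index_mat_sum[OF assms(2,3)]
  by (intro sum.cong refl) (use spectral_carrier[OF assms(1)] assms(2,3) in fastforce)

lemma fcalc_cong:
  assumes "spectral d A S P" "\<And>a. a \<in> S \<Longrightarrow> P a \<noteq> 0\<^sub>m d d \<Longrightarrow> f a = g a"
  shows "fcalc d S P f = fcalc d S P g"
  unfolding fcalc_def
proof (rule mat_sum_cong)
  fix a assume a: "a \<in> S"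
  show "f a \<cdot>\<^sub>m P a = g a \<cdot>\<^sub>m P a"
    using assms(2)[OF a] by (cases "P a = 0\<^sub>m d d") auto
qed

lemma fcalc_add:
  assumes "spectral d A S P"
  shows "fcalc d S P f + fcalc d S P g = fcalc d S P (\<lambda>a. f a + g a)"
  by (rule eq_matI) (auto simp: index_fcalc[OF assms] sum.distrib algebra_simps)

lemma fcalc_minus:
  assumes "spectral d A S P"
  shows "fcalc d S P f - fcalc d S P g = fcalc d S P (\<lambda>a. f a - g a)"
  by (rule eq_matI) (auto simp: index_fcalc[OF assms] sum_subtractf algebra_simps)

lemma fcalc_smult:
  assumes "spectral d A S P"
  shows "c \<cdot>\<^sub>m fcalc d S P f = fcalc d S P (\<lambda>a. c * f a)"
  by (rule eq_matI) (auto simp: index_fcalc[OF assms] sum_distrib_left mult.assoc)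

lemma fcalc_one:
  assumes "spectral d A S P"
  shows "fcalc d S P (\<lambda>_. 1) = 1\<^sub>m d"
proof -
  have "fcalc d S P (\<lambda>_. 1) = mat_sum d S P"
    unfolding fcalc_def by (rule mat_sum_cong) auto
  then show ?thesis using assms by (simp add: spectral_def)
qed

lemma fcalc_id:
  assumes "spectral d A S P"
  shows "fcalc d S P complex_of_real = A"
proof -
  have A: "A \<in> carrier_mat d d" using assms by (simp add: spectral_def)
  have "A = A * mat_sum d S P" using assms A by (simp add: spectral_def)
  also have "\<dots> = mat_sum d S (\<lambda>a. A * P a)"
    using A spectral_carrier[OF assms] by (rule mult_mat_sum)
  also have "\<dots> = fcalc d S P complex_of_real"
    unfolding fcalc_def by (rule mat_sum_cong) (use assms in \<open>auto simp: spectral_def\<close>)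
  finally show ?thesis ..
qed

lemma fcalc_adjoint:
  assumes "spectral d A S P"
  shows "(fcalc d S P f)\<^sup>\<dagger> = fcalc d S P (\<lambda>a. cnj (f a))"
proof -
  have "(fcalc d S P f)\<^sup>\<dagger> = mat_sum d S (\<lambda>a. (f a \<cdot>\<^sub>m P a)\<^sup>\<dagger>)"
    unfolding fcalc_def by (rule adjoint_mat_sum) (use spectral_carrier[OF assms] in auto)
  also have "\<dots> = fcalc d S P (\<lambda>a. cnj (f a))"
    unfolding fcalc_def using assms
    by (intro mat_sum_cong) (auto simp: adjoint_smult spectral_def hermitian_mat_def)
  finally show ?thesis .
qed

lemma spectral_hermitian: "spectral d A S P \<Longrightarrow> hermitian_mat d A"
  using fcalc_adjoint[of d A S P complex_of_real] fcalc_id[of d A S P] fcalc_carrier[of d S P complex_of_real]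
  by (simp add: hermitian_mat_def)

lemma fcalc_mult:
  assumes sp: "spectral d A S P"
  shows "fcalc d S P f * fcalc d S P g = fcalc d S P (\<lambda>a. f a * g a)"
proof -
  have P: "a \<in> S \<Longrightarrow> P a \<in> carrier_mat d d" for a using spectral_carrier[OF sp] .
  have fin: "finite S" using sp by (simp add: spectral_def)
  have "fcalc d S P f * fcalc d S P g = mat_sum d S (\<lambda>a. (f a \<cdot>\<^sub>m P a) * fcalc d S P g)"
    unfolding fcalc_def[of d S P f] using P by (intro mat_sum_mult) auto
  also have "\<dots> = fcalc d S P (\<lambda>a. f a * g a)"
    unfolding fcalc_def[of d S P "\<lambda>a. f a * g a"]
  proof (rule mat_sum_cong)
    fix a assume a: "a \<in> S"
    have "(f a \<cdot>\<^sub>m P a) * fcalc d S P g = mat_sum d S (\<lambda>b. (f a \<cdot>\<^sub>m P a) * (g b \<cdot>\<^sub>m P b))"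
      unfolding fcalc_def using P a by (intro mult_mat_sum) auto
    also have "\<dots> = mat_sum d S (\<lambda>b. if b = a then (f a * g a) \<cdot>\<^sub>m P a else 0\<^sub>m d d)"
    proof (rule mat_sum_cong)
      fix b assume b: "b \<in> S"
      have "(f a \<cdot>\<^sub>m P a) * (g b \<cdot>\<^sub>m P b) = f a \<cdot>\<^sub>m (P a * (g b \<cdot>\<^sub>m P b))"
        using P[OF a] P[OF b] by (intro mult_smult_assoc_mat) auto
      also have "P a * (g b \<cdot>\<^sub>m P b) = g b \<cdot>\<^sub>m (P a * P b)"
        using P[OF a] P[OF b] by (rule mult_smult_distrib)
      also have "P a * P b = (if a = b then P a else 0\<^sub>m d d)"
        using sp a b by (simp add: spectral_def)
      finally show "(f a \<cdot>\<^sub>m P a) * (g b \<cdot>\<^sub>m P b) = (if b = a then (f a * g a) \<cdot>\<^sub>m P a else 0\<^sub>m d d)"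
        by (auto simp: smult_smult_mat)
    qed
    also have "\<dots> = (f a * g a) \<cdot>\<^sub>m P a"
    proof (rule eq_matI)
      fix i j assume "i < dim_row ((f a * g a) \<cdot>\<^sub>m P a)" "j < dim_col ((f a * g a) \<cdot>\<^sub>m P a)"
      then have ij: "i < d" "j < d" using P[OF a] by auto
      have "(\<Sum>b\<in>S. (if b = a then (f a * g a) \<cdot>\<^sub>m P a else 0\<^sub>m d d) $$ (i, j))
        = (\<Sum>b\<in>S. if b = a then ((f a * g a) \<cdot>\<^sub>m P a) $$ (i, j) else 0)"
        using ij by (intro sum.cong refl) auto
      then show "mat_sum d S (\<lambda>b. if b = a then (f a * g a) \<cdot>\<^sub>m P a else 0\<^sub>m d d) $$ (i, j)
          = ((f a * g a) \<cdot>\<^sub>m P a) $$ (i, j)"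
        using ij a fin by simp
    qed (use P[OF a] in auto)
    finally show "(f a \<cdot>\<^sub>m P a) * fcalc d S P g = (f a * g a) \<cdot>\<^sub>m P a" .
  qed
  finally show ?thesis .
qed

lemma fcalc_pow:
  assumes "spectral d A S P"
  shows "fcalc d S P f ^\<^sub>m k = fcalc d S P (\<lambda>a. f a ^ k)"
proof (induction k)
  case 0
  then show ?case using fcalc_one[OF assms] by simp
next
  case (Suc k)
  then show ?case by (simp add: fcalc_mult[OF assms] mult.commute)
qed

text \<open>Each entry of the exponential series is a finite sum of scalar exponential series, one
  for each value in \<open>S\<close>, so convergence is inherited from the scalar case.\<close>

lemma mat_exp_fcalc:
  assumes sp: "spectral d A S P"
  shows "mat_exp (z \<cdot>\<^sub>m A) = fcalc d S P (\<lambda>a. exp (z * complex_of_real a))"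
proof (rule eq_matI)
  have A: "A \<in> carrier_mat d d" using sp by (simp add: spectral_def)
  have zA: "z \<cdot>\<^sub>m A = fcalc d S P (\<lambda>a. z * complex_of_real a)"
    using fcalc_smult[OF sp, of z complex_of_real] fcalc_id[OF sp] by simp
  fix i j assume "i < dim_row (fcalc d S P (\<lambda>a. exp (z * complex_of_real a)))"
    "j < dim_col (fcalc d S P (\<lambda>a. exp (z * complex_of_real a)))"
  then have ij: "i < d" "j < d" by auto
  have e: "(\<lambda>k. (w ^ k / fact k) * c) sums (exp w * c)" for w c :: complex
    using exp_converges[of w] by (intro sums_mult2) (simp add: scaleR_conv_of_real field_simps)
  have "(\<lambda>k. \<Sum>a\<in>S. ((z * complex_of_real a) ^ k / fact k) * P a $$ (i, j)) sums
      (\<Sum>a\<in>S. exp (z * complex_of_real a) * P a $$ (i, j))"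
    by (intro sums_sum e)
  also have "(\<lambda>k. \<Sum>a\<in>S. ((z * complex_of_real a) ^ k / fact k) * P a $$ (i, j))
      = (\<lambda>k. ((z \<cdot>\<^sub>m A) ^\<^sub>m k) $$ (i, j) / fact k)"
    unfolding zA fcalc_pow[OF sp] by (auto simp: index_fcalc[OF sp ij] sum_divide_distrib)
  finally show "mat_exp (z \<cdot>\<^sub>m A) $$ (i, j) = fcalc d S P (\<lambda>a. exp (z * complex_of_real a)) $$ (i, j)"
    using ij A by (simp add: mat_exp_def sums_iff index_fcalc[OF sp ij])
qed (use assms in \<open>auto simp: mat_exp_def spectral_def\<close>)

lemma cscalar_prod_mat_sum:
  assumes "\<And>x. x \<in> J \<Longrightarrow> f x \<in> carrier_mat d d" "v \<in> carrier_vec d" "w \<in> carrier_vec d"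
  shows "(mat_sum d J f *\<^sub>v v) \<bullet>c w = (\<Sum>x\<in>J. (f x *\<^sub>v v) \<bullet>c w)"
proof -
  have o: "outer v w \<in> carrier_mat d d" using assms by simp
  have "(mat_sum d J f *\<^sub>v v) \<bullet>c w = mat_trace (mat_sum d J f * outer v w)"
    by (rule mat_trace_outer[OF mat_sum_carrier assms(2,3), symmetric])
  also have "mat_sum d J f * outer v w = mat_sum d J (\<lambda>x. f x * outer v w)"
    using o assms(1) by (rule mat_sum_mult)
  also have "mat_trace \<dots> = (\<Sum>x\<in>J. mat_trace (f x * outer v w))"
    using mult_carrier_mat[OF assms(1) o] by (rule mat_trace_sum)
  also have "\<dots> = (\<Sum>x\<in>J. (f x *\<^sub>v v) \<bullet>c w)"
    by (intro sum.cong refl mat_trace_outer[OF assms(1) assms(2,3)])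
  finally show ?thesis .
qed

lemma smult_mult_mat_vec:
  "A \<in> carrier_mat n m \<Longrightarrow> v \<in> carrier_vec m \<Longrightarrow> (c \<cdot>\<^sub>m A) *\<^sub>v v = (c :: complex) \<cdot>\<^sub>v (A *\<^sub>v v)"
  by (rule eq_vecI) (auto simp: index_mult_vec sum_distrib_left mult_ac simp del: index_mult_mat_vec)

text \<open>Pythagoras for the orthogonal components of v: the squared norm is the quadratic form of
  the functional calculus of |f|^2, and each projection turns its form into a squared norm.\<close>

lemma fcalc_vec_l2:
  assumes sp: "spectral d A S P" and v: "v \<in> carrier_vec d"
  shows "(vec_l2 (fcalc d S P f *\<^sub>v v))\<^sup>2 = (\<Sum>a\<in>S. (cmod (f a))\<^sup>2 * (vec_l2 (P a *\<^sub>v v))\<^sup>2)"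
proof -
  let ?F = "fcalc d S P f"
  have P: "a \<in> S \<Longrightarrow> P a \<in> carrier_mat d d" for a using spectral_carrier[OF sp] .
  have Fv: "?F *\<^sub>v v \<in> carrier_vec d" by (rule mult_mat_vec_carrier[OF fcalc_carrier v])
  have F': "?F\<^sup>\<dagger> \<in> carrier_mat d d" by (rule adjoint_carrier[OF fcalc_carrier])
  have "complex_of_real ((vec_l2 (?F *\<^sub>v v))\<^sup>2) = (?F\<^sup>\<dagger> *\<^sub>v (?F *\<^sub>v v)) \<bullet>c v"
    using cscalar_prod_adjoint[OF F' Fv v] by (simp add: cscalar_prod_self)
  also have "?F\<^sup>\<dagger> *\<^sub>v (?F *\<^sub>v v) = (?F\<^sup>\<dagger> * ?F) *\<^sub>v v"
    by (rule assoc_mult_mat_vec[OF F' fcalc_carrier v, symmetric])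
  also have "?F\<^sup>\<dagger> * ?F = fcalc d S P (\<lambda>a. complex_of_real ((cmod (f a))\<^sup>2))"
    unfolding fcalc_adjoint[OF sp] fcalc_mult[OF sp] by (simp add: complex_norm_square mult.commute del: of_real_power)
  also have "(\<dots> *\<^sub>v v) \<bullet>c v = (\<Sum>a\<in>S. ((complex_of_real ((cmod (f a))\<^sup>2) \<cdot>\<^sub>m P a) *\<^sub>v v) \<bullet>c v)"
    unfolding fcalc_def using P v by (intro cscalar_prod_mat_sum) auto
  also have "\<dots> = (\<Sum>a\<in>S. complex_of_real ((cmod (f a))\<^sup>2 * (vec_l2 (P a *\<^sub>v v))\<^sup>2))"
  proof (intro sum.cong refl)
    fix a assume a: "a \<in> S"
    have Pv: "P a *\<^sub>v v \<in> carrier_vec d" by (rule mult_mat_vec_carrier[OF P[OF a] v])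
    have adj: "(P a)\<^sup>\<dagger> = P a" and idem: "P a * P a = P a"
      using sp a by (auto simp: spectral_def hermitian_mat_def)
    have "P a *\<^sub>v v = P a *\<^sub>v (P a *\<^sub>v v)"
      using assoc_mult_mat_vec[OF P[OF a] P[OF a] v] idem by simp
    then have "(P a *\<^sub>v v) \<bullet>c v = (P a *\<^sub>v v) \<bullet>c (P a *\<^sub>v v)"
      using cscalar_prod_adjoint[OF P[OF a] Pv v] adj by simp
    then show "((complex_of_real ((cmod (f a))\<^sup>2) \<cdot>\<^sub>m P a) *\<^sub>v v) \<bullet>c v =
        complex_of_real ((cmod (f a))\<^sup>2 * (vec_l2 (P a *\<^sub>v v))\<^sup>2)"
      using P[OF a] v Pv by (simp add: smult_mult_mat_vec[OF P[OF a] v] cscalar_prod_self)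
  qed
  also have "\<dots> = complex_of_real (\<Sum>a\<in>S. (cmod (f a))\<^sup>2 * (vec_l2 (P a *\<^sub>v v))\<^sup>2)" by simp
  finally show ?thesis unfolding of_real_eq_iff .
qed

lemma op_bound_fcalc:
  assumes sp: "spectral d A S P" and c: "\<And>a. a \<in> S \<Longrightarrow> P a \<noteq> 0\<^sub>m d d \<Longrightarrow> cmod (f a) \<le> c" "0 \<le> c"
  shows "op_bound (fcalc d S P f) c"
proof (rule op_boundI[OF fcalc_carrier])
  fix v :: "complex vec" assume v: "v \<in> carrier_vec d"
  have "(vec_l2 (fcalc d S P f *\<^sub>v v))\<^sup>2 = (\<Sum>a\<in>S. (cmod (f a))\<^sup>2 * (vec_l2 (P a *\<^sub>v v))\<^sup>2)"
    by (rule fcalc_vec_l2[OF sp v])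
  also have "\<dots> \<le> (\<Sum>a\<in>S. c\<^sup>2 * (vec_l2 (P a *\<^sub>v v))\<^sup>2)"
  proof (rule sum_mono)
    fix a assume a: "a \<in> S"
    show "(cmod (f a))\<^sup>2 * (vec_l2 (P a *\<^sub>v v))\<^sup>2 \<le> c\<^sup>2 * (vec_l2 (P a *\<^sub>v v))\<^sup>2"
    proof (cases "P a = 0\<^sub>m d d")
      case True
      then have "P a *\<^sub>v v = 0\<^sub>v d" using v by auto
      then show ?thesis by simp
    next
      case False
      then show ?thesis using c(1)[OF a False] by (intro mult_right_mono power_mono) auto
    qed
  qed
  \<comment> \<open>The same identity for the constant function 1, whose functional calculus is the
    identity, adds the components back up to |v|^2.\<close>
  also have "\<dots> = c\<^sup>2 * (vec_l2 (fcalc d S P (\<lambda>_. 1) *\<^sub>v v))\<^sup>2"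
    unfolding fcalc_vec_l2[OF sp v] by (simp add: sum_distrib_left)
  also have "\<dots> = (c * vec_l2 v)\<^sup>2"
    unfolding fcalc_one[OF sp] using v by (simp add: power_mult_distrib)
  finally show "vec_l2 (fcalc d S P f *\<^sub>v v) \<le> c * vec_l2 v"
    by (rule power2_le_imp_le) (use c in auto)
qed

text \<open>A nonzero column of the projection is an eigenvector, so norm or positivity properties
  of A pass to a.\<close>

lemma spectral_projection_nonzero:
  assumes sp: "spectral d A S P" and a: "a \<in> S" "P a \<noteq> 0\<^sub>m d d"
  obtains w where "w \<in> carrier_vec d" "A *\<^sub>v w = complex_of_real a \<cdot>\<^sub>v w" "vec_l2 w > 0"
proof -
  have A: "A \<in> carrier_mat d d" using sp by (simp add: spectral_def)
  have P: "P a \<in> carrier_mat d d" using spectral_carrier[OF sp a(1)] .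
  obtain i j where ij: "i < d" "j < d" "P a $$ (i, j) \<noteq> 0"
    using a(2) P eq_matI[of "P a" "0\<^sub>m d d"] by fastforce
  let ?w = "col (P a) j"
  have "vec_index ?w i \<noteq> 0" using ij P by simp
  have "?w \<noteq> 0\<^sub>v (dim_vec ?w)"
  proof
    assume h: "?w = 0\<^sub>v (dim_vec ?w)"
    have "vec_index ?w i = vec_index (0\<^sub>v (dim_vec ?w)) i" by (rule arg_cong[OF h])
    then show False using \<open>vec_index ?w i \<noteq> 0\<close> ij P by simp
  qed
  then have "vec_l2 ?w \<noteq> 0" using vec_l2_eq_0 by blast
  then have pos: "vec_l2 ?w > 0" using vec_l2_nonneg[of ?w] by linarith
  have "A *\<^sub>v ?w = col (A * P a) j" by (rule col_mult2[OF A P ij(2), symmetric])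
  also have "\<dots> = complex_of_real a \<cdot>\<^sub>v ?w" using sp a ij P by (auto simp: spectral_def)
  finally show ?thesis using that[of ?w] P pos by auto
qed

lemma spectral_eigenvalue_bound:
  assumes sp: "spectral d A S P" and a: "a \<in> S" "P a \<noteq> 0\<^sub>m d d" and b: "op_bound A c"
  shows "\<bar>a\<bar> \<le> c"
proof -
  obtain w where w: "w \<in> carrier_vec d" "A *\<^sub>v w = complex_of_real a \<cdot>\<^sub>v w" "vec_l2 w > 0"
    using spectral_projection_nonzero[OF sp a] .
  have "\<bar>a\<bar> * vec_l2 w \<le> c * vec_l2 w"
    using op_boundD[OF b _ w(1)] sp w by (auto simp: spectral_def vec_l2_smult)
  then show ?thesis using w(3) by simp
qed

text \<open>The factor is the positive square root. Testing the quadratic form on eigenvectors shows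
  that every a with nonzero projection is nonnegative, so \<open>sqrt\<close> squares back to a
  there.\<close>

lemma positive_factorization:
  assumes R: "hermitian_mat d \<rho>" "\<And>v. v \<in> carrier_vec d \<Longrightarrow> 0 \<le> Re ((\<rho> *\<^sub>v v) \<bullet>c v)"
  obtains C where "C \<in> carrier_mat d d" "\<rho> = C * C\<^sup>\<dagger>"
proof -
  obtain S P where sp: "spectral d \<rho> S P" using spectral_decomposition[OF R(1)] .
  let ?C = "fcalc d S P (\<lambda>a. complex_of_real (sqrt a))"
  have "0 \<le> a" if a: "a \<in> S" "P a \<noteq> 0\<^sub>m d d" for a
  proof -
    obtain w where w: "w \<in> carrier_vec d" "\<rho> *\<^sub>v w = complex_of_real a \<cdot>\<^sub>v w" "vec_l2 w > 0"
      using spectral_projection_nonzero[OF sp a] .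
    have "(\<rho> *\<^sub>v w) \<bullet>c w = complex_of_real (a * (vec_l2 w)\<^sup>2)"
      unfolding w(2) using w(1) by (simp add: cscalar_prod_self)
    then have "0 \<le> a * (vec_l2 w)\<^sup>2" using R(2)[OF w(1)] by simp
    then show ?thesis using w(3) by (simp add: zero_le_mult_iff)
  qed
  then have "?C * ?C\<^sup>\<dagger> = fcalc d S P complex_of_real"
    unfolding fcalc_adjoint[OF sp] fcalc_mult[OF sp]
    by (intro fcalc_cong[OF sp]) (auto simp: of_real_mult[symmetric] simp del: of_real_mult)
  then show ?thesis using that[of ?C] fcalc_id[OF sp] by simp
qed

lemma density_factorization:
  assumes "density_mat d \<rho>"
  obtains C where "C \<in> carrier_mat d d" "\<rho> = C * C\<^sup>\<dagger>"
  using positive_factorization[of d \<rho>] assms by (auto simp: density_mat_def)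

section \<open>Projective measurements\<close>

lemma spectral_adjoint_mult:
  assumes sp: "spectral d A S P" and b: "b \<in> S"
  shows "P b * A = complex_of_real b \<cdot>\<^sub>m P b"
proof -
  have A: "A \<in> carrier_mat d d" using sp by (simp add: spectral_def)
  have P: "P b \<in> carrier_mat d d" using spectral_carrier[OF sp b] .
  have "P b * A = (A * P b)\<^sup>\<dagger>"
    using adjoint_mult[OF A P] spectral_hermitian[OF sp] sp b by (simp add: hermitian_mat_def spectral_def)
  also have "\<dots> = complex_of_real b \<cdot>\<^sub>m P b"
    using sp b by (simp add: spectral_def adjoint_smult hermitian_mat_def)
  finally show ?thesis .
qed

text \<open>For b different from a, b P_b v = P_b A v = a P_b v forces P_b v = 0. Expanding v with
  the resolution of the identity then leaves only the component for a, or nothing at all if a is not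
  in \<open>S\<close>.\<close>

lemma spectral_eigenvector:
  assumes sp: "spectral d A S P" and v: "v \<in> carrier_vec d" and e: "A *\<^sub>v v = complex_of_real a \<cdot>\<^sub>v v"
  shows "(if a \<in> S then P a else 0\<^sub>m d d) *\<^sub>v v = v"
proof -
  have A: "A \<in> carrier_mat d d" using sp by (simp add: spectral_def)
  have P: "b \<in> S \<Longrightarrow> P b \<in> carrier_mat d d" for b using spectral_carrier[OF sp] .
  have zero: "P b *\<^sub>v v = 0\<^sub>v d" if b: "b \<in> S" "b \<noteq> a" for b
  proof (rule eq_vecI)
    fix i assume "i < dim_vec (0\<^sub>v d :: complex vec)"
    then have i: "i < d" by simp
    have "complex_of_real b \<cdot>\<^sub>v (P b *\<^sub>v v) = (P b * A) *\<^sub>v v"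
      unfolding spectral_adjoint_mult[OF sp b(1)] using smult_mult_mat_vec[OF P[OF b(1)] v] by simp
    also have "\<dots> = P b *\<^sub>v (A *\<^sub>v v)" by (rule assoc_mult_mat_vec[OF P[OF b(1)] A v])
    also have "\<dots> = complex_of_real a \<cdot>\<^sub>v (P b *\<^sub>v v)"
      unfolding e using P[OF b(1)] v by (rule mult_mat_vec)
    finally have "complex_of_real b * vec_index (P b *\<^sub>v v) i = complex_of_real a * vec_index (P b *\<^sub>v v) i"
      using arg_cong[of _ _ "\<lambda>u. vec_index u i"] i P[OF b(1)]
      by (metis carrier_matD(1) dim_mult_mat_vec index_smult_vec(1))
    then show "vec_index (P b *\<^sub>v v) i = vec_index (0\<^sub>v d) i" using b i by simp
  qed (use P[OF b(1)] in auto)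
  have fv: "fcalc d S P (\<lambda>b. if b = a then 0 else 1) *\<^sub>v v = 0\<^sub>v d"
  proof -
    have "(vec_l2 (fcalc d S P (\<lambda>b. if b = a then 0 else 1) *\<^sub>v v))\<^sup>2 = 0"
      unfolding fcalc_vec_l2[OF sp v] by (rule sum.neutral) (auto simp: zero)
    then show ?thesis using vec_l2_eq_0[of "fcalc d S P (\<lambda>b. if b = a then 0 else 1) *\<^sub>v v"] by simp
  qed
  let ?Q = "if a \<in> S then P a else 0\<^sub>m d d"
  have Q: "?Q \<in> carrier_mat d d" using P by auto
  have Qf: "?Q = fcalc d S P (\<lambda>b. if b = a then 1 else 0)"
  proof (rule eq_matI)
    fix i j assume "i < dim_row (fcalc d S P (\<lambda>b. if b = a then 1 else 0))" "j < dim_col (fcalc d S P (\<lambda>b. if b = a then 1 else 0))"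
    then have ij: "i < d" "j < d" by auto
    have "(\<Sum>b\<in>S. (if b = a then 1 else 0) * P b $$ (i, j)) = (\<Sum>b\<in>S. if b = a then P a $$ (i, j) else 0)"
      by (intro sum.cong refl) auto
    then show "?Q $$ (i, j) = fcalc d S P (\<lambda>b. if b = a then 1 else 0) $$ (i, j)"
      using sp ij by (simp add: index_fcalc[OF sp ij] spectral_def)
  qed (use Q in auto)
  have "1\<^sub>m d = ?Q + fcalc d S P (\<lambda>b. if b = a then 0 else 1)"
    unfolding Qf fcalc_add[OF sp] fcalc_one[OF sp, symmetric] by (rule fcalc_cong[OF sp]) auto
  then have "v = (?Q + fcalc d S P (\<lambda>b. if b = a then 0 else 1)) *\<^sub>v v" using v by (metis one_mult_mat_vec)
  also have "\<dots> = ?Q *\<^sub>v v + 0\<^sub>v d"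
    using add_mult_distrib_mat_vec[OF Q fcalc_carrier v] fv by simp
  also have "\<dots> = ?Q *\<^sub>v v" using mult_mat_vec_carrier[OF Q v] by simp
  finally show ?thesis ..
qed

text \<open>The columns of Q are fixed by Q because Q is idempotent, hence they are fixed by
  P.\<close>

lemma mult_eq_of_fixed:
  assumes P: "P \<in> carrier_mat d d" and Q: "Q \<in> carrier_mat d d" "Q * Q = Q"
    and fixed: "\<And>v. v \<in> carrier_vec d \<Longrightarrow> Q *\<^sub>v v = v \<Longrightarrow> P *\<^sub>v v = v"
  shows "P * Q = Q"
proof (rule mat_col_eqI)
  fix j assume "j < dim_col Q"
  then have j: "j < d" using Q by simp
  have c: "col Q j \<in> carrier_vec d" using Q by auto
  have "Q *\<^sub>v col Q j = col Q j" using col_mult2[OF Q(1) Q(1) j] Q(2) by simp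
  then have "P *\<^sub>v col Q j = col Q j" using fixed[OF c] by simp
  then show "col (P * Q) j = col Q j" using col_mult2[OF P Q(1) j] by simp
qed (use P Q in auto)

text \<open>Equal fixed spaces give P Q = Q and Q P = P. The adjoint of the first equation is Q P =
  Q.\<close>

lemma projection_unique:
  assumes P: "hermitian_mat d P" "P * P = P" and Q: "hermitian_mat d Q" "Q * Q = Q"
    and eq: "\<And>v. v \<in> carrier_vec d \<Longrightarrow> P *\<^sub>v v = v \<longleftrightarrow> Q *\<^sub>v v = v"
  shows "P = Q"
proof -
  have Pc: "P \<in> carrier_mat d d" and Qc: "Q \<in> carrier_mat d d" using P Q by (auto simp: hermitian_mat_def)
  have "P * Q = Q" by (rule mult_eq_of_fixed[OF Pc Qc Q(2)]) (use eq in auto)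
  moreover have "Q * P = P" by (rule mult_eq_of_fixed[OF Qc Pc P(2)]) (use eq in auto)
  ultimately show ?thesis
    using adjoint_mult[OF Pc Qc] hermitian_adjoint[OF P(1)] hermitian_adjoint[OF Q(1)] by simp
qed

text \<open>Resolves the definite description in \<open>eigenspace_projection\<close>: the candidate
  has the right fixed space, and a Hermitian idempotent is determined by its fixed space.\<close>

lemma eigenspace_projection_spectral:
  assumes sp: "spectral d A S P"
  shows "eigenspace_projection A a = (if a \<in> S then P a else 0\<^sub>m d d)"
proof -
  let ?Q = "if a \<in> S then P a else 0\<^sub>m d d"
  have d: "dim_row A = d" and A: "A \<in> carrier_mat d d" using sp by (auto simp: spectral_def)
  have z: "hermitian_mat d (0\<^sub>m d d)" by (auto simp: hermitian_mat_def intro!: eq_matI)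
  have Qh: "hermitian_mat d ?Q" using sp z by (auto simp: spectral_def)
  have QQ: "?Q * ?Q = ?Q" using sp by (auto simp: spectral_def)
  have Qc: "?Q \<in> carrier_mat d d" using Qh by (rule hermitian_carrier)
  have AQ: "A * ?Q = complex_of_real a \<cdot>\<^sub>m ?Q" using sp A by (auto simp: spectral_def)
  have fixed: "?Q *\<^sub>v v = v \<longleftrightarrow> A *\<^sub>v v = complex_of_real a \<cdot>\<^sub>v v" if v: "v \<in> carrier_vec d" for v
  proof
    assume q: "?Q *\<^sub>v v = v"
    have "A *\<^sub>v (?Q *\<^sub>v v) = (A * ?Q) *\<^sub>v v" by (rule assoc_mult_mat_vec[OF A Qc v, symmetric])
    also have "\<dots> = complex_of_real a \<cdot>\<^sub>v (?Q *\<^sub>v v)" unfolding AQ by (rule smult_mult_mat_vec[OF Qc v])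
    finally show "A *\<^sub>v v = complex_of_real a \<cdot>\<^sub>v v" unfolding q .
  next
    assume "A *\<^sub>v v = complex_of_real a \<cdot>\<^sub>v v"
    then show "?Q *\<^sub>v v = v" by (rule spectral_eigenvector[OF sp v])
  qed
  show ?thesis
    unfolding eigenspace_projection_def d
  proof (rule the_equality)
    show "hermitian_mat d ?Q \<and> ?Q * ?Q = ?Q \<and> (\<forall>v\<in>carrier_vec d. ?Q *\<^sub>v v = v \<longleftrightarrow> A *\<^sub>v v = complex_of_real a \<cdot>\<^sub>v v)"
      by (intro conjI ballI Qh QQ fixed)
    fix R assume R: "hermitian_mat d R \<and> R * R = R \<and> (\<forall>v\<in>carrier_vec d. R *\<^sub>v v = v \<longleftrightarrow> A *\<^sub>v v = complex_of_real a \<cdot>\<^sub>v v)"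
    show "R = ?Q"
    proof (rule projection_unique[OF _ _ Qh QQ])
      fix v :: "complex vec" assume v: "v \<in> carrier_vec d"
      show "R *\<^sub>v v = v \<longleftrightarrow> ?Q *\<^sub>v v = v" unfolding fixed[OF v] using R v by blast
    qed (use R in auto)
  qed
qed

lemma mat_trace_conjugation:
  assumes M: "M \<in> carrier_mat d d" and C: "C \<in> carrier_mat d m"
  shows "mat_trace (C\<^sup>\<dagger> * (M * C)) = (\<Sum>i<m. (M *\<^sub>v col C i) \<bullet>c col C i)"
proof -
  have MC: "M * C \<in> carrier_mat d m" using M C by simp
  have "mat_trace (C\<^sup>\<dagger> * (M * C)) = (\<Sum>i<m. \<Sum>l<d. cnj (C $$ (l, i)) * (M * C) $$ (l, i))"
    unfolding mat_trace_mult[OF adjoint_carrier[OF C] MC]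
    using C by (intro sum.cong refl) (simp del: index_mult_mat(1) index_mult)
  also have "\<dots> = (\<Sum>i<m. (M *\<^sub>v col C i) \<bullet>c col C i)"
  proof (intro sum.cong refl)
    fix i assume "i \<in> {..<m}"
    then have i: "i < m" by simp
    have e: "vec_index (M *\<^sub>v col C i) l = (M * C) $$ (l, i)" if "l < d" for l
      using M C i that by (simp del: index_mult)
    have "(M *\<^sub>v col C i) \<bullet>c col C i = (\<Sum>l<dim_vec (col C i). vec_index (M *\<^sub>v col C i) l * cnj (vec_index (col C i) l))"
      using M C by (intro cscalar_prod_index) auto
    also have "\<dots> = (\<Sum>l<d. cnj (C $$ (l, i)) * (M * C) $$ (l, i))"
      using C i e by (intro sum.cong) (auto simp: mult.commute simp del: index_mult_mat index_mult index_mult_mat_vec)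
    finally show "(\<Sum>l<d. cnj (C $$ (l, i)) * (M * C) $$ (l, i)) = (M *\<^sub>v col C i) \<bullet>c col C i" ..
  qed
  finally show ?thesis .
qed

lemma pmf_embed_finite:
  assumes "finite S" "\<And>x. 0 \<le> f x" "\<And>x. x \<notin> S \<Longrightarrow> f x = 0" "sum f S = 1"
  shows "pmf (embed_pmf f) x = f x"
proof (rule pmf_embed_pmf)
  have "(\<integral>\<^sup>+x. ennreal (f x) \<partial>count_space UNIV) = (\<Sum>x\<in>S. ennreal (f x))"
    using assms by (intro nn_integral_count_space') auto
  also have "\<dots> = 1" using assms by (simp add: sum_ennreal)
  finally show "(\<integral>\<^sup>+x. ennreal (f x) \<partial>count_space UNIV) = 1" .
qed (use assms in auto)

text \<open>The Born weights form a distribution: each is a sum of values of the quadratic form of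
  \<sigma> on the columns of a projection, and together they give the trace of \<sigma>. Only then
  does \<open>embed_pmf\<close> have the intended values.\<close>

lemma measure_observable_outcome:
  assumes A: "hermitian_mat d A" and s: "density_mat d \<sigma>" and b: "op_bound A c"
  shows "finite (set_pmf (measure_observable A \<sigma>))"
    and "measure_pmf.expectation (measure_observable A \<sigma>) (\<lambda>x. x) = Re (mat_trace (A * \<sigma>))"
    and "x \<in> set_pmf (measure_observable A \<sigma>) \<Longrightarrow> \<bar>x\<bar> \<le> c"
proof -
  obtain S P where sp: "spectral d A S P" using spectral_decomposition[OF A] .
  have P: "a \<in> S \<Longrightarrow> P a \<in> carrier_mat d d" for a using spectral_carrier[OF sp] .
  have fin: "finite S" using sp by (simp add: spectral_def)
  have sc: "\<sigma> \<in> carrier_mat d d" using s by (auto simp: density_mat_def hermitian_mat_def)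
  let ?f = "\<lambda>a. Re (mat_trace (eigenspace_projection A a * \<sigma>))"
  have f: "?f a = (if a \<in> S then Re (mat_trace (P a * \<sigma>)) else 0)" for a
    unfolding eigenspace_projection_spectral[OF sp] using sc by (auto simp: mat_trace_def)
  have nonneg: "0 \<le> Re (mat_trace (P a * \<sigma>))" if a: "a \<in> S" for a
  proof -
    have Pa: "(P a)\<^sup>\<dagger> = P a" "P a * P a = P a" using sp a by (auto simp: spectral_def hermitian_mat_def)
    have Ps: "\<sigma> * P a \<in> carrier_mat d d" using sc P[OF a] by simp
    have "mat_trace (P a * \<sigma>) = mat_trace (\<sigma> * P a)" by (rule mat_trace_comm[OF P[OF a] sc])
    also have "\<sigma> * P a = (\<sigma> * P a) * P a"
      using assoc_mult_mat[OF sc P[OF a] P[OF a]] Pa by simp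
    also have "mat_trace \<dots> = mat_trace ((P a)\<^sup>\<dagger> * (\<sigma> * P a))"
      unfolding Pa(1) by (rule mat_trace_comm[OF Ps P[OF a]])
    also have "\<dots> = (\<Sum>i<d. (\<sigma> *\<^sub>v col (P a) i) \<bullet>c col (P a) i)"
      by (rule mat_trace_conjugation[OF sc P[OF a]])
    finally show ?thesis using s P[OF a] by (auto simp: density_mat_def intro!: sum_nonneg)
  qed
  \<comment> \<open>Used with the constant function 1 for the normalisation and with the identity
    function for the expectation.\<close>
  have trsum: "(\<Sum>a\<in>S. complex_of_real (g a) * mat_trace (P a * \<sigma>)) = mat_trace (fcalc d S P (\<lambda>a. complex_of_real (g a)) * \<sigma>)" for g
  proof -
    have c: "a \<in> S \<Longrightarrow> complex_of_real (g a) \<cdot>\<^sub>m P a \<in> carrier_mat d d" for a using P by simp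
    have "mat_trace (fcalc d S P (\<lambda>a. complex_of_real (g a)) * \<sigma>) = (\<Sum>a\<in>S. mat_trace ((complex_of_real (g a) \<cdot>\<^sub>m P a) * \<sigma>))"
    proof -
      have "mat_sum d S (\<lambda>a. complex_of_real (g a) \<cdot>\<^sub>m P a) * \<sigma> = mat_sum d S (\<lambda>a. (complex_of_real (g a) \<cdot>\<^sub>m P a) * \<sigma>)"
        using sc c by (rule mat_sum_mult)
      then show ?thesis
        unfolding fcalc_def using mat_trace_sum[of S "\<lambda>a. (complex_of_real (g a) \<cdot>\<^sub>m P a) * \<sigma>" d] mult_carrier_mat[OF c sc] by simp
    qed
    also have "\<dots> = (\<Sum>a\<in>S. complex_of_real (g a) * mat_trace (P a * \<sigma>))"
    proof (intro sum.cong refl)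
      fix a assume a: "a \<in> S"
      show "mat_trace ((complex_of_real (g a) \<cdot>\<^sub>m P a) * \<sigma>) = complex_of_real (g a) * mat_trace (P a * \<sigma>)"
        unfolding mult_smult_assoc_mat[OF P[OF a] sc] by (rule mat_trace_smult[OF mult_carrier_mat[OF P[OF a] sc]])
    qed
    finally show ?thesis ..
  qed
  have one: "sum ?f S = 1"
  proof -
    have "sum ?f S = Re (\<Sum>a\<in>S. complex_of_real 1 * mat_trace (P a * \<sigma>))" by (simp add: f)
    also have "\<dots> = Re (mat_trace (1\<^sub>m d * \<sigma>))" unfolding trsum using fcalc_one[OF sp] by simp
    also have "\<dots> = 1" using sc s by (simp add: density_mat_def)
    finally show ?thesis .
  qed
  have pmf: "pmf (measure_observable A \<sigma>) a = ?f a" for a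
    unfolding measure_observable_def by (rule pmf_embed_finite[OF fin _ _ one]) (use nonneg f in auto)
  have supp: "set_pmf (measure_observable A \<sigma>) \<subseteq> S"
  proof
    fix a assume "a \<in> set_pmf (measure_observable A \<sigma>)"
    then have "pmf (measure_observable A \<sigma>) a \<noteq> 0" by (simp add: set_pmf_iff)
    then show "a \<in> S" unfolding pmf f by (auto split: if_splits)
  qed
  then show "finite (set_pmf (measure_observable A \<sigma>))" using fin finite_subset by blast
  have "measure_pmf.expectation (measure_observable A \<sigma>) (\<lambda>x. x) = (\<Sum>a\<in>S. pmf (measure_observable A \<sigma>) a *\<^sub>R a)"
    using fin by (rule integral_measure_pmf) (use supp in auto)
  also have "\<dots> = Re (\<Sum>a\<in>S. complex_of_real a * mat_trace (P a * \<sigma>))" by (simp add: pmf f mult.commute)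
  also have "\<dots> = Re (mat_trace (A * \<sigma>))" unfolding trsum using fcalc_id[OF sp] by simp
  finally show "measure_pmf.expectation (measure_observable A \<sigma>) (\<lambda>x. x) = Re (mat_trace (A * \<sigma>))" .
  assume x: "x \<in> set_pmf (measure_observable A \<sigma>)"
  then have xS: "x \<in> S" using supp by auto
  \<comment> \<open>Membership in \<open>S\<close> does not make x an eigenvalue, but positive
    probability does, since a zero projection has Born weight 0.\<close>
  have "P x \<noteq> 0\<^sub>m d d"
  proof
    assume "P x = 0\<^sub>m d d"
    then have "?f x = 0" using xS f[of x] sc by (simp add: mat_trace_def)
    then show False using x pmf[of x] by (simp add: set_pmf_iff)
  qed
  then show "\<bar>x\<bar> \<le> c" by (rule spectral_eigenvalue_bound[OF sp xS _ b])
qed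

section \<open>Density matrices and channels\<close>

lemma density_carrier: "density_mat d \<rho> \<Longrightarrow> \<rho> \<in> carrier_mat d d"
  and density_hermitian: "density_mat d \<rho> \<Longrightarrow> hermitian_mat d \<rho>"
  and density_trace: "density_mat d \<rho> \<Longrightarrow> mat_trace \<rho> = 1"
  by (auto simp: density_mat_def hermitian_mat_def)

lemma gram_positive:
  fixes G :: "complex mat"
  assumes G: "G \<in> carrier_mat n m"
  shows "hermitian_mat n (G * G\<^sup>\<dagger>)" "v \<in> carrier_vec n \<Longrightarrow> 0 \<le> Re (((G * G\<^sup>\<dagger>) *\<^sub>v v) \<bullet>c v)"
proof -
  have G': "G\<^sup>\<dagger> \<in> carrier_mat m n" using G by (rule adjoint_carrier)
  show "hermitian_mat n (G * G\<^sup>\<dagger>)"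
    unfolding hermitian_mat_def using mult_carrier_mat[OF G G'] adjoint_mult[OF G G'] by simp
  assume v: "v \<in> carrier_vec n"
  have G'v: "G\<^sup>\<dagger> *\<^sub>v v \<in> carrier_vec m" by (rule mult_mat_vec_carrier[OF G' v])
  have "((G * G\<^sup>\<dagger>) *\<^sub>v v) \<bullet>c v = (G *\<^sub>v (G\<^sup>\<dagger> *\<^sub>v v)) \<bullet>c v"
    by (simp only: assoc_mult_mat_vec[OF G G' v])
  also have "\<dots> = (G\<^sup>\<dagger> *\<^sub>v v) \<bullet>c (G\<^sup>\<dagger> *\<^sub>v v)" by (rule cscalar_prod_adjoint[OF G G'v v])
  finally show "0 \<le> Re (((G * G\<^sup>\<dagger>) *\<^sub>v v) \<bullet>c v)" by (simp add: cscalar_prod_self)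
qed

text \<open>Conjugation and tensor products act on the Gram factor of a state, so positivity of the
  result is immediate and only the trace remains to be computed.\<close>

lemma density_gram:
  assumes "G \<in> carrier_mat n m" "mat_trace (G * G\<^sup>\<dagger>) = 1"
  shows "density_mat n (G * G\<^sup>\<dagger>)"
  using gram_positive[OF assms(1)] assms(2) by (auto simp: density_mat_def)

lemma density_conjugate:
  assumes s: "density_mat d \<sigma>" and V: "V \<in> carrier_mat d d" "V\<^sup>\<dagger> * V = 1\<^sub>m d"
  shows "density_mat d (V * \<sigma> * V\<^sup>\<dagger>)"
proof -
  obtain C where C: "C \<in> carrier_mat d d" "\<sigma> = C * C\<^sup>\<dagger>" using density_factorization[OF s] .
  have C': "C\<^sup>\<dagger> \<in> carrier_mat d d" and V': "V\<^sup>\<dagger> \<in> carrier_mat d d" using C(1) V(1) by simp_all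
  have sc: "\<sigma> \<in> carrier_mat d d" using s by (rule density_carrier)
  have VC: "V * C \<in> carrier_mat d d" using V C by simp
  have eq: "V * \<sigma> * V\<^sup>\<dagger> = (V * C) * (V * C)\<^sup>\<dagger>"
  proof -
    have "(V * C) * (V * C)\<^sup>\<dagger> = (V * C) * (C\<^sup>\<dagger> * V\<^sup>\<dagger>)" by (simp only: adjoint_mult[OF V(1) C(1)])
    also have "\<dots> = ((V * C) * C\<^sup>\<dagger>) * V\<^sup>\<dagger>" by (rule assoc_mult_mat[OF VC C' V', symmetric])
    also have "(V * C) * C\<^sup>\<dagger> = V * \<sigma>" unfolding C(2) by (rule assoc_mult_mat[OF V(1) C(1) C'])
    finally show ?thesis ..
  qed
  have "mat_trace (V * \<sigma> * V\<^sup>\<dagger>) = mat_trace (V\<^sup>\<dagger> * (V * \<sigma>))"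
    by (rule mat_trace_comm[OF mult_carrier_mat[OF V(1) sc] V'])
  also have "V\<^sup>\<dagger> * (V * \<sigma>) = \<sigma>"
    using assoc_mult_mat[OF V' V(1) sc] V(2) sc by simp
  finally have "mat_trace (V * \<sigma> * V\<^sup>\<dagger>) = 1" using density_trace[OF s] by simp
  then show ?thesis unfolding eq by (rule density_gram[OF VC])
qed

lemma density_kron:
  assumes "density_mat d \<rho>" "density_mat e \<omega>"
  shows "density_mat (d * e) (\<rho> \<Otimes> \<omega>)"
proof -
  obtain B where B: "B \<in> carrier_mat d d" "\<rho> = B * B\<^sup>\<dagger>" using density_factorization[OF assms(1)] .
  obtain C where C: "C \<in> carrier_mat e e" "\<omega> = C * C\<^sup>\<dagger>" using density_factorization[OF assms(2)] .
  have eq: "\<rho> \<Otimes> \<omega> = (B \<Otimes> C) * (B \<Otimes> C)\<^sup>\<dagger>"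
    unfolding B(2) C(2) kron_adjoint[OF B(1) C(1)]
    by (rule kron_mult[OF B(1) C(1) adjoint_carrier[OF B(1)] adjoint_carrier[OF C(1)], symmetric])
  have "mat_trace (\<rho> \<Otimes> \<omega>) = 1"
    using kron_trace[OF density_carrier[OF assms(1)] density_carrier[OF assms(2)]] assms
    by (simp add: density_trace)
  then show ?thesis unfolding eq by (rule density_gram[OF kron_carrier[OF B(1) C(1)]])
qed

text \<open>Positivity again uses rank-one pieces: the quadratic form of the partial trace at v is
  the sum over the standard basis e_k of the form of M at v tensor e_k.\<close>

lemma density_ptrace:
  assumes s: "density_mat (d * e) M"
  shows "density_mat d (ptrace_snd d e M)"
  unfolding density_mat_def
proof (intro conjI ballI)
  have M: "M \<in> carrier_mat (d * e) (d * e)" and Mh: "M\<^sup>\<dagger> = M"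
    using density_hermitian[OF s] by (auto simp: hermitian_mat_def)
  show "mat_trace (ptrace_snd d e M) = 1" using mat_trace_ptrace[OF M] density_trace[OF s] by simp
  show "hermitian_mat d (ptrace_snd d e M)"
    unfolding hermitian_mat_def
  proof (intro conjI ptrace_carrier eq_matI)
    fix i j assume "i < dim_row (ptrace_snd d e M)" "j < dim_col (ptrace_snd d e M)"
    then have ij: "i < d" "j < d" by (auto simp: ptrace_snd_def)
    have "cnj (M $$ (j * e + k, i * e + k)) = M $$ (i * e + k, j * e + k)" if "k < e" for k
      using index_adjoint[of "i * e + k" M "j * e + k"] M Mh product_index_less[OF ij(1) that] product_index_less[OF ij(2) that]
      by simp
    then show "(ptrace_snd d e M)\<^sup>\<dagger> $$ (i, j) = ptrace_snd d e M $$ (i, j)"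
      using ij by (simp add: ptrace_snd_def)
  qed (auto simp: ptrace_snd_def)
  fix v :: "complex vec" assume v: "v \<in> carrier_vec d"
  have o: "outer v v \<in> carrier_mat d d" using v by simp
  define u where "u k = vec_kron v (col (1\<^sub>m e) k)" for k
  have u: "u k \<in> carrier_vec (d * e)" for k unfolding u_def by (intro vec_kron_carrier v carrier_vecI) simp
  have uo: "outer (u k) (u k) \<in> carrier_mat (d * e) (d * e)" for k using u by simp
  have "(ptrace_snd d e M *\<^sub>v v) \<bullet>c v = mat_trace (ptrace_snd d e M * outer v v)"
    by (rule mat_trace_outer[OF ptrace_carrier v v, symmetric])
  also have "\<dots> = mat_trace (outer v v * ptrace_snd d e M)" by (rule mat_trace_comm[OF ptrace_carrier o])
  also have "\<dots> = mat_trace ((outer v v \<Otimes> 1\<^sub>m e) * M)" by (rule mat_trace_mult_ptrace[OF o M])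
  also have "\<dots> = mat_trace (M * (outer v v \<Otimes> 1\<^sub>m e))"
    by (rule mat_trace_comm[OF kron_carrier[OF o one_carrier_mat] M])
  also have "outer v v \<Otimes> 1\<^sub>m e = mat_sum (d * e) {..<e} (\<lambda>k. outer (u k) (u k))"
    using outer_kron_gram[OF v v one_carrier_mat[of e]] by (simp add: u_def)
  also have "M * \<dots> = mat_sum (d * e) {..<e} (\<lambda>k. M * outer (u k) (u k))"
    using M uo by (rule mult_mat_sum)
  also have "mat_trace \<dots> = (\<Sum>k<e. mat_trace (M * outer (u k) (u k)))"
    using mult_carrier_mat[OF M uo] by (rule mat_trace_sum)
  also have "\<dots> = (\<Sum>k<e. (M *\<^sub>v u k) \<bullet>c u k)" by (simp only: mat_trace_outer[OF M u u])
  finally show "0 \<le> Re ((ptrace_snd d e M *\<^sub>v v) \<bullet>c v)"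
    using s u by (auto simp: density_mat_def intro!: sum_nonneg)
qed

lemma density_plus_state: "density_mat 2 plus_state"
proof -
  have p: "plus_state \<in> carrier_mat 2 2" by (simp add: plus_state_def)
  have "plus_state = plus_state * plus_state\<^sup>\<dagger>"
    by (rule eq_matI) (auto simp: plus_state_def scalar_prod_def numeral_2_eq_2)
  moreover have "mat_trace plus_state = 1" by (simp add: mat_trace_def plus_state_def numeral_2_eq_2)
  ultimately show ?thesis using density_gram[OF p] by simp
qed

lemma mat_trace_adjoint: "M \<in> carrier_mat d d \<Longrightarrow> mat_trace (M\<^sup>\<dagger>) = cnj (mat_trace M)"
  by (auto simp: mat_trace_def)

text \<open>Conjugation reverses the product and cyclicity restores it. As a consequence the complex
  modulus in the accuracy claim is a distance of real numbers.\<close>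

lemma hermitian_trace_real:
  assumes "hermitian_mat d A" "hermitian_mat d B"
  shows "complex_of_real (Re (mat_trace (A * B))) = mat_trace (A * B)"
proof -
  have A: "A \<in> carrier_mat d d" "A\<^sup>\<dagger> = A" and B: "B \<in> carrier_mat d d" "B\<^sup>\<dagger> = B" using assms by (auto simp: hermitian_mat_def)
  have "cnj (mat_trace (A * B)) = mat_trace ((A * B)\<^sup>\<dagger>)" using A B
    by (intro mat_trace_adjoint[symmetric, of _ d]) simp
  also have "\<dots> = mat_trace (B * A)" using adjoint_mult[OF A(1) B(1)] A B by simp
  also have "\<dots> = mat_trace (A * B)" by (rule mat_trace_comm[OF B(1) A(1)])
  finally show ?thesis by (simp add: complex_eq_iff)
qed

text \<open>Left and right factor are separate parameters. Equal factors give a collision or its LCU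
  approximation; different factors occur in the off-diagonal ancilla block, where the two samples
  act on different sides.\<close>

definition chan :: "nat \<Rightarrow> nat \<Rightarrow> complex mat \<Rightarrow> complex mat \<Rightarrow> complex mat \<Rightarrow> complex mat \<Rightarrow> complex mat" where
  "chan d e \<omega> W V X = ptrace_snd d e (W * (X \<Otimes> \<omega>) * V\<^sup>\<dagger>)"

definition dual_chan :: "nat \<Rightarrow> nat \<Rightarrow> complex mat \<Rightarrow> complex mat \<Rightarrow> complex mat \<Rightarrow> complex mat \<Rightarrow> complex mat" where
  "dual_chan d e \<omega> W V A = slice d e \<omega> (V\<^sup>\<dagger> * (A \<Otimes> 1\<^sub>m e) * W)"

lemma chan_carrier [simp]: "chan d e \<omega> W V X \<in> carrier_mat d d"
  and dual_chan_carrier [simp]: "dual_chan d e \<omega> W V X \<in> carrier_mat d d"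
  by (simp_all add: chan_def dual_chan_def)

lemma mat_trace_chan_eq:
  assumes A: "A \<in> carrier_mat d d" and X: "X \<in> carrier_mat d d" and R: "\<omega> \<in> carrier_mat e e"
    and W: "W \<in> carrier_mat (d * e) (d * e)" and V: "V \<in> carrier_mat (d * e) (d * e)"
  shows "mat_trace (A * chan d e \<omega> W V X) = mat_trace ((A \<Otimes> 1\<^sub>m e) * (W * (X \<Otimes> \<omega>) * V\<^sup>\<dagger>))"
proof -
  have "W * (X \<Otimes> \<omega>) * V\<^sup>\<dagger> \<in> carrier_mat (d * e) (d * e)"
    by (intro mult_carrier_mat[of _ _ "d * e"] W kron_carrier X R adjoint_carrier V)
  then show ?thesis unfolding chan_def by (rule mat_trace_mult_ptrace[OF A])
qed

text \<open>Cyclicity brings the right factor to the front of the observable; the dualities for the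
  partial trace and for tensoring with \<omega> do the rest.\<close>

lemma mat_trace_chan:
  assumes A: "A \<in> carrier_mat d d" and X: "X \<in> carrier_mat d d" and R: "\<omega> \<in> carrier_mat e e"
    and W: "W \<in> carrier_mat (d * e) (d * e)" and V: "V \<in> carrier_mat (d * e) (d * e)"
  shows "mat_trace (A * chan d e \<omega> W V X) = mat_trace (dual_chan d e \<omega> W V A * X)"
proof -
  let ?D = "d * e"
  let ?A = "A \<Otimes> 1\<^sub>m e" and ?Z = "X \<Otimes> \<omega>"
  have A1: "?A \<in> carrier_mat ?D ?D" by (rule kron_carrier[OF A one_carrier_mat])
  have Z: "?Z \<in> carrier_mat ?D ?D" by (rule kron_carrier[OF X R])
  have V': "V\<^sup>\<dagger> \<in> carrier_mat ?D ?D" by (rule adjoint_carrier[OF V])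
  have WZ: "W * ?Z \<in> carrier_mat ?D ?D" by (rule mult_carrier_mat[OF W Z])
  have AWZ: "?A * (W * ?Z) \<in> carrier_mat ?D ?D" by (rule mult_carrier_mat[OF A1 WZ])
  have VA: "V\<^sup>\<dagger> * ?A \<in> carrier_mat ?D ?D" by (rule mult_carrier_mat[OF V' A1])
  have VAW: "V\<^sup>\<dagger> * ?A * W \<in> carrier_mat ?D ?D" by (rule mult_carrier_mat[OF VA W])
  have "mat_trace (A * chan d e \<omega> W V X) = mat_trace (?A * (W * ?Z * V\<^sup>\<dagger>))"
    by (rule mat_trace_chan_eq[OF A X R W V])
  also have "?A * (W * ?Z * V\<^sup>\<dagger>) = (?A * (W * ?Z)) * V\<^sup>\<dagger>" by (rule assoc_mult_mat[OF A1 WZ V', symmetric])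
  also have "mat_trace \<dots> = mat_trace (V\<^sup>\<dagger> * (?A * (W * ?Z)))" by (rule mat_trace_comm[OF AWZ V'])
  also have "V\<^sup>\<dagger> * (?A * (W * ?Z)) = (V\<^sup>\<dagger> * ?A) * (W * ?Z)" by (rule assoc_mult_mat[OF V' A1 WZ, symmetric])
  also have "\<dots> = (V\<^sup>\<dagger> * ?A * W) * ?Z" by (rule assoc_mult_mat[OF VA W Z, symmetric])
  also have "mat_trace \<dots> = mat_trace (dual_chan d e \<omega> W V A * X)"
    unfolding dual_chan_def by (rule mat_trace_slice[OF VAW X R, symmetric])
  finally show ?thesis .
qed

lemma op_bound_conjugation:
  assumes A: "A \<in> carrier_mat d d" "op_bound A a" "0 \<le> a"
    and W: "W \<in> carrier_mat (d * e) (d * e)" "op_bound W w" "0 \<le> w"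
    and V: "V \<in> carrier_mat (d * e) (d * e)" "op_bound V v" "0 \<le> v"
  shows "op_bound (V\<^sup>\<dagger> * (A \<Otimes> 1\<^sub>m e) * W) (v * a * w)"
  using assms by (intro op_bound_mult[of _ "d * e" "d * e" _ "d * e"] mult_carrier_mat[of _ _ "d * e"]
    adjoint_carrier kron_carrier op_bound_adjoint op_bound_kron_one) auto

lemma op_bound_dual_chan:
  assumes A: "A \<in> carrier_mat d d" "op_bound A a" "0 \<le> a" and R: "density_mat e \<omega>"
    and W: "W \<in> carrier_mat (d * e) (d * e)" "op_bound W w" "0 \<le> w"
    and V: "V \<in> carrier_mat (d * e) (d * e)" "op_bound V v" "0 \<le> v"
  shows "op_bound (dual_chan d e \<omega> W V A) (v * a * w)"
proof -
  obtain C where C: "C \<in> carrier_mat e e" "\<omega> = C * C\<^sup>\<dagger>" using density_factorization[OF R] .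
  show ?thesis unfolding dual_chan_def
  proof (rule op_bound_slice[OF _ _ _ C density_trace[OF R]])
    show "V\<^sup>\<dagger> * (A \<Otimes> 1\<^sub>m e) * W \<in> carrier_mat (d * e) (d * e)"
      by (intro mult_carrier_mat[of _ _ "d * e"] W kron_carrier A one_carrier_mat adjoint_carrier V)
    show "op_bound (V\<^sup>\<dagger> * (A \<Otimes> 1\<^sub>m e) * W) (v * a * w)" by (rule op_bound_conjugation[OF A W V])
  qed (use assms in auto)
qed

text \<open>The instance of Hoelder duality between operator and trace norm that is required,
  obtained from the unit sum of squared column norms of a Gram factor.\<close>

lemma density_trace_bound:
  assumes R: "density_mat d \<rho>" and A: "A \<in> carrier_mat d d" "op_bound A a"
  shows "cmod (mat_trace (A * \<rho>)) \<le> a"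
proof -
  obtain C where C: "C \<in> carrier_mat d d" "\<rho> = C * C\<^sup>\<dagger>" using density_factorization[OF R] .
  have C': "C\<^sup>\<dagger> \<in> carrier_mat d d" using C by simp
  have c: "col C i \<in> carrier_vec d" for i using C by auto
  have "A * \<rho> = (A * C) * C\<^sup>\<dagger>" unfolding C(2) by (rule assoc_mult_mat[OF A(1) C(1) C', symmetric])
  also have "mat_trace \<dots> = mat_trace (C\<^sup>\<dagger> * (A * C))" by (rule mat_trace_comm[OF mult_carrier_mat[OF A(1) C(1)] C'])
  also have "\<dots> = (\<Sum>i<d. (A *\<^sub>v col C i) \<bullet>c col C i)" by (rule mat_trace_conjugation[OF A(1) C(1)])
  also have "cmod \<dots> \<le> (\<Sum>i<d. a * (vec_l2 (col C i))\<^sup>2)"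
    using op_bound_sesquilinear[OF A c c] by (intro sum_norm_le) (simp add: power2_eq_square mult.assoc)
  also have "\<dots> = a * (\<Sum>i<d. (vec_l2 (col C i))\<^sup>2)" by (simp add: sum_distrib_left)
  also have "(\<Sum>i<d. (vec_l2 (col C i))\<^sup>2) = 1"
    using mat_trace_gram[OF C(1)] C density_trace[OF R] by (metis of_real_eq_1_iff)
  finally show ?thesis by simp
qed

text \<open>The induction step for the accumulated error c. First X is exchanged for Y while keeping
  the dual channel of W, which costs c (1 + \<epsilon>)^2 a; then W is exchanged for U on the state
  Y, which costs ((1 + \<epsilon>)^2 - 1) a. The hypothesis on X and Y ranges over all observables
  because it is applied to the dual observable.\<close>

lemma chan_perturbation:
  assumes A: "A \<in> carrier_mat d d" "op_bound A a" "0 \<le> a" and R: "density_mat e \<omega>"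
    and W: "W \<in> carrier_mat (d * e) (d * e)" and U: "U \<in> carrier_mat (d * e) (d * e)" "op_bound U 1"
    and WU: "op_bound (W - U) \<epsilon>" "0 \<le> \<epsilon>"
    and X: "X \<in> carrier_mat d d" and Y: "density_mat d Y"
    and XY: "\<And>A a. A \<in> carrier_mat d d \<Longrightarrow> op_bound A a \<Longrightarrow> 0 \<le> a \<Longrightarrow>
      cmod (mat_trace (A * X) - mat_trace (A * Y)) \<le> c * a"
  shows "cmod (mat_trace (A * chan d e \<omega> W W X) - mat_trace (A * chan d e \<omega> U U Y))
     \<le> ((c + 1) * (1 + \<epsilon>)\<^sup>2 - 1) * a"
proof -
  let ?D = "d * e"
  let ?A = "A \<Otimes> 1\<^sub>m e"
  have Yc: "Y \<in> carrier_mat d d" using Y by (rule density_carrier)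
  have Rc: "\<omega> \<in> carrier_mat e e" using R by (rule density_carrier)
  have A1: "?A \<in> carrier_mat ?D ?D" "op_bound ?A a" by (rule kron_carrier[OF A(1) one_carrier_mat], rule op_bound_kron_one[OF A])
  have E: "W - U \<in> carrier_mat ?D ?D" using W U by auto
  have "W = U + (W - U)" using W U by (intro eq_matI) auto
  then have Wb: "op_bound W (1 + \<epsilon>)" using op_bound_add[OF U(1) E U(2) WU(1)] by simp
  have W': "W\<^sup>\<dagger> \<in> carrier_mat ?D ?D" and U': "U\<^sup>\<dagger> \<in> carrier_mat ?D ?D" using W U by simp_all
  have Eb: "op_bound (V\<^sup>\<dagger> * ?A * V') (v * a * v')"
    if "V \<in> carrier_mat ?D ?D" "op_bound V v" "0 \<le> v" "V' \<in> carrier_mat ?D ?D" "op_bound V' v'" "0 \<le> v'" for V V' v v'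
    by (rule op_bound_conjugation[OF A that(4-6) that(1-3)])
  have c3: "V * ?A * V' \<in> carrier_mat ?D ?D" if "V \<in> carrier_mat ?D ?D" "V' \<in> carrier_mat ?D ?D" for V V'
    using that by (intro mult_carrier_mat[of _ _ "d * e"] A1)
  have step1: "cmod (mat_trace (dual_chan d e \<omega> W W A * X) - mat_trace (dual_chan d e \<omega> W W A * Y)) \<le> c * ((1 + \<epsilon>) * a * (1 + \<epsilon>))"
    using W Wb WU A R by (intro XY dual_chan_carrier op_bound_dual_chan) auto
  let ?BW = "W\<^sup>\<dagger> * ?A * W" and ?BU = "U\<^sup>\<dagger> * ?A * U"
  have Z: "Y \<Otimes> \<omega> \<in> carrier_mat ?D ?D" by (rule kron_carrier[OF Yc Rc])
  have Zd: "density_mat ?D (Y \<Otimes> \<omega>)" by (rule density_kron[OF Y R])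
  \<comment> \<open>Only one of the two factors is exchanged at a time, so the summands contribute
    (1 + \<epsilon>) a \<epsilon> and \<epsilon> a.\<close>
  have BWU: "?BW - ?BU = W\<^sup>\<dagger> * ?A * (W - U) + (W - U)\<^sup>\<dagger> * ?A * U"
  proof -
    have "W\<^sup>\<dagger> * ?A * (W - U) = ?BW - W\<^sup>\<dagger> * ?A * U"
      by (rule mult_minus_distrib_mat[OF mult_carrier_mat[OF W' A1(1)] W U(1)])
    moreover have "(W - U)\<^sup>\<dagger> * ?A * U = W\<^sup>\<dagger> * ?A * U - ?BU"
      unfolding adjoint_minus[OF W U(1)] minus_mult_distrib_mat[OF W' U' A1(1)]
      by (rule minus_mult_distrib_mat[OF mult_carrier_mat[OF W' A1(1)] mult_carrier_mat[OF U' A1(1)] U(1)])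
    moreover have "?BW - ?BU = (?BW - W\<^sup>\<dagger> * ?A * U) + (W\<^sup>\<dagger> * ?A * U - ?BU)"
    proof -
      have gen: "M - N = (M - L) + (L - N)" if "M \<in> carrier_mat ?D ?D" "N \<in> carrier_mat ?D ?D" "L \<in> carrier_mat ?D ?D" for M N L :: "complex mat"
        using that by (intro eq_matI) auto
      show ?thesis by (rule gen) (intro c3 W' U' W U)+
    qed
    ultimately show ?thesis by simp
  qed
  have BWUb: "op_bound (?BW - ?BU) ((1 + \<epsilon>) * a * \<epsilon> + \<epsilon> * a * 1)"
    unfolding BWU using W U WU Wb E A
    by (intro op_bound_add[of _ ?D ?D] Eb c3 adjoint_carrier) auto
  have "mat_trace (dual_chan d e \<omega> W W A * Y) - mat_trace (dual_chan d e \<omega> U U A * Y)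
      = mat_trace (?BW * (Y \<Otimes> \<omega>)) - mat_trace (?BU * (Y \<Otimes> \<omega>))"
    unfolding dual_chan_def
    by (simp only: mat_trace_slice[OF c3[OF W' W] Yc Rc] mat_trace_slice[OF c3[OF U' U(1)] Yc Rc])
  also have "\<dots> = mat_trace ((?BW - ?BU) * (Y \<Otimes> \<omega>))"
    unfolding minus_mult_distrib_mat[OF c3[OF W' W] c3[OF U' U(1)] Z]
    by (rule mat_trace_minus[OF mult_carrier_mat[OF c3[OF W' W] Z] mult_carrier_mat[OF c3[OF U' U(1)] Z], symmetric])
  finally have step2: "cmod (mat_trace (dual_chan d e \<omega> W W A * Y) - mat_trace (dual_chan d e \<omega> U U A * Y)) \<le> (1 + \<epsilon>) * a * \<epsilon> + \<epsilon> * a * 1"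
    using density_trace_bound[OF Zd minus_carrier_mat[OF c3[OF U' U(1)]] BWUb] by simp
  have "cmod (mat_trace (dual_chan d e \<omega> W W A * X) - mat_trace (dual_chan d e \<omega> U U A * Y))
    \<le> c * ((1 + \<epsilon>) * a * (1 + \<epsilon>)) + ((1 + \<epsilon>) * a * \<epsilon> + \<epsilon> * a * 1)"
    using norm_triangle_mono[OF step1 step2] by simp
  also have "\<dots> = ((c + 1) * (1 + \<epsilon>)\<^sup>2 - 1) * a" by (simp add: power2_eq_square algebra_simps)
  finally show ?thesis
    by (simp only: mat_trace_chan[OF A(1) X Rc W W] mat_trace_chan[OF A(1) Yc Rc U(1) U(1)])
qed

section \<open>Blocks with respect to the ancilla\<close>

definition blk :: "nat \<Rightarrow> nat \<Rightarrow> nat \<Rightarrow> complex mat \<Rightarrow> complex mat" where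
  "blk D a b M = mat D D (\<lambda>(i, j). M $$ (a * D + i, b * D + j))"

lemma blk_carrier [simp]: "blk D a b M \<in> carrier_mat D D"
  by (simp add: blk_def)

lemma index_blk [simp]: "i < D \<Longrightarrow> j < D \<Longrightarrow> blk D a b M $$ (i, j) = M $$ (a * D + i, b * D + j)"
  by (simp add: blk_def)

lemma dim_blk [simp]: "dim_row (blk D a b M) = D" "dim_col (blk D a b M) = D"
  by (simp_all add: blk_def)

lemma eq_blkI:
  assumes "M \<in> carrier_mat (2 * D) (2 * D)" "N \<in> carrier_mat (2 * D) (2 * D)"
    "\<And>a b. a < 2 \<Longrightarrow> b < 2 \<Longrightarrow> blk D a b M = blk D a b N"
  shows "M = N"
proof (rule eq_mat_productI[OF assms(1,2)])
  fix a i b j :: nat assume "a < 2" "i < D" "b < 2" "j < D"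
  then show "M $$ (a * D + i, b * D + j) = N $$ (a * D + i, b * D + j)"
    using assms(3)[of a b] index_blk[of i D j a b M] index_blk[of i D j a b N] by simp
qed

text \<open>The ancilla is the most significant part of the joint index, so after regrouping the
  index the choice of an ancilla block does not touch the environment.\<close>

lemma blk_kron:
  assumes "\<sigma> \<in> carrier_mat (2 * d) (2 * d)" "\<omega> \<in> carrier_mat e e" "a < 2" "b < 2"
  shows "blk (d * e) a b (\<sigma> \<Otimes> \<omega>) = blk d a b \<sigma> \<Otimes> \<omega>"
proof (rule eq_mat_productI[of _ d e d e])
  fix i k j l assume l: "i < d" "k < e" "j < d" "l < e"
  have idx: "x * (d * e) + (y * e + z) = (x * d + y) * e + z" for x y z :: nat by (simp add: algebra_simps)
  have "(\<sigma> \<Otimes> \<omega>) $$ ((a * d + i) * e + k, (b * d + j) * e + l) = \<sigma> $$ (a * d + i, b * d + j) * \<omega> $$ (k, l)"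
    using assms l product_index_less[of a 2 i d] product_index_less[of b 2 j d] by (intro index_kron) auto
  then show "blk (d * e) a b (\<sigma> \<Otimes> \<omega>) $$ (i * e + k, j * e + l) = (blk d a b \<sigma> \<Otimes> \<omega>) $$ (i * e + k, j * e + l)"
    using l product_index_less[of i d k e] product_index_less[of j d l e]
    by (simp add: index_kron[OF blk_carrier assms(2)] idx)
qed (use assms in auto)

lemma blk_ptrace:
  assumes "a < 2" "b < 2"
  shows "blk d a b (ptrace_snd (2 * d) e M) = ptrace_snd d e (blk (d * e) a b M)"
proof (rule eq_matI)
  fix i j assume "i < dim_row (ptrace_snd d e (blk (d * e) a b M))" "j < dim_col (ptrace_snd d e (blk (d * e) a b M))"
  then have ij: "i < d" "j < d" by (auto simp: ptrace_snd_def)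
  have idx: "x * (d * e) + (y * e + z) = (x * d + y) * e + z" for x y z :: nat by (simp add: algebra_simps)
  show "blk d a b (ptrace_snd (2 * d) e M) $$ (i, j) = ptrace_snd d e (blk (d * e) a b M) $$ (i, j)"
    using ij assms product_index_less[of a 2 i d] product_index_less[of b 2 j d]
      product_index_less[OF ij(1)] product_index_less[OF ij(2)]
    by (simp add: idx)
qed (auto simp: ptrace_snd_def blk_def)

definition blk_diag :: "complex mat \<Rightarrow> complex mat \<Rightarrow> complex mat" where
  "blk_diag Y X = proj0 \<Otimes> Y + proj1 \<Otimes> X"

lemma proj_carrier [simp]: "proj0 \<in> carrier_mat 2 2" "proj1 \<in> carrier_mat 2 2"
  by (simp_all add: proj0_def proj1_def mat_of_rows_list_def numeral_2_eq_2)

lemma blk_diag_carrier [simp]: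
  "Y \<in> carrier_mat D D \<Longrightarrow> X \<in> carrier_mat D D \<Longrightarrow> blk_diag Y X \<in> carrier_mat (2 * D) (2 * D)"
  unfolding blk_diag_def by (intro add_carrier_mat kron_carrier) auto

lemma blk_blk_diag:
  assumes Y: "Y \<in> carrier_mat D D" and X: "X \<in> carrier_mat D D" and ab: "a < 2" "b < 2"
  shows "blk D a b (blk_diag Y X) = (if a = b then if a = 0 then Y else X else 0\<^sub>m D D)"
proof (rule eq_matI)
  have dims: "dim_row (if a = b then if a = 0 then Y else X else 0\<^sub>m D D) = D" "dim_col (if a = b then if a = 0 then Y else X else 0\<^sub>m D D) = D"
    using X Y by auto
  fix i j assume "i < dim_row (if a = b then if a = 0 then Y else X else 0\<^sub>m D D)" "j < dim_col (if a = b then if a = 0 then Y else X else 0\<^sub>m D D)"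
  then have ij: "i < D" "j < D" using dims by auto
  have l: "a * D + i < 2 * D" "b * D + j < 2 * D" using ab ij product_index_less by blast+
  have "blk_diag Y X $$ (a * D + i, b * D + j) = (proj0 \<Otimes> Y) $$ (a * D + i, b * D + j) + (proj1 \<Otimes> X) $$ (a * D + i, b * D + j)"
    unfolding blk_diag_def using l X by (intro index_add_mat(1)) (auto simp: proj1_def mat_of_rows_list_def)
  also have "\<dots> = proj0 $$ (a, b) * Y $$ (i, j) + proj1 $$ (a, b) * X $$ (i, j)"
    using ab ij by (simp add: index_kron[OF proj_carrier(1) Y] index_kron[OF proj_carrier(2) X])
  finally show "blk D a b (blk_diag Y X) $$ (i, j) = (if a = b then if a = 0 then Y else X else 0\<^sub>m D D) $$ (i, j)"
    using ab ij by (auto simp: less_2_cases_iff proj0_def proj1_def mat_of_rows_list_def)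
qed (use X Y in auto)

lemma blk_mult:
  assumes M: "M \<in> carrier_mat (2 * D) (2 * D)" and N: "N \<in> carrier_mat (2 * D) (2 * D)" and ab: "a < 2" "b < 2"
  shows "blk D a b (M * N) = blk D a 0 M * blk D 0 b N + blk D a 1 M * blk D 1 b N"
proof (rule eq_matI)
  let ?R = "blk D a 0 M * blk D 0 b N + blk D a 1 M * blk D 1 b N"
  have R: "?R \<in> carrier_mat D D" by (intro add_carrier_mat mult_carrier_mat[of _ _ D]) auto
  fix i j assume "i < dim_row ?R" "j < dim_col ?R"
  then have ij: "i < D" "j < D" using R by auto
  have l: "a * D + i < 2 * D" "b * D + j < 2 * D" using ab ij product_index_less by blast+
  have "(M * N) $$ (a * D + i, b * D + j) = (\<Sum>c<2. \<Sum>k<D. M $$ (a * D + i, c * D + k) * N $$ (c * D + k, b * D + j))"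
    by (rule index_mult_product[OF M N l])
  also have "\<dots> = (\<Sum>k<D. M $$ (a * D + i, 0 * D + k) * N $$ (0 * D + k, b * D + j))
     + (\<Sum>k<D. M $$ (a * D + i, 1 * D + k) * N $$ (1 * D + k, b * D + j))"
    by (simp add: numeral_2_eq_2)
  also have "\<dots> = (blk D a 0 M * blk D 0 b N) $$ (i, j) + (blk D a 1 M * blk D 1 b N) $$ (i, j)"
  proof -
    have e: "(blk D a c M * blk D c b N) $$ (i, j) = (\<Sum>k<D. M $$ (a * D + i, c * D + k) * N $$ (c * D + k, b * D + j))" for c
    proof -
      have "(blk D a c M * blk D c b N) $$ (i, j) = (\<Sum>k<dim_row (blk D c b N). blk D a c M $$ (i, k) * blk D c b N $$ (k, j))"
        using ij by (intro index_mult) (auto simp: blk_def)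
      also have "dim_row (blk D c b N) = D" by (simp add: blk_def)
      finally show ?thesis using ij by simp
    qed
    show ?thesis unfolding e ..
  qed
  also have "\<dots> = ?R $$ (i, j)"
    using ij by (intro index_add_mat(1)[symmetric]) (auto simp: blk_def)
  finally show "blk D a b (M * N) $$ (i, j) = ?R $$ (i, j)" using ij by simp
qed (auto simp: blk_def)

lemma less_2_iff: "a < 2 \<longleftrightarrow> a = 0 \<or> a = (1::nat)" by auto

lemma blk_diag_mult:
  assumes "Y \<in> carrier_mat D D" "X \<in> carrier_mat D D" "Y' \<in> carrier_mat D D" "X' \<in> carrier_mat D D"
  shows "blk_diag Y X * blk_diag Y' X' = blk_diag (Y * Y') (X * X')"
proof (rule eq_blkI)
  have p: "Y * Y' \<in> carrier_mat D D" "X * X' \<in> carrier_mat D D" using assms by simp_all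
  show "blk_diag Y X * blk_diag Y' X' \<in> carrier_mat (2 * D) (2 * D)"
    using assms by (intro mult_carrier_mat[of _ _ "2 * D"] blk_diag_carrier)
  show "blk_diag (Y * Y') (X * X') \<in> carrier_mat (2 * D) (2 * D)" using p by simp
  fix a b :: nat assume ab: "a < 2" "b < 2"
  show "blk D a b (blk_diag Y X * blk_diag Y' X') = blk D a b (blk_diag (Y * Y') (X * X'))"
    unfolding blk_mult[OF blk_diag_carrier[OF assms(1,2)] blk_diag_carrier[OF assms(3,4)] ab] blk_blk_diag[OF p ab]
    using ab assms p by (auto simp: blk_blk_diag less_2_iff)
qed

lemma blk_adjoint:
  assumes "M \<in> carrier_mat (2 * D) (2 * D)" "a < 2" "b < 2"
  shows "blk D a b (M\<^sup>\<dagger>) = (blk D b a M)\<^sup>\<dagger>"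
proof (rule eq_matI)
  fix i j assume "i < dim_row ((blk D b a M)\<^sup>\<dagger>)" "j < dim_col ((blk D b a M)\<^sup>\<dagger>)"
  then have ij: "i < D" "j < D" by (auto simp: blk_def)
  have l: "a * D + i < 2 * D" "b * D + j < 2 * D" using assms ij product_index_less by blast+
  show "blk D a b (M\<^sup>\<dagger>) $$ (i, j) = (blk D b a M)\<^sup>\<dagger> $$ (i, j)"
    using ij l assms by (subst index_adjoint) (auto simp: blk_def)
qed (auto simp: blk_def)

lemma blk_diag_adjoint:
  assumes "Y \<in> carrier_mat D D" "X \<in> carrier_mat D D"
  shows "(blk_diag Y X)\<^sup>\<dagger> = blk_diag (Y\<^sup>\<dagger>) (X\<^sup>\<dagger>)"
proof (rule eq_blkI)
  have c: "blk_diag Y X \<in> carrier_mat (2 * D) (2 * D)" using assms by simp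
  then show "(blk_diag Y X)\<^sup>\<dagger> \<in> carrier_mat (2 * D) (2 * D)" by simp
  show "blk_diag (Y\<^sup>\<dagger>) (X\<^sup>\<dagger>) \<in> carrier_mat (2 * D) (2 * D)" using assms by simp
  fix a b :: nat assume ab: "a < 2" "b < 2"
  have z: "(0\<^sub>m D D :: complex mat)\<^sup>\<dagger> = 0\<^sub>m D D" by (rule eq_matI) auto
  show "blk D a b ((blk_diag Y X)\<^sup>\<dagger>) = blk D a b (blk_diag (Y\<^sup>\<dagger>) (X\<^sup>\<dagger>))"
    unfolding blk_adjoint[OF c ab] blk_blk_diag[OF assms ab(2,1)]
    using ab assms by (auto simp: blk_blk_diag z)
qed

lemma blk_diag_one: "blk_diag (1\<^sub>m D) (1\<^sub>m D) = 1\<^sub>m (2 * D)"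
proof (rule eq_blkI)
  fix a b :: nat assume ab: "a < 2" "b < 2"
  show "blk D a b (blk_diag (1\<^sub>m D) (1\<^sub>m D)) = blk D a b (1\<^sub>m (2 * D))"
    using ab by (auto simp: blk_blk_diag less_2_iff intro!: eq_matI)
qed auto

lemma ctrl_conv: "X \<in> carrier_mat D D \<Longrightarrow> ctrl X = blk_diag (1\<^sub>m D) X"
  and anti_ctrl_conv: "Y \<in> carrier_mat D D \<Longrightarrow> anti_ctrl Y = blk_diag Y (1\<^sub>m D)"
  by (auto simp: ctrl_def anti_ctrl_def blk_diag_def)

text \<open>The two controlled operations act on different ancilla branches and merge into a single
  block-diagonal matrix.\<close>

lemma anti_ctrl_mult_ctrl:
  assumes "X \<in> carrier_mat D D" "Y \<in> carrier_mat D D"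
  shows "anti_ctrl Y * ctrl X = blk_diag Y X"
  using assms by (simp add: ctrl_conv anti_ctrl_conv blk_diag_mult[of _ D])

lemma coherent_step_density:
  assumes s: "density_mat (2 * 2 ^ n) \<sigma>" and R: "density_mat (2 ^ env_qubits c) (env_state c)"
    and X: "X \<in> carrier_mat (joint_dim n c) (joint_dim n c)" "X\<^sup>\<dagger> * X = 1\<^sub>m (joint_dim n c)"
    and Y: "Y \<in> carrier_mat (joint_dim n c) (joint_dim n c)" "Y\<^sup>\<dagger> * Y = 1\<^sub>m (joint_dim n c)"
  shows "density_mat (2 * 2 ^ n) (coherent_step n c X Y \<sigma>)"
proof -
  let ?D = "joint_dim n c"
  have D: "2 * 2 ^ n * 2 ^ env_qubits c = 2 * ?D" by (simp add: joint_dim_def power_add)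
  let ?V = "blk_diag Y X"
  have V: "?V \<in> carrier_mat (2 * ?D) (2 * ?D)" using X Y by simp
  have "?V\<^sup>\<dagger> * ?V = 1\<^sub>m (2 * ?D)"
    using X Y by (simp add: blk_diag_adjoint[of _ ?D] blk_diag_mult[of _ ?D] blk_diag_one)
  moreover have "density_mat (2 * ?D) (\<sigma> \<Otimes> env_state c)" using density_kron[OF s R] by (simp only: D)
  ultimately have "density_mat (2 * ?D) (?V * (\<sigma> \<Otimes> env_state c) * ?V\<^sup>\<dagger>)" using V by (intro density_conjugate)
  then show ?thesis
    unfolding coherent_step_def anti_ctrl_mult_ctrl[OF X(1) Y(1)] Let_def by (intro density_ptrace) (simp only: D)
qed

text \<open>For block-diagonal V, the row of ancilla state 0 only meets Y on the left, and the
  column of ancilla state 1 only meets the adjoint of X on the right. The off-diagonal block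
  therefore evolves by itself.\<close>

lemma blk_coherent_step:
  assumes s: "\<sigma> \<in> carrier_mat (2 * 2 ^ n) (2 * 2 ^ n)" and R: "env_state c \<in> carrier_mat (2 ^ env_qubits c) (2 ^ env_qubits c)"
    and X: "X \<in> carrier_mat (joint_dim n c) (joint_dim n c)"
    and Y: "Y \<in> carrier_mat (joint_dim n c) (joint_dim n c)"
  shows "blk (2 ^ n) 0 1 (coherent_step n c X Y \<sigma>)
    = chan (2 ^ n) (2 ^ env_qubits c) (env_state c) Y X (blk (2 ^ n) 0 1 \<sigma>)"
proof -
  let ?D = "joint_dim n c"
  have D: "2 * 2 ^ n * 2 ^ env_qubits c = 2 * ?D" "2 ^ n * 2 ^ env_qubits c = ?D" by (simp_all add: joint_dim_def power_add)
  let ?V = "blk_diag Y X" and ?Z = "\<sigma> \<Otimes> env_state c"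
  have V: "?V \<in> carrier_mat (2 * ?D) (2 * ?D)" using X Y by simp
  have Z: "?Z \<in> carrier_mat (2 * ?D) (2 * ?D)" using kron_carrier[OF s R] by (simp only: D)
  have V': "?V\<^sup>\<dagger> \<in> carrier_mat (2 * ?D) (2 * ?D)" using V by simp
  have VZ: "?V * ?Z \<in> carrier_mat (2 * ?D) (2 * ?D)" using V Z by simp
  have zero: "0\<^sub>m ?D ?D * M = 0\<^sub>m ?D ?D" "M * 0\<^sub>m ?D ?D = 0\<^sub>m ?D ?D" if "M \<in> carrier_mat ?D ?D" for M :: "complex mat"
    using that by simp_all
  have bc: "blk ?D a b M \<in> carrier_mat ?D ?D" for a b M by simp
  have l01: "(0::nat) < 2" "(1::nat) < 2" by auto
  have b1: "blk ?D 0 b (?V * ?Z) = Y * blk ?D 0 b ?Z" if "b < 2" for b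
  proof -
    have "blk ?D 0 b (?V * ?Z) = blk ?D 0 0 ?V * blk ?D 0 b ?Z + blk ?D 0 1 ?V * blk ?D 1 b ?Z"
      by (rule blk_mult[OF V Z l01(1) that])
    also have "blk ?D 0 0 ?V = Y" unfolding blk_blk_diag[OF Y X l01(1) l01(1)] by simp
    also have "blk ?D 0 1 ?V = 0\<^sub>m ?D ?D" unfolding blk_blk_diag[OF Y X l01] by simp
    also have "Y * blk ?D 0 b ?Z + 0\<^sub>m ?D ?D * blk ?D 1 b ?Z = Y * blk ?D 0 b ?Z"
      unfolding zero(1)[OF bc] by (rule right_add_zero_mat[OF mult_carrier_mat[OF Y bc]])
    finally show ?thesis .
  qed
  have "blk ?D 0 1 (?V * ?Z * ?V\<^sup>\<dagger>) = blk ?D 0 0 (?V * ?Z) * blk ?D 0 1 (?V\<^sup>\<dagger>) + blk ?D 0 1 (?V * ?Z) * blk ?D 1 1 (?V\<^sup>\<dagger>)"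
    by (rule blk_mult[OF VZ V' l01])
  also have "blk ?D 0 1 (?V\<^sup>\<dagger>) = 0\<^sub>m ?D ?D"
    unfolding blk_diag_adjoint[OF Y X] blk_blk_diag[OF adjoint_carrier[OF Y] adjoint_carrier[OF X] l01] by simp
  also have "blk ?D 1 1 (?V\<^sup>\<dagger>) = X\<^sup>\<dagger>"
    unfolding blk_diag_adjoint[OF Y X] blk_blk_diag[OF adjoint_carrier[OF Y] adjoint_carrier[OF X] l01(2) l01(2)] by simp
  also have "blk ?D 0 0 (?V * ?Z) * 0\<^sub>m ?D ?D + blk ?D 0 1 (?V * ?Z) * X\<^sup>\<dagger> = Y * blk ?D 0 1 ?Z * X\<^sup>\<dagger>"
    unfolding zero(2)[OF bc] b1[OF l01(2)]
    by (rule left_add_zero_mat[OF mult_carrier_mat[OF mult_carrier_mat[OF Y bc] adjoint_carrier[OF X]]])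
  also have "blk ?D 0 1 ?Z = blk (2 ^ n) 0 1 \<sigma> \<Otimes> env_state c"
    using blk_kron[OF s R l01] by (simp only: D)
  finally have b: "blk ?D 0 1 (?V * ?Z * ?V\<^sup>\<dagger>) = Y * (blk (2 ^ n) 0 1 \<sigma> \<Otimes> env_state c) * X\<^sup>\<dagger>" .
  have "blk (2 ^ n) 0 1 (coherent_step n c X Y \<sigma>) = ptrace_snd (2 ^ n) (2 ^ env_qubits c) (blk (2 ^ n * 2 ^ env_qubits c) 0 1 (?V * ?Z * ?V\<^sup>\<dagger>))"
    unfolding coherent_step_def anti_ctrl_mult_ctrl[OF X Y] Let_def by (rule blk_ptrace[OF l01])
  then show ?thesis unfolding D(2) b chan_def .
qed

text \<open>Pauli X selects the two off-diagonal ancilla blocks. They are adjoint to each other, so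
  their contributions are complex conjugates.\<close>

lemma trace_pauli_x_kron:
  assumes s: "hermitian_mat (2 * d) \<sigma>" and O: "hermitian_mat d Obs"
  shows "Re (mat_trace ((pauli_mat Pauli_X \<Otimes> Obs) * \<sigma>)) = 2 * Re (mat_trace (Obs * blk d 0 1 \<sigma>))"
proof -
  have sc: "\<sigma> \<in> carrier_mat (2 * d) (2 * d)" "\<sigma>\<^sup>\<dagger> = \<sigma>" and Oc: "Obs \<in> carrier_mat d d" "Obs\<^sup>\<dagger> = Obs"
    using assms by (auto simp: hermitian_mat_def)
  have x: "pauli_mat Pauli_X \<in> carrier_mat 2 2" by (simp add: mat_of_rows_list_def numeral_2_eq_2)
  have "mat_trace ((pauli_mat Pauli_X \<Otimes> Obs) * \<sigma>)
    = (\<Sum>a<2. \<Sum>i<d. \<Sum>b<2. \<Sum>j<d. (pauli_mat Pauli_X \<Otimes> Obs) $$ (a * d + i, b * d + j) * \<sigma> $$ (b * d + j, a * d + i))"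
    by (rule mat_trace_mult_product[OF kron_carrier[OF x Oc(1)] sc(1)])
  also have "\<dots> = (\<Sum>a<2. \<Sum>i<d. \<Sum>b<2. \<Sum>j<d. pauli_mat Pauli_X $$ (a, b) * Obs $$ (i, j) * \<sigma> $$ (b * d + j, a * d + i))"
    by (intro sum.cong refl) (simp add: index_kron[OF x Oc(1)] del: pauli_mat.simps)
  also have "\<dots> = (\<Sum>i<d. \<Sum>j<d. Obs $$ (i, j) * blk d 1 0 \<sigma> $$ (j, i)) + (\<Sum>i<d. \<Sum>j<d. Obs $$ (i, j) * blk d 0 1 \<sigma> $$ (j, i))"
    by (simp add: numeral_2_eq_2 mat_of_rows_list_def)
  also have "\<dots> = mat_trace (Obs * blk d 1 0 \<sigma>) + mat_trace (Obs * blk d 0 1 \<sigma>)"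
    by (simp only: mat_trace_mult[OF Oc(1) blk_carrier])
  also have "mat_trace (Obs * blk d 1 0 \<sigma>) = cnj (mat_trace (Obs * blk d 0 1 \<sigma>))"
  proof -
    have "blk d 1 0 \<sigma> = (blk d 0 1 \<sigma>)\<^sup>\<dagger>" using blk_adjoint[OF sc(1), of 1 0] sc(2) by simp
    then have "Obs * blk d 1 0 \<sigma> = (blk d 0 1 \<sigma> * Obs)\<^sup>\<dagger>" using adjoint_mult[OF blk_carrier Oc(1)] Oc(2) by simp
    also have "mat_trace \<dots> = cnj (mat_trace (blk d 0 1 \<sigma> * Obs))"
      by (rule mat_trace_adjoint[OF mult_carrier_mat[OF blk_carrier Oc(1)]])
    also have "mat_trace (blk d 0 1 \<sigma> * Obs) = mat_trace (Obs * blk d 0 1 \<sigma>)" by (rule mat_trace_comm[OF blk_carrier Oc(1)])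
    finally show ?thesis .
  qed
  finally show ?thesis by simp
qed

text \<open>The initial weight 1/2 cancels the factor 2 of
  \<open>trace_pauli_x_kron\<close>.\<close>

lemma blk_plus_state:
  assumes "\<rho> \<in> carrier_mat d d"
  shows "blk d 0 1 (plus_state \<Otimes> \<rho>) = (1 / 2) \<cdot>\<^sub>m \<rho>"
proof (rule eq_matI)
  have p: "plus_state \<in> carrier_mat 2 2" by (simp add: plus_state_def)
  fix i j assume "i < dim_row ((1 / 2) \<cdot>\<^sub>m \<rho>)" "j < dim_col ((1 / 2) \<cdot>\<^sub>m \<rho>)"
  then have ij: "i < d" "j < d" using assms by auto
  have "(plus_state \<Otimes> \<rho>) $$ (0 * d + i, 1 * d + j) = plus_state $$ (0, 1) * \<rho> $$ (i, j)"
    using ij by (intro index_kron[OF p assms]) auto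
  then show "blk d 0 1 (plus_state \<Otimes> \<rho>) $$ (i, j) = ((1 / 2) \<cdot>\<^sub>m \<rho>) $$ (i, j)"
    using ij assms by (simp add: plus_state_def)
qed (use assms in \<open>auto simp: blk_def\<close>)

section \<open>Pauli strings\<close>

definition unitary_mat :: "nat \<Rightarrow> complex mat \<Rightarrow> bool" where
  "unitary_mat d U \<longleftrightarrow> U \<in> carrier_mat d d \<and> U\<^sup>\<dagger> * U = 1\<^sub>m d"

lemma unitary_carrier: "unitary_mat d U \<Longrightarrow> U \<in> carrier_mat d d"
  by (simp add: unitary_mat_def)

lemma unitary_one: "unitary_mat d (1\<^sub>m d)"
  by (simp add: unitary_mat_def)

lemma unitary_mult:
  assumes "unitary_mat d U" "unitary_mat d V"
  shows "unitary_mat d (U * V)"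
proof -
  have U: "U \<in> carrier_mat d d" "U\<^sup>\<dagger> * U = 1\<^sub>m d" and V: "V \<in> carrier_mat d d" "V\<^sup>\<dagger> * V = 1\<^sub>m d"
    using assms by (auto simp: unitary_mat_def)
  have U': "U\<^sup>\<dagger> \<in> carrier_mat d d" and V': "V\<^sup>\<dagger> \<in> carrier_mat d d" using U V by simp_all
  have "(U * V)\<^sup>\<dagger> * (U * V) = (V\<^sup>\<dagger> * U\<^sup>\<dagger>) * (U * V)" unfolding adjoint_mult[OF U(1) V(1)] ..
  also have "\<dots> = V\<^sup>\<dagger> * (U\<^sup>\<dagger> * (U * V))" by (rule assoc_mult_mat[OF V' U' mult_carrier_mat[OF U(1) V(1)]])
  also have "U\<^sup>\<dagger> * (U * V) = V"
    unfolding assoc_mult_mat[OF U' U(1) V(1), symmetric] U(2) by (rule left_mult_one_mat[OF V(1)])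
  finally show ?thesis using V(2) mult_carrier_mat[OF U(1) V(1)] by (simp add: unitary_mat_def)
qed

lemma unitary_smult:
  assumes "unitary_mat d U" "cmod c = 1"
  shows "unitary_mat d (c \<cdot>\<^sub>m U)"
proof -
  have U: "U \<in> carrier_mat d d" "U\<^sup>\<dagger> * U = 1\<^sub>m d" using assms by (auto simp: unitary_mat_def)
  have U': "U\<^sup>\<dagger> \<in> carrier_mat d d" using U by simp
  have "(c \<cdot>\<^sub>m U)\<^sup>\<dagger> * (c \<cdot>\<^sub>m U) = cnj c \<cdot>\<^sub>m (U\<^sup>\<dagger> * (c \<cdot>\<^sub>m U))"
    unfolding adjoint_smult by (rule mult_smult_assoc_mat[OF U' smult_carrier_mat[OF U(1)]])
  also have "U\<^sup>\<dagger> * (c \<cdot>\<^sub>m U) = c \<cdot>\<^sub>m 1\<^sub>m d" unfolding mult_smult_distrib[OF U' U(1)] U(2) ..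
  also have "cnj c \<cdot>\<^sub>m (c \<cdot>\<^sub>m 1\<^sub>m d) = 1\<^sub>m d"
    using assms(2) unfolding smult_smult_mat by (intro eq_matI) (simp_all add: complex_norm_square[symmetric] mult.commute)
  finally show ?thesis using U by (simp add: unitary_mat_def)
qed

lemma unitary_mat_prod: "(\<And>U. U \<in> set Us \<Longrightarrow> unitary_mat d U) \<Longrightarrow> unitary_mat d (mat_prod d Us)"
  unfolding mat_prod_def by (induction Us) (auto intro: unitary_one unitary_mult)

lemma op_bound_unitary: "unitary_mat d U \<Longrightarrow> op_bound U 1"
  by (auto simp: unitary_mat_def intro: op_bound_isometry)

lemma unitary_mat_exp:
  assumes "hermitian_mat d A"
  shows "unitary_mat d (mat_exp ((- \<i> * complex_of_real t) \<cdot>\<^sub>m A))"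
proof -
  obtain S P where sp: "spectral d A S P" using spectral_decomposition[OF assms] .
  have "cnj (exp (- \<i> * complex_of_real t * complex_of_real a)) * exp (- \<i> * complex_of_real t * complex_of_real a) = 1" for a
    by (simp add: exp_cnj flip: exp_add)
  then show ?thesis
    unfolding unitary_mat_def mat_exp_fcalc[OF sp] fcalc_adjoint[OF sp] fcalc_mult[OF sp]
    by (simp add: fcalc_one[OF sp])
qed

section \<open>Pauli strings as Hermitian involutions\<close>

lemma pauli_carrier [simp]: "pauli_mat p \<in> carrier_mat 2 2"
  by (cases p) (auto simp: mat_of_rows_list_def numeral_2_eq_2)

lemma pauli_adjoint: "(pauli_mat p)\<^sup>\<dagger> = pauli_mat p"
  by (rule eq_matI; cases p) (auto simp: mat_of_rows_list_def less_Suc_eq numeral_2_eq_2)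

lemma pauli_square: "pauli_mat p * pauli_mat p = 1\<^sub>m 2"
  by (rule eq_matI; cases p)
    (auto simp: mat_of_rows_list_def less_Suc_eq numeral_2_eq_2 scalar_prod_def simp del: index_mult)

text \<open>The three facts share one induction because the adjoint and product rules for tensor
  products need the dimensions of the remaining string.\<close>

lemma pauli_string_properties:
  defines "s \<equiv> \<lambda>ps. foldr (\<lambda>p A. pauli_mat p \<Otimes> A) ps (1\<^sub>m 1)"
  shows "s ps \<in> carrier_mat (2 ^ length ps) (2 ^ length ps) \<and> (s ps)\<^sup>\<dagger> = s ps \<and> s ps * s ps = 1\<^sub>m (2 ^ length ps)"
proof (induction ps)
  case Nil
  then show ?case by (simp add: s_def)
next
  case (Cons p ps)
  then have c: "s ps \<in> carrier_mat (2 ^ length ps) (2 ^ length ps)" and a: "(s ps)\<^sup>\<dagger> = s ps"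
    and q: "s ps * s ps = 1\<^sub>m (2 ^ length ps)" by auto
  have s: "s (p # ps) = pauli_mat p \<Otimes> s ps" by (simp add: s_def)
  show ?case
    unfolding s kron_adjoint[OF pauli_carrier c] kron_mult[OF pauli_carrier c pauli_carrier c] a q pauli_adjoint pauli_square
    using kron_carrier[OF pauli_carrier c] by (simp add: one_kron_one)
qed

lemma signed_pauli_properties:
  assumes "length (snd s) = m"
  shows "hermitian_mat (2 ^ m) (signed_pauli_mat s)" "signed_pauli_mat s * signed_pauli_mat s = 1\<^sub>m (2 ^ m)"
proof -
  define M where "M = foldr (\<lambda>p A. pauli_mat p \<Otimes> A) (snd s) (1\<^sub>m 1)"
  define c :: complex where "c = (if fst s then - 1 else 1)"
  have M: "M \<in> carrier_mat (2 ^ m) (2 ^ m)" "M\<^sup>\<dagger> = M" "M * M = 1\<^sub>m (2 ^ m)"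
    using pauli_string_properties[of "snd s"] assms by (auto simp: M_def)
  have s: "signed_pauli_mat s = c \<cdot>\<^sub>m M" by (simp add: signed_pauli_mat_def c_def M_def)
  show "hermitian_mat (2 ^ m) (signed_pauli_mat s)"
    using M by (auto simp: s hermitian_mat_def adjoint_smult c_def)
  have "(c \<cdot>\<^sub>m M) * (c \<cdot>\<^sub>m M) = c \<cdot>\<^sub>m (c \<cdot>\<^sub>m (M * M))"
    using mult_smult_assoc_mat[OF M(1) smult_carrier_mat[OF M(1)]] mult_smult_distrib[OF M(1) M(1)] by simp
  then show "signed_pauli_mat s * signed_pauli_mat s = 1\<^sub>m (2 ^ m)"
    by (auto simp: s M(3) smult_smult_mat c_def)
qed

lemma unitary_of_involution:
  assumes "hermitian_mat d P" "P * P = 1\<^sub>m d"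
  shows "unitary_mat d P"
  using assms by (auto simp: unitary_mat_def hermitian_mat_def)

text \<open>An involution only has the eigenvalues 1 and -1, and on these the exponential agrees
  with a function that is affine in the eigenvalue.\<close>

lemma mat_exp_involution:
  assumes P: "hermitian_mat d P" "P * P = 1\<^sub>m d"
  shows "mat_exp ((- \<i> * complex_of_real t) \<cdot>\<^sub>m P) =
    complex_of_real (cos t) \<cdot>\<^sub>m 1\<^sub>m d + (- \<i> * complex_of_real (sin t)) \<cdot>\<^sub>m P"
proof -
  obtain S Q where sp: "spectral d P S Q" using spectral_decomposition[OF P(1)] .
  have Pc: "P \<in> carrier_mat d d" using P(1) by (rule hermitian_carrier)
  have a: "a = 1 \<or> a = - 1" if aS: "a \<in> S" "Q a \<noteq> 0\<^sub>m d d" for a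
  proof -
    obtain w where w: "w \<in> carrier_vec d" "P *\<^sub>v w = complex_of_real a \<cdot>\<^sub>v w" "vec_l2 w > 0"
      using spectral_projection_nonzero[OF sp aS] .
    have "w = (P * P) *\<^sub>v w" using P(2) w(1) by simp
    also have "\<dots> = P *\<^sub>v (P *\<^sub>v w)" by (rule assoc_mult_mat_vec[OF Pc Pc w(1)])
    also have "\<dots> = complex_of_real a \<cdot>\<^sub>v (complex_of_real a \<cdot>\<^sub>v w)"
      unfolding w(2) using mult_mat_vec[OF Pc w(1)] w(2) by simp
    finally have "vec_l2 w = vec_l2 (complex_of_real a \<cdot>\<^sub>v (complex_of_real a \<cdot>\<^sub>v w))" by simp
    then have "\<bar>a\<bar> * \<bar>a\<bar> = 1" using w(3) by (simp add: vec_l2_smult)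
    then have "a * a = 1" by (simp flip: abs_mult)
    then show ?thesis by (simp add: square_eq_1_iff)
  qed
  have e: "exp (- \<i> * complex_of_real t * complex_of_real a) = complex_of_real (cos t) + - \<i> * complex_of_real (sin t) * complex_of_real a"
    if "a = 1 \<or> a = - 1" for a
    using that exp_Euler[of "complex_of_real t"] exp_minus_Euler[of "complex_of_real t"] by (auto simp: cos_of_real sin_of_real)
  have "mat_exp ((- \<i> * complex_of_real t) \<cdot>\<^sub>m P) = fcalc d S Q (\<lambda>a. complex_of_real (cos t) * 1 + - \<i> * complex_of_real (sin t) * complex_of_real a)"
    unfolding mat_exp_fcalc[OF sp] using e a by (intro fcalc_cong[OF sp]) auto
  also have "\<dots> = complex_of_real (cos t) \<cdot>\<^sub>m 1\<^sub>m d + (- \<i> * complex_of_real (sin t)) \<cdot>\<^sub>m P"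
    unfolding fcalc_add[OF sp, symmetric] fcalc_smult[OF sp, symmetric] fcalc_one[OF sp] fcalc_id[OF sp] ..
  finally show ?thesis .
qed

section \<open>Expansion of powers into words\<close>

abbreviation lists_of :: "'a set \<Rightarrow> nat \<Rightarrow> 'a list set" where
  "lists_of J k \<equiv> {xs. set xs \<subseteq> J \<and> length xs = k}"

lemma sum_lists_Suc:
  "(\<Sum>xs\<in>lists_of J (Suc k). f xs) = (\<Sum>x\<in>J. \<Sum>xs\<in>lists_of J k. f (x # xs))"
proof -
  have "(\<Sum>x\<in>J. \<Sum>xs\<in>lists_of J k. f (x # xs)) = (\<Sum>(x, xs)\<in>J \<times> lists_of J k. f (x # xs))"
    by (rule sum.cartesian_product)
  also have "\<dots> = (\<Sum>xs\<in>lists_of J (Suc k). f xs)"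
    by (rule sum.reindex_bij_witness[of _ "\<lambda>xs. (hd xs, tl xs)" "\<lambda>(x, xs). x # xs"])
      (auto simp: length_Suc_conv)
  finally show ?thesis ..
qed

lemma lists_of_0: "lists_of J 0 = {[]}"
  by auto

lemma sum_prod_list_pow:
  fixes w :: "'a \<Rightarrow> 'b::comm_semiring_1"
  shows "(\<Sum>xs\<in>lists_of J k. prod_list (map w xs)) = (\<Sum>x\<in>J. w x) ^ k"
proof (induction k)
  case 0
  show ?case unfolding lists_of_0 by simp
next
  case (Suc k)
  then show ?case
    unfolding sum_lists_Suc list.map prod_list.Cons sum_product[symmetric] by simp
qed

text \<open>Matrix powers grow on the right, words grow at the head; this reconciles the
  two.\<close>

lemma pow_mat_commute: "A \<in> carrier_mat d d \<Longrightarrow> A * A ^\<^sub>m k = A ^\<^sub>m k * (A :: complex mat)"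
proof (induction k)
  case (Suc k)
  have p: "A ^\<^sub>m k \<in> carrier_mat d d" using Suc.prems by (rule pow_carrier_mat)
  have "A * A ^\<^sub>m Suc k = (A * A ^\<^sub>m k) * A" using assoc_mult_mat[OF Suc.prems p Suc.prems] by simp
  then show ?case using Suc by simp
qed simp

lemma mat_prod_carrier: "(\<And>U. U \<in> set Us \<Longrightarrow> U \<in> carrier_mat d d) \<Longrightarrow> mat_prod d Us \<in> carrier_mat d d"
  unfolding mat_prod_def by (induction Us) (auto intro!: mult_carrier_mat[of _ _ d])

lemma mat_sum_product:
  assumes F: "\<And>x. x \<in> A \<Longrightarrow> F x \<in> carrier_mat d d" and G: "\<And>y. y \<in> B \<Longrightarrow> G y \<in> carrier_mat d d"
  shows "mat_sum d A (\<lambda>x. mat_sum d B (\<lambda>y. F x * G y)) = mat_sum d A F * mat_sum d B G"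
proof -
  have "mat_sum d A F * mat_sum d B G = mat_sum d A (\<lambda>x. F x * mat_sum d B G)"
    using F by (intro mat_sum_mult) auto
  also have "\<dots> = mat_sum d A (\<lambda>x. mat_sum d B (\<lambda>y. F x * G y))"
    using F G by (intro mat_sum_cong mult_mat_sum) auto
  finally show ?thesis ..
qed

lemma smult_mult_smult:
  assumes "A \<in> carrier_mat d d" "B \<in> carrier_mat d d"
  shows "(a \<cdot>\<^sub>m A) * (b \<cdot>\<^sub>m B) = (a * b :: complex) \<cdot>\<^sub>m (A * B)"
  using mult_smult_assoc_mat[OF assms(1) smult_carrier_mat[OF assms(2)]] mult_smult_distrib[OF assms]
  by (simp add: smult_smult_mat)

text \<open>The noncommutative power expansion, with the order of the factors recorded by the list.
  It serves both for powers of the normalised Hamiltonian and for the power of the segment that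
  expands into words.\<close>

lemma mat_sum_lists_pow:
  assumes F: "\<And>x. x \<in> J \<Longrightarrow> F x \<in> carrier_mat d d"
  shows "mat_sum d (lists_of J k) (\<lambda>xs. prod_list (map g xs) \<cdot>\<^sub>m mat_prod d (map F xs))
    = mat_sum d J (\<lambda>x. g x \<cdot>\<^sub>m F x) ^\<^sub>m k"
proof (induction k)
  case 0
  show ?case unfolding lists_of_0 by (rule eq_matI) (auto simp: mat_prod_def)
next
  case (Suc k)
  let ?M = "mat_sum d J (\<lambda>x. g x \<cdot>\<^sub>m F x)"
  have M: "?M \<in> carrier_mat d d" by simp
  have p: "mat_prod d (map F xs) \<in> carrier_mat d d" if "xs \<in> lists_of J k" for xs k
    using that F by (intro mat_prod_carrier) auto
  have "mat_sum d (lists_of J (Suc k)) (\<lambda>xs. prod_list (map g xs) \<cdot>\<^sub>m mat_prod d (map F xs))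
     = mat_sum d J (\<lambda>x. mat_sum d (lists_of J k) (\<lambda>xs. prod_list (map g (x # xs)) \<cdot>\<^sub>m mat_prod d (map F (x # xs))))"
    by (rule eq_matI) (auto simp: sum_lists_Suc simp del: prod_list.Cons list.map)
  also have "\<dots> = mat_sum d J (\<lambda>x. mat_sum d (lists_of J k) (\<lambda>xs. (g x \<cdot>\<^sub>m F x) * (prod_list (map g xs) \<cdot>\<^sub>m mat_prod d (map F xs))))"
  proof (intro mat_sum_cong)
    fix x xs assume x: "x \<in> J" and xs: "xs \<in> lists_of J k"
    show "prod_list (map g (x # xs)) \<cdot>\<^sub>m mat_prod d (map F (x # xs)) = (g x \<cdot>\<^sub>m F x) * (prod_list (map g xs) \<cdot>\<^sub>m mat_prod d (map F xs))"
      unfolding smult_mult_smult[OF F[OF x] p[OF xs]] by (simp add: mat_prod_def)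
  qed
  also have "\<dots> = ?M * mat_sum d (lists_of J k) (\<lambda>xs. prod_list (map g xs) \<cdot>\<^sub>m mat_prod d (map F xs))"
    using F p by (intro mat_sum_product) auto
  also have "\<dots> = ?M ^\<^sub>m Suc k" unfolding Suc.IH pow_mat_commute[OF M] by simp
  finally show ?case .
qed

section \<open>The segment as a function of the Hamiltonian\<close>

text \<open>The scalar counterpart of \<open>segment\<close>: a Taylor polynomial of exp with each
  even order and its successor paired, the form in which the blocks produce it.\<close>

definition trunc_exp :: "nat \<Rightarrow> complex \<Rightarrow> complex" where
  "trunc_exp q z = (\<Sum>k\<in>{k. k \<le> q \<and> even k}. z ^ k / fact k * (1 + z / of_nat (k + 1)))"

context
  fixes n :: nat and HS :: "complex mat" and c :: collision
  assumes valid: "valid_collision n HS c"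
begin

lemma coef_pos: "l \<in> {1..terms c} \<Longrightarrow> 0 < coef c l"
  and str_length: "l \<in> {1..terms c} \<Longrightarrow> length (snd (str c l)) = n + env_qubits c"
  and terms_pos: "1 \<le> terms c"
  using valid by (auto simp: valid_collision_def)

lemma coef_sum_pos: "0 < coef_sum c"
  unfolding coef_sum_def using coef_pos terms_pos by (intro sum_pos) auto

lemma weight_pos: "l \<in> {1..terms c} \<Longrightarrow> 0 < weight c l"
  using coef_pos coef_sum_pos by (simp add: weight_def)

lemma sum_weight: "(\<Sum>l\<in>{1..terms c}. weight c l) = 1"
  using coef_sum_pos by (simp add: weight_def coef_sum_def flip: sum_divide_distrib)

lemma pauli_term:
  assumes "l \<in> {1..terms c}"
  shows "hermitian_mat (joint_dim n c) (signed_pauli_mat (str c l))"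
    "signed_pauli_mat (str c l) * signed_pauli_mat (str c l) = 1\<^sub>m (joint_dim n c)"
  using signed_pauli_properties[OF str_length[OF assms]] by (simp_all add: joint_dim_def)

lemma pauli_term_carrier: "l \<in> {1..terms c} \<Longrightarrow> signed_pauli_mat (str c l) \<in> carrier_mat (joint_dim n c) (joint_dim n c)"
  by (rule hermitian_carrier[OF pauli_term(1)])

lemma normalized_ham_sum:
  "normalized_ham n HS c = mat_sum (joint_dim n c) {1..terms c}
     (\<lambda>l. complex_of_real (weight c l) \<cdot>\<^sub>m signed_pauli_mat (str c l))"
proof -
  have "normalized_ham n HS c = mat_sum (joint_dim n c) {1..terms c}
     (\<lambda>l. complex_of_real (1 / coef_sum c) \<cdot>\<^sub>m (complex_of_real (coef c l) \<cdot>\<^sub>m signed_pauli_mat (str c l)))"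
    unfolding normalized_ham_def using valid pauli_term_carrier
    by (subst smult_mat_sum[symmetric]) (auto simp: valid_collision_def)
  then show ?thesis by (simp add: smult_smult_mat weight_def)
qed

lemma hermitian_normalized_ham: "hermitian_mat (joint_dim n c) (normalized_ham n HS c)"
  unfolding normalized_ham_sum hermitian_mat_def
proof
  have t: "l \<in> {1..terms c} \<Longrightarrow> complex_of_real (weight c l) \<cdot>\<^sub>m signed_pauli_mat (str c l) \<in> carrier_mat (joint_dim n c) (joint_dim n c)" for l
    using pauli_term_carrier by simp
  have "(mat_sum (joint_dim n c) {1..terms c} (\<lambda>l. complex_of_real (weight c l) \<cdot>\<^sub>m signed_pauli_mat (str c l)))\<^sup>\<dagger>
     = mat_sum (joint_dim n c) {1..terms c} (\<lambda>l. (complex_of_real (weight c l) \<cdot>\<^sub>m signed_pauli_mat (str c l))\<^sup>\<dagger>)"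
    by (rule adjoint_mat_sum) (rule t)
  also have "\<dots> = mat_sum (joint_dim n c) {1..terms c} (\<lambda>l. complex_of_real (weight c l) \<cdot>\<^sub>m signed_pauli_mat (str c l))"
    using hermitian_adjoint[OF pauli_term(1)] by (intro mat_sum_cong) (simp add: adjoint_smult)
  finally show "(mat_sum (joint_dim n c) {1..terms c} (\<lambda>l. complex_of_real (weight c l) \<cdot>\<^sub>m signed_pauli_mat (str c l)))\<^sup>\<dagger>
     = mat_sum (joint_dim n c) {1..terms c} (\<lambda>l. complex_of_real (weight c l) \<cdot>\<^sub>m signed_pauli_mat (str c l))" .
qed simp

lemma op_bound_normalized_ham: "op_bound (normalized_ham n HS c) 1"
proof -
  have "op_bound (normalized_ham n HS c) (\<Sum>l\<in>{1..terms c}. weight c l)"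
    unfolding normalized_ham_sum
  proof (rule op_bound_mat_sum)
    fix l assume l: "l \<in> {1..terms c}"
    show "complex_of_real (weight c l) \<cdot>\<^sub>m signed_pauli_mat (str c l) \<in> carrier_mat (joint_dim n c) (joint_dim n c)"
      using pauli_term_carrier[OF l] by simp
    show "op_bound (complex_of_real (weight c l) \<cdot>\<^sub>m signed_pauli_mat (str c l)) (weight c l)"
      using op_bound_smult[OF pauli_term_carrier[OF l] op_bound_unitary[OF unitary_of_involution[OF pauli_term[OF l]]], of "complex_of_real (weight c l)"]
        weight_pos[OF l] by simp
  qed simp
  then show ?thesis unfolding sum_weight .
qed

lemma unitary_collision: "unitary_mat (joint_dim n c) (collision_unitary n HS t c)"
  unfolding collision_unitary_def by (rule unitary_mat_exp[OF hermitian_normalized_ham])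

text \<open>With y = x / (k + 1) and s = sqrt (1 + y^2) the angle has cosine 1 / s and sine y / s,
  where y being nonnegative fixes the sign of the sine. The factor s then clears both
  denominators.\<close>

lemma rotation_conv:
  assumes "l \<in> {1..terms c}" "0 \<le> x"
  shows "complex_of_real (sqrt (1 + (x / real (k + 1))\<^sup>2)) \<cdot>\<^sub>m
      mat_exp ((- \<i> * complex_of_real (segment_angle x k)) \<cdot>\<^sub>m signed_pauli_mat (str c l))
    = 1\<^sub>m (joint_dim n c) + (- \<i> * complex_of_real (x / real (k + 1))) \<cdot>\<^sub>m signed_pauli_mat (str c l)"
proof -
  define y where "y = x / real (k + 1)"
  have y: "0 \<le> y" using assms by (simp add: y_def)
  define s where "s = sqrt (1 + y\<^sup>2)"
  have s: "1 \<le> s" "s\<^sup>2 = 1 + y\<^sup>2" by (simp_all add: s_def)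
  have "0 \<le> 1 / s" using s by simp
  then have inv: "- 1 \<le> 1 / s" "1 / s \<le> 1" using s by (linarith, simp)
  have co: "cos (segment_angle x k) = 1 / s"
    unfolding segment_angle_def y_def[symmetric] s_def[symmetric] by (rule cos_arccos[OF inv])
  have "sin (segment_angle x k) = sqrt (1 - (1 / s)\<^sup>2)"
    unfolding segment_angle_def y_def[symmetric] s_def[symmetric] by (rule sin_arccos[OF inv])
  also have "1 - (1 / s)\<^sup>2 = (y / s)\<^sup>2"
  proof -
    have "y\<^sup>2 = s\<^sup>2 - 1" using s(2) by simp
    moreover have "s\<^sup>2 \<noteq> 0" using s(1) by auto
    ultimately show ?thesis by (simp only: power_divide) (simp add: diff_divide_distrib)
  qed
  finally have si: "sin (segment_angle x k) = y / s" using y s by simp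
  have c: "signed_pauli_mat (str c l) \<in> carrier_mat (joint_dim n c) (joint_dim n c)" by (rule pauli_term_carrier[OF assms(1)])
  show ?thesis
    unfolding mat_exp_involution[OF pauli_term[OF assms(1)]] co si y_def[symmetric] s_def[symmetric]
    using c s by (intro eq_matI) (auto simp: field_simps)
qed

lemma finite_blocks: "finite (blocks q c)"
proof -
  have "blocks q c \<subseteq> {ls. set ls \<subseteq> {1..terms c} \<and> length ls \<le> q} \<times> {1..terms c}"
    by (auto simp: blocks_def)
  then show ?thesis by (rule finite_subset) (intro finite_cartesian_product finite_lists_length_le; simp)
qed

lemma sum_blocks:
  "(\<Sum>b\<in>blocks q c. f b) = (\<Sum>k\<in>{k. k \<le> q \<and> even k}. \<Sum>ls\<in>lists_of {1..terms c} k. \<Sum>m\<in>{1..terms c}. f (ls, m))"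
proof -
  have "(\<Sum>b\<in>blocks q c. f b) = (\<Sum>k\<in>{k. k \<le> q \<and> even k}. sum f {b \<in> blocks q c. length (fst b) = k})"
    by (rule sum.group[symmetric]) (auto simp: finite_blocks, auto simp: blocks_def)
  also have "\<dots> = (\<Sum>k\<in>{k. k \<le> q \<and> even k}. \<Sum>(ls, m)\<in>lists_of {1..terms c} k \<times> {1..terms c}. f (ls, m))"
  proof (rule sum.cong [OF refl])
    fix k assume "k \<in> {k. k \<le> q \<and> even k}"
    then have "{b \<in> blocks q c. length (fst b) = k} = lists_of {1..terms c} k \<times> {1..terms c}"
      by (auto simp: blocks_def)
    then show "sum f {b \<in> blocks q c. length (fst b) = k} = (\<Sum>(ls, m)\<in>lists_of {1..terms c} k \<times> {1..terms c}. f (ls, m))"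
      by simp
  qed
  finally show ?thesis by (simp only: sum.cartesian_product)
qed

lemma block_unitary_unitary:
  assumes "b \<in> blocks q c"
  shows "unitary_mat (joint_dim n c) (block_unitary n c x b)"
proof -
  obtain ls m where b: "b = (ls, m)" "set ls \<subseteq> {1..terms c}" "m \<in> {1..terms c}"
    using assms by (auto simp: blocks_def)
  have "unitary_mat (joint_dim n c) (mat_prod (joint_dim n c) (map (\<lambda>l. signed_pauli_mat (str c l)) ls))"
    using b by (intro unitary_mat_prod) (auto intro!: unitary_of_involution pauli_term)
  then show ?thesis
    unfolding b block_unitary_def prod.case
    by (intro unitary_smult unitary_mult unitary_mat_exp pauli_term(1) b(3)) (simp_all add: norm_power)
qed

text \<open>For fixed k the sum over the strings gives the k-th power of the normalised Hamiltonian
  H and the sum over the rotations gives 1 - \<i> (x / (k + 1)) H. The segment is thus a polynomial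
  in H alone, although the individual Pauli strings do not commute.\<close>

lemma segment_fcalc:
  assumes sp: "spectral (joint_dim n c) (normalized_ham n HS c) S P" and x: "0 \<le> x"
  shows "segment n c x q = fcalc (joint_dim n c) S P (\<lambda>a. trunc_exp q (- \<i> * complex_of_real (x * a)))"
proof -
  let ?D = "joint_dim n c" and ?I = "{1..terms c}" and ?H = "normalized_ham n HS c"
  let ?P = "\<lambda>l. signed_pauli_mat (str c l)" and ?w = "\<lambda>l. complex_of_real (weight c l)"
  have P: "l \<in> ?I \<Longrightarrow> ?P l \<in> carrier_mat ?D ?D" for l by (rule pauli_term_carrier)
  have H: "?H \<in> carrier_mat ?D ?D" by (rule hermitian_carrier[OF hermitian_normalized_ham])
  define R where "R k l = 1\<^sub>m ?D + (- \<i> * complex_of_real (x / real (k + 1))) \<cdot>\<^sub>m ?P l" for k l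
  have R: "l \<in> ?I \<Longrightarrow> R k l \<in> carrier_mat ?D ?D" for k l using P by (simp add: R_def)
  have sumR: "mat_sum ?D ?I (\<lambda>l. ?w l \<cdot>\<^sub>m R k l) = 1\<^sub>m ?D + (- \<i> * complex_of_real (x / real (k + 1))) \<cdot>\<^sub>m ?H" for k
  proof (rule eq_matI)
    fix i j assume "i < dim_row (1\<^sub>m ?D + (- \<i> * complex_of_real (x / real (k + 1))) \<cdot>\<^sub>m ?H)"
      "j < dim_col (1\<^sub>m ?D + (- \<i> * complex_of_real (x / real (k + 1))) \<cdot>\<^sub>m ?H)"
    then have ij: "i < ?D" "j < ?D" using H by auto
    let ?y = "- \<i> * complex_of_real (x / real (k + 1))"
    have "(\<Sum>l\<in>?I. (?w l \<cdot>\<^sub>m R k l) $$ (i, j)) = (\<Sum>l\<in>?I. ?w l * 1\<^sub>m ?D $$ (i, j) + ?y * ((?w l \<cdot>\<^sub>m ?P l) $$ (i, j)))"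
    proof (intro sum.cong refl)
      fix l assume "l \<in> ?I"
      then have "?P l \<in> carrier_mat ?D ?D" by (rule P)
      then show "(?w l \<cdot>\<^sub>m R k l) $$ (i, j) = ?w l * 1\<^sub>m ?D $$ (i, j) + ?y * ((?w l \<cdot>\<^sub>m ?P l) $$ (i, j))"
        using ij unfolding R_def by (simp add: algebra_simps)
    qed
    also have "\<dots> = (\<Sum>l\<in>?I. ?w l) * 1\<^sub>m ?D $$ (i, j) + ?y * (\<Sum>l\<in>?I. (?w l \<cdot>\<^sub>m ?P l) $$ (i, j))"
      by (simp only: sum.distrib sum_distrib_left sum_distrib_right)
    also have "(\<Sum>l\<in>?I. ?w l) = 1" using sum_weight by (metis of_real_1 of_real_sum)
    also have "(\<Sum>l\<in>?I. (?w l \<cdot>\<^sub>m ?P l) $$ (i, j)) = ?H $$ (i, j)" unfolding normalized_ham_sum using ij by simp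
    finally show "mat_sum ?D ?I (\<lambda>l. ?w l \<cdot>\<^sub>m R k l) $$ (i, j) = (1\<^sub>m ?D + ?y \<cdot>\<^sub>m ?H) $$ (i, j)"
      using ij H by simp
  qed (use H in auto)
  define g where "g k = (complex_of_real x) ^ k / fact k * (- \<i>) ^ k" for k
  \<comment> \<open>Each summand is brought into product form, with one factor depending only on the
    strings and one only on the rotation, so that the double sum factorises.\<close>
  have block_term: "complex_of_real (block_coef c x (ls, m)) \<cdot>\<^sub>m block_unitary n c x (ls, m)
      = g k \<cdot>\<^sub>m ((prod_list (map ?w ls) \<cdot>\<^sub>m mat_prod ?D (map ?P ls)) * (?w m \<cdot>\<^sub>m R k m))"
    if ls: "ls \<in> lists_of ?I k" and m: "m \<in> ?I" for ls m k
  proof -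
    have len: "length ls = k" using ls by simp
    have mp: "mat_prod ?D (map ?P ls) \<in> carrier_mat ?D ?D" using ls P by (intro mat_prod_carrier) auto
    define E where "E = mat_exp ((- \<i> * complex_of_real (segment_angle x k)) \<cdot>\<^sub>m ?P m)"
    have E: "E \<in> carrier_mat ?D ?D" unfolding E_def
      using unitary_carrier[OF unitary_mat_exp[OF pauli_term(1)[OF m]]] .
    define s where "s = complex_of_real (sqrt (1 + (x / real (k + 1))\<^sup>2))"
    have RE: "R k m = s \<cdot>\<^sub>m E" unfolding R_def E_def s_def by (rule rotation_conv[OF m x, symmetric])
    have pl: "complex_of_real (prod_list (map (weight c) ls)) = prod_list (map ?w ls)"
      by (induction ls) auto
    have bc: "complex_of_real (block_coef c x (ls, m)) = complex_of_real x ^ k / fact k * s * prod_list (map ?w ls) * ?w m"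
      by (simp add: block_coef_def len s_def pl)
    have "complex_of_real (block_coef c x (ls, m)) \<cdot>\<^sub>m block_unitary n c x (ls, m)
       = (complex_of_real (block_coef c x (ls, m)) * (- \<i>) ^ k) \<cdot>\<^sub>m (mat_prod ?D (map ?P ls) * E)"
      by (simp add: block_unitary_def len E_def smult_smult_mat)
    moreover have "g k \<cdot>\<^sub>m ((prod_list (map ?w ls) \<cdot>\<^sub>m mat_prod ?D (map ?P ls)) * (?w m \<cdot>\<^sub>m R k m))
       = (g k * (prod_list (map ?w ls) * (?w m * s))) \<cdot>\<^sub>m (mat_prod ?D (map ?P ls) * E)"
      unfolding RE smult_smult_mat smult_mult_smult[OF mp E] ..
    moreover have "complex_of_real (block_coef c x (ls, m)) * (- \<i>) ^ k = g k * (prod_list (map ?w ls) * (?w m * s))"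
      unfolding bc g_def by (simp add: field_simps)
    ultimately show ?thesis by simp
  qed
  have "segment n c x q = mat_sum ?D {k. k \<le> q \<and> even k} (\<lambda>k. mat_sum ?D (lists_of ?I k) (\<lambda>ls. mat_sum ?D ?I (\<lambda>m.
      complex_of_real (block_coef c x (ls, m)) \<cdot>\<^sub>m block_unitary n c x (ls, m))))"
    unfolding segment_def by (rule eq_matI) (auto simp: sum_blocks)
  also have "\<dots> = mat_sum ?D {k. k \<le> q \<and> even k} (\<lambda>k. g k \<cdot>\<^sub>m (?H ^\<^sub>m k * (1\<^sub>m ?D + (- \<i> * complex_of_real (x / real (k + 1))) \<cdot>\<^sub>m ?H)))"
  proof (rule mat_sum_cong)
    fix k
    have mp: "prod_list (map ?w ls) \<cdot>\<^sub>m mat_prod ?D (map ?P ls) \<in> carrier_mat ?D ?D" if "ls \<in> lists_of ?I k" for ls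
      using that P by (intro smult_carrier_mat mat_prod_carrier) auto
    have wR: "?w m \<cdot>\<^sub>m R k m \<in> carrier_mat ?D ?D" if "m \<in> ?I" for m using R[OF that] by simp
    have "mat_sum ?D (lists_of ?I k) (\<lambda>ls. mat_sum ?D ?I (\<lambda>m. complex_of_real (block_coef c x (ls, m)) \<cdot>\<^sub>m block_unitary n c x (ls, m)))
       = mat_sum ?D (lists_of ?I k) (\<lambda>ls. mat_sum ?D ?I (\<lambda>m. g k \<cdot>\<^sub>m ((prod_list (map ?w ls) \<cdot>\<^sub>m mat_prod ?D (map ?P ls)) * (?w m \<cdot>\<^sub>m R k m))))"
      by (intro mat_sum_cong block_term)
    also have "\<dots> = mat_sum ?D (lists_of ?I k) (\<lambda>ls. g k \<cdot>\<^sub>m mat_sum ?D ?I (\<lambda>m. (prod_list (map ?w ls) \<cdot>\<^sub>m mat_prod ?D (map ?P ls)) * (?w m \<cdot>\<^sub>m R k m)))"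
      using mult_carrier_mat[OF mp wR] by (intro mat_sum_cong smult_mat_sum[symmetric])
    also have "\<dots> = g k \<cdot>\<^sub>m mat_sum ?D (lists_of ?I k) (\<lambda>ls. mat_sum ?D ?I (\<lambda>m. (prod_list (map ?w ls) \<cdot>\<^sub>m mat_prod ?D (map ?P ls)) * (?w m \<cdot>\<^sub>m R k m)))"
      by (rule smult_mat_sum[symmetric]) simp
    also have "\<dots> = g k \<cdot>\<^sub>m (mat_sum ?D (lists_of ?I k) (\<lambda>ls. prod_list (map ?w ls) \<cdot>\<^sub>m mat_prod ?D (map ?P ls)) * mat_sum ?D ?I (\<lambda>m. ?w m \<cdot>\<^sub>m R k m))"
      by (intro arg_cong[where f = "(\<cdot>\<^sub>m) (g k)"] mat_sum_product mp wR)
    also have "mat_sum ?D (lists_of ?I k) (\<lambda>ls. prod_list (map ?w ls) \<cdot>\<^sub>m mat_prod ?D (map ?P ls)) = ?H ^\<^sub>m k"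
      unfolding normalized_ham_sum by (rule mat_sum_lists_pow) (rule P)
    finally show "mat_sum ?D (lists_of ?I k) (\<lambda>ls. mat_sum ?D ?I (\<lambda>m. complex_of_real (block_coef c x (ls, m)) \<cdot>\<^sub>m block_unitary n c x (ls, m)))
      = g k \<cdot>\<^sub>m (?H ^\<^sub>m k * (1\<^sub>m ?D + (- \<i> * complex_of_real (x / real (k + 1))) \<cdot>\<^sub>m ?H))"
      unfolding sumR .
  qed
  also have "\<dots> = mat_sum ?D {k. k \<le> q \<and> even k} (\<lambda>k. fcalc ?D S P (\<lambda>a. (- \<i> * complex_of_real (x * a)) ^ k / fact k * (1 + (- \<i> * complex_of_real (x * a)) / of_nat (k + 1))))"
  proof (rule mat_sum_cong)
    fix k
    have "?H ^\<^sub>m k = fcalc ?D S P (\<lambda>a. complex_of_real a ^ k)"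
      using fcalc_pow[OF sp, of complex_of_real k] fcalc_id[OF sp] by simp
    moreover have "1\<^sub>m ?D + (- \<i> * complex_of_real (x / real (k + 1))) \<cdot>\<^sub>m ?H = fcalc ?D S P (\<lambda>a. 1 + (- \<i> * complex_of_real (x / real (k + 1))) * complex_of_real a)"
      unfolding fcalc_add[OF sp, symmetric] fcalc_smult[OF sp, symmetric] fcalc_one[OF sp] fcalc_id[OF sp] ..
    ultimately have "g k \<cdot>\<^sub>m (?H ^\<^sub>m k * (1\<^sub>m ?D + (- \<i> * complex_of_real (x / real (k + 1))) \<cdot>\<^sub>m ?H))
       = fcalc ?D S P (\<lambda>a. g k * (complex_of_real a ^ k * (1 + (- \<i> * complex_of_real (x / real (k + 1))) * complex_of_real a)))"
      by (simp only: fcalc_mult[OF sp] fcalc_smult[OF sp])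
    also have "(\<lambda>a. g k * (complex_of_real a ^ k * (1 + (- \<i> * complex_of_real (x / real (k + 1))) * complex_of_real a)))
       = (\<lambda>a. (- \<i> * complex_of_real (x * a)) ^ k / fact k * (1 + (- \<i> * complex_of_real (x * a)) / of_nat (k + 1)))"
    proof
      fix a :: real
      have "(- \<i> * complex_of_real (x * a)) ^ k = (- \<i>) ^ k * complex_of_real x ^ k * complex_of_real a ^ k"
        by (simp only: power_mult_distrib of_real_mult mult.assoc)
      then show "g k * (complex_of_real a ^ k * (1 + (- \<i> * complex_of_real (x / real (k + 1))) * complex_of_real a))
        = (- \<i> * complex_of_real (x * a)) ^ k / fact k * (1 + (- \<i> * complex_of_real (x * a)) / of_nat (k + 1))"
        unfolding g_def by simp
    qed
    finally show "g k \<cdot>\<^sub>m (?H ^\<^sub>m k * (1\<^sub>m ?D + (- \<i> * complex_of_real (x / real (k + 1))) \<cdot>\<^sub>m ?H))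
       = fcalc ?D S P (\<lambda>a. (- \<i> * complex_of_real (x * a)) ^ k / fact k * (1 + (- \<i> * complex_of_real (x * a)) / of_nat (k + 1)))" .
  qed
  also have "\<dots> = fcalc ?D S P (\<lambda>a. trunc_exp q (- \<i> * complex_of_real (x * a)))"
  proof (rule eq_matI)
    fix i j assume "i < dim_row (fcalc ?D S P (\<lambda>a. trunc_exp q (- \<i> * complex_of_real (x * a))))"
      "j < dim_col (fcalc ?D S P (\<lambda>a. trunc_exp q (- \<i> * complex_of_real (x * a))))"
    then have ij: "i < ?D" "j < ?D" by auto
    show "mat_sum ?D {k. k \<le> q \<and> even k} (\<lambda>k. fcalc ?D S P (\<lambda>a. (- \<i> * complex_of_real (x * a)) ^ k / fact k * (1 + (- \<i> * complex_of_real (x * a)) / of_nat (k + 1)))) $$ (i, j)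
      = fcalc ?D S P (\<lambda>a. trunc_exp q (- \<i> * complex_of_real (x * a))) $$ (i, j)"
      unfolding index_mat_sum[OF ij] index_fcalc[OF sp ij] trunc_exp_def sum_distrib_right by (rule sum.swap)
  qed auto
  finally show ?thesis .
qed

lemma words_lists: "words r q c = lists_of (blocks q c) r"
  by (auto simp: words_def)

lemma lcu_approx_words:
  "lcu_approx n t r q c = mat_sum (joint_dim n c) (words r q c)
     (\<lambda>w. complex_of_real (word_coef t r c w) \<cdot>\<^sub>m word_unitary n t r c w)"
proof -
  have pl: "complex_of_real (prod_list (map f w)) = prod_list (map (\<lambda>b. complex_of_real (f b)) w)" for f :: "block \<Rightarrow> real" and w
    by (induction w) auto
  show ?thesis
    unfolding lcu_approx_def segment_def words_lists word_coef_def word_unitary_def pl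
    by (rule mat_sum_lists_pow[symmetric]) (rule unitary_carrier[OF block_unitary_unitary])
qed

lemma word_unitary_unitary: "w \<in> words r q c \<Longrightarrow> unitary_mat (joint_dim n c) (word_unitary n t r c w)"
  unfolding word_unitary_def by (rule unitary_mat_prod) (auto simp: words_def intro: block_unitary_unitary)

lemma prod_list_weight_pos: "set ls \<subseteq> {1..terms c} \<Longrightarrow> 0 < prod_list (map (weight c) ls)"
  by (induction ls) (auto intro!: mult_pos_pos weight_pos)

lemma block_coef_pos: "b \<in> blocks q c \<Longrightarrow> 0 < x \<Longrightarrow> 0 < block_coef c x b"
  by (cases b) (auto simp: blocks_def block_coef_def intro!: mult_pos_pos divide_pos_pos prod_list_weight_pos weight_pos add_pos_nonneg)

lemma blocks_nonempty: "blocks q c \<noteq> {}"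
proof -
  have "([], 1) \<in> blocks q c" using terms_pos by (simp add: blocks_def)
  then show ?thesis by auto
qed

text \<open>The weights of the strings and of the rotation each sum to 1, so the one-norm of the
  segment does not depend on the Hamiltonian.\<close>

lemma sum_block_coef:
  "(\<Sum>b\<in>blocks q c. block_coef c x b) = (\<Sum>k\<in>{k. k \<le> q \<and> even k}. x ^ k / fact k * sqrt (1 + (x / real (k + 1))\<^sup>2))"
proof -
  have "(\<Sum>ls\<in>lists_of {1..terms c} k. \<Sum>m\<in>{1..terms c}. block_coef c x (ls, m)) = x ^ k / fact k * sqrt (1 + (x / real (k + 1))\<^sup>2)" for k
  proof -
    let ?g = "x ^ k / fact k * sqrt (1 + (x / real (k + 1))\<^sup>2)"
    have "(\<Sum>ls\<in>lists_of {1..terms c} k. \<Sum>m\<in>{1..terms c}. block_coef c x (ls, m))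
      = (\<Sum>ls\<in>lists_of {1..terms c} k. \<Sum>m\<in>{1..terms c}. ?g * prod_list (map (weight c) ls) * weight c m)"
      by (intro sum.cong refl) (auto simp: block_coef_def)
    also have "\<dots> = ?g * ((\<Sum>ls\<in>lists_of {1..terms c} k. prod_list (map (weight c) ls)) * (\<Sum>m\<in>{1..terms c}. weight c m))"
      unfolding sum_product by (simp only: sum_distrib_left mult.assoc)
    also have "\<dots> = ?g" unfolding sum_prod_list_pow sum_weight by simp
    finally show ?thesis .
  qed
  then show ?thesis unfolding sum_blocks by simp
qed

lemma word_coef_pos:
  assumes "0 < t" "0 < r" "w \<in> words r q c"
  shows "0 < word_coef t r c w"
proof -
  have "0 < segment_time t r c" using assms coef_sum_pos by (simp add: segment_time_def)
  then have "0 < prod_list (map (block_coef c (segment_time t r c)) w)" if "set w \<subseteq> blocks q c" for w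
    using that by (induction w) (auto intro!: mult_pos_pos block_coef_pos)
  then show ?thesis using assms by (simp add: word_coef_def words_def)
qed

lemma lcu_norm_eq:
  assumes "0 < t" "0 < r"
  shows "lcu_norm t r q c = (\<Sum>b\<in>blocks q c. block_coef c (segment_time t r c) b) ^ r"
proof -
  have "lcu_norm t r q c = (\<Sum>w\<in>words r q c. word_coef t r c w)"
    unfolding lcu_norm_def using word_coef_pos[OF assms] by (intro sum.cong) (auto simp: less_imp_le)
  then show ?thesis unfolding word_coef_def words_lists sum_prod_list_pow .
qed

lemma finite_words: "finite (words r q c)"
  unfolding words_lists by (rule finite_lists_length_eq[OF finite_blocks])

lemma lcu_norm_pos:
  assumes "0 < t" "0 < r"
  shows "0 < lcu_norm t r q c"
  unfolding lcu_norm_eq[OF assms]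
  using assms coef_sum_pos
  by (intro zero_less_power sum_pos finite_blocks blocks_nonempty block_coef_pos) (auto simp: segment_time_def)

lemma pmf_sample_word:
  assumes "0 < t" "0 < r"
  shows "pmf (sample_word t r q c) w = (if w \<in> words r q c then word_coef t r c w / lcu_norm t r q c else 0)"
  unfolding sample_word_def
proof (rule pmf_embed_finite[OF finite_words])
  have "(\<Sum>w\<in>words r q c. word_coef t r c w) = lcu_norm t r q c"
    unfolding lcu_norm_def using word_coef_pos[OF assms] by (intro sum.cong) (auto simp: less_imp_le)
  then show "(\<Sum>w\<in>words r q c. if w \<in> words r q c then word_coef t r c w / lcu_norm t r q c else 0) = 1"
    using lcu_norm_pos[OF assms, of q] by (simp flip: sum_divide_distrib)
qed (use word_coef_pos[OF assms] lcu_norm_pos[OF assms, of q] in \<open>auto simp: less_imp_le\<close>)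

lemma set_sample_word:
  assumes "0 < t" "0 < r"
  shows "set_pmf (sample_word t r q c) = words r q c"
  using word_coef_pos[OF assms] lcu_norm_pos[OF assms, of q]
  by (force simp: set_pmf_eq pmf_sample_word[OF assms])

end

section \<open>Truncation error and one-norm of the decomposition\<close>

lemma sum_even_index:
  fixes m :: nat
  shows "(\<Sum>k\<in>{k. k \<le> 2 * m \<and> even k}. f k) = (\<Sum>j\<le>m. f (2 * j))"
  by (rule sum.reindex_bij_witness[of _ "\<lambda>j. 2 * j" "\<lambda>k. k div 2"]) auto

lemma taylor_pair:
  fixes z :: complex
  shows "z ^ N / fact N * (1 + z / of_nat (N + 1)) = z ^ N / fact N + z ^ (N + 1) / fact (N + 1)"
proof -
  have "(1 + of_nat N :: complex) \<noteq> 0" using of_nat_neq_0[of N, where ?'a = complex] by simp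
  then show ?thesis by (simp add: algebra_simps)
qed

text \<open>Opening the pairs restores every Taylor order. The top degree is odd because the last
  even order brings its successor along.\<close>

lemma trunc_exp_even: "trunc_exp (2 * m) z = (\<Sum>k\<le>2 * m + 1. z ^ k / fact k)"
proof -
  have "(\<Sum>j\<le>m. z ^ (2 * j) / fact (2 * j) * (1 + z / of_nat (2 * j + 1))) = (\<Sum>k\<le>2 * m + 1. z ^ k / fact k)"
  proof (induction m)
    case 0
    show ?case by simp
  next
    case (Suc m)
    have e: "z ^ (2 * Suc m) / fact (2 * Suc m) * (1 + z / of_nat (2 * Suc m + 1))
      = z ^ (2 * Suc m) / fact (2 * Suc m) + z ^ (2 * Suc m + 1) / fact (2 * Suc m + 1)"
      by (rule taylor_pair)
    have "2 * Suc m + 1 = Suc (Suc (2 * m + 1))" by simp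
    then have "(\<Sum>k\<le>2 * Suc m + 1. z ^ k / fact k) = (\<Sum>k\<le>2 * m + 1. z ^ k / fact k)
       + (z ^ (2 * Suc m) / fact (2 * Suc m) + z ^ (2 * Suc m + 1) / fact (2 * Suc m + 1))"
      by (simp only: sum.atMost_Suc) simp
    then show ?case using Suc.IH e by (simp only: sum.atMost_Suc)
  qed
  then show ?thesis unfolding trunc_exp_def sum_even_index .
qed

text \<open>The Taylor remainder on the imaginary axis; degree 2 m + 1 gives the exponent 2 m + 2
  without an exponential factor.\<close>

lemma trunc_exp_error:
  "cmod (trunc_exp (2 * m) (- \<i> * complex_of_real y) - exp (- \<i> * complex_of_real y)) \<le> \<bar>y\<bar> ^ (2 * m + 2) / fact (2 * m + 2)"
  using iexp_approx1[of "- y" "2 * m + 1"] unfolding trunc_exp_even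
  by (simp add: norm_minus_commute)

lemma cmod_power_diff_le:
  assumes "cmod z = 1" "cmod (s - z) \<le> \<eta>"
  shows "cmod (s ^ r - z ^ r) \<le> (1 + \<eta>) ^ r - 1"
proof (induction r)
  case (Suc r)
  have "0 \<le> \<eta>" using assms(2) norm_ge_zero order_trans by blast
  have s: "cmod s \<le> 1 + \<eta>" using norm_triangle_ineq[of "s - z" z] assms by simp
  have "s ^ Suc r - z ^ Suc r = s * (s ^ r - z ^ r) + (s - z) * z ^ r" by (simp add: algebra_simps)
  also have "cmod \<dots> \<le> cmod s * cmod (s ^ r - z ^ r) + cmod (s - z) * cmod z ^ r"
    by (metis norm_mult norm_power norm_triangle_ineq)
  also have "\<dots> \<le> (1 + \<eta>) * ((1 + \<eta>) ^ r - 1) + \<eta> * 1"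
    using s Suc assms \<open>0 \<le> \<eta>\<close> by (intro add_mono mult_mono) auto
  also have "\<dots> = (1 + \<eta>) ^ Suc r - 1" by (simp add: algebra_simps)
  finally show ?case .
qed simp

text \<open>Compares with exp u for u = r \<eta>, and exp u is at most 1 + u + u^2 on [0, 1]. It
  linearises the error both over the segments of a collision and over the sequence of
  collisions.\<close>

lemma one_plus_power_le:
  assumes "0 \<le> \<eta>" "real r * \<eta> \<le> 1"
  shows "(1 + \<eta>) ^ r - 1 \<le> 2 * (real r * \<eta>)"
proof -
  let ?u = "real r * \<eta>"
  have u: "0 \<le> ?u" using assms by simp
  have "(1 + \<eta>) ^ r \<le> exp \<eta> ^ r" using assms by (intro power_mono) auto
  also have "\<dots> = exp ?u" by (simp add: exp_of_nat_mult)
  also have "\<dots> \<le> 1 + ?u + ?u\<^sup>2" using assms u by (intro exp_bound)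
  also have "?u\<^sup>2 \<le> ?u" using assms u by (simp add: power2_eq_square mult_left_le)
  finally show ?thesis by (simp add: algebra_simps)
qed

text \<open>Both matrices are functions of the same Hermitian matrix, so the operator error is a
  scalar error on eigenvalues in [-1, 1]. One segment contributes the Taylor remainder, and the r-th
  power multiplies it by at most 2 r.\<close>

lemma lcu_approx_error:
  assumes valid: "valid_collision n HS c" and t: "0 < t" and r: "0 < r" and x: "segment_time t r c < 1"
    and e: "2 * (real r * (segment_time t r c ^ (2 * m + 2) / fact (2 * m + 2))) \<le> \<epsilon>" "\<epsilon> \<le> 1"
  shows "op_bound (lcu_approx n t r (2 * m) c - collision_unitary n HS t c) \<epsilon>"
proof -
  let ?D = "joint_dim n c" and ?x = "segment_time t r c"
  obtain S P where sp: "spectral ?D (normalized_ham n HS c) S P"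
    using spectral_decomposition[OF hermitian_normalized_ham[OF valid]] .
  have x0: "0 < ?x" using t r coef_sum_pos[OF valid] by (simp add: segment_time_def)
  let ?\<eta> = "?x ^ (2 * m + 2) / fact (2 * m + 2)"
  have \<eta>: "0 \<le> ?\<eta>" using x0 by simp
  then have e0: "0 \<le> \<epsilon>" using e(1) by (meson mult_nonneg_nonneg of_nat_0_le_iff order_trans zero_le_numeral)
  have l: "lcu_approx n t r (2 * m) c = fcalc ?D S P (\<lambda>a. trunc_exp (2 * m) (- \<i> * complex_of_real (?x * a)) ^ r)"
    unfolding lcu_approx_def segment_fcalc[OF valid sp less_imp_le[OF x0]] by (rule fcalc_pow[OF sp])
  have u: "collision_unitary n HS t c = fcalc ?D S P (\<lambda>a. exp (- \<i> * complex_of_real (?x * a)) ^ r)"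
  proof -
    have "exp (- \<i> * complex_of_real (coef_sum c * t) * complex_of_real a) = exp (- \<i> * complex_of_real (?x * a)) ^ r" for a
      using r by (simp add: segment_time_def mult.assoc flip: exp_of_nat_mult)
    then show ?thesis unfolding collision_unitary_def mat_exp_fcalc[OF sp] by simp
  qed
  show ?thesis
    unfolding l u fcalc_minus[OF sp]
  proof (rule op_bound_fcalc[OF sp _ e0])
    fix a assume a: "a \<in> S" "P a \<noteq> 0\<^sub>m ?D ?D"
    have a1: "\<bar>a\<bar> \<le> 1" by (rule spectral_eigenvalue_bound[OF sp a op_bound_normalized_ham[OF valid]])
    have "\<bar>?x * a\<bar> \<le> ?x" using a1 x0 by (simp add: abs_mult mult_left_le)
    then have "\<bar>?x * a\<bar> ^ (2 * m + 2) / fact (2 * m + 2) \<le> ?\<eta>" by (intro divide_right_mono power_mono) auto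
    then have "cmod (trunc_exp (2 * m) (- \<i> * complex_of_real (?x * a)) - exp (- \<i> * complex_of_real (?x * a))) \<le> ?\<eta>"
      using trunc_exp_error[of m "?x * a"] by linarith
    then have "cmod (trunc_exp (2 * m) (- \<i> * complex_of_real (?x * a)) ^ r - exp (- \<i> * complex_of_real (?x * a)) ^ r) \<le> (1 + ?\<eta>) ^ r - 1"
      by (intro cmod_power_diff_le) (simp_all add: norm_exp_eq_Re)
    also have "\<dots> \<le> 2 * (real r * ?\<eta>)"
      by (rule one_plus_power_le[OF \<eta>]) (use e in linarith)
    also have "\<dots> \<le> \<epsilon>" by (rule e(1))
    finally show "cmod (trunc_exp (2 * m) (- \<i> * complex_of_real (?x * a)) ^ r - exp (- \<i> * complex_of_real (?x * a)) ^ r) \<le> \<epsilon>" .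
  qed
qed

lemma exp_sum_le:
  assumes "finite I" "0 \<le> (x::real)"
  shows "(\<Sum>k\<in>I. x ^ k / fact k) \<le> exp x"
proof -
  have "(\<lambda>k. x ^ k / fact k) sums exp x"
    using exp_converges[of x] by (simp add: divide_inverse mult.commute)
  then show ?thesis using assms
    by (subst sums_unique) (auto intro!: sum_le_suminf simp: sums_iff)
qed

lemma fact_double_ge: "2 ^ j * fact j \<le> (fact (2 * j) :: real)"
proof (induction j)
  case (Suc j)
  have "2 ^ Suc j * fact (Suc j) = (2 ^ j * fact j) * (2 * real (Suc j))" by (simp add: algebra_simps)
  also have "\<dots> \<le> fact (2 * j) * (2 * real (Suc j))" using Suc by (intro mult_right_mono) auto
  also have "\<dots> \<le> fact (2 * j) * (2 * real (Suc j) * (2 * real j + 1))"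
    by (intro mult_left_mono) (auto simp: mult_le_cancel_left1)
  also have "\<dots> = fact (2 * Suc j)" by (simp add: algebra_simps)
  finally show ?case .
qed simp

text \<open>The even Taylor orders sum to at most cosh x, which is below exp (x^2 / 2) by
  \<open>fact_double_ge\<close>, and the square roots contribute another such factor. This is the
  gain from pairing: the one-norm exceeds 1 only to second order in x.\<close>

lemma sum_block_coef_le:
  assumes "0 \<le> (x::real)"
  shows "(\<Sum>k\<in>{k. k \<le> 2 * m \<and> even k}. x ^ k / fact k * sqrt (1 + (x / real (k + 1))\<^sup>2)) \<le> exp (x\<^sup>2)"
proof -
  have s: "sqrt (1 + (x / real (k + 1))\<^sup>2) \<le> exp (x\<^sup>2 / 2)" for k
  proof (rule real_le_lsqrt)
    have "x / real (k + 1) \<le> x" using assms by (simp add: divide_le_eq mult_left_le_one_le algebra_simps)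
    then have "1 + (x / real (k + 1))\<^sup>2 \<le> 1 + x\<^sup>2" using assms by (intro add_left_mono power_mono) auto
    also have "\<dots> \<le> exp (x\<^sup>2)" by (rule exp_ge_add_one_self)
    also have "\<dots> = (exp (x\<^sup>2 / 2))\<^sup>2" by (simp flip: exp_double)
    finally show "1 + (x / real (k + 1))\<^sup>2 \<le> (exp (x\<^sup>2 / 2))\<^sup>2" .
  qed auto
  have "(\<Sum>k\<in>{k. k \<le> 2 * m \<and> even k}. x ^ k / fact k * sqrt (1 + (x / real (k + 1))\<^sup>2))
     \<le> (\<Sum>k\<in>{k. k \<le> 2 * m \<and> even k}. x ^ k / fact k * exp (x\<^sup>2 / 2))"
    using s assms by (intro sum_mono mult_left_mono) auto
  also have "\<dots> = (\<Sum>j\<le>m. x ^ (2 * j) / fact (2 * j)) * exp (x\<^sup>2 / 2)"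
    unfolding sum_even_index by (simp add: sum_distrib_right)
  also have "\<dots> \<le> (\<Sum>j\<le>m. (x\<^sup>2 / 2) ^ j / fact j) * exp (x\<^sup>2 / 2)"
  proof (intro mult_right_mono sum_mono)
    fix j
    have "x ^ (2 * j) / fact (2 * j) \<le> x ^ (2 * j) / (2 ^ j * fact j)"
      using fact_double_ge[of j] assms by (intro divide_left_mono) auto
    then show "x ^ (2 * j) / fact (2 * j) \<le> (x\<^sup>2 / 2) ^ j / fact j" by (simp add: power_divide power_mult)
  qed auto
  also have "\<dots> \<le> exp (x\<^sup>2 / 2) * exp (x\<^sup>2 / 2)" by (intro mult_right_mono exp_sum_le) auto
  also have "\<dots> = exp (x\<^sup>2)" by (simp flip: exp_add)
  finally show ?thesis .
qed

lemma lcu_norm_le: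
  assumes valid: "valid_collision n HS c" and t: "0 < t" and r: "0 < r"
  shows "lcu_norm t r (2 * m) c \<le> exp ((coef_sum c * t)\<^sup>2 / real r)"
proof -
  let ?x = "segment_time t r c"
  have x: "0 \<le> ?x" using t coef_sum_pos[OF valid] by (simp add: segment_time_def)
  have "lcu_norm t r (2 * m) c \<le> exp (?x\<^sup>2) ^ r"
    unfolding lcu_norm_eq[OF valid t r] sum_block_coef[OF valid]
    using x by (intro power_mono sum_block_coef_le sum_nonneg) auto
  also have "\<dots> = exp (real r * ?x\<^sup>2)" by (simp add: exp_of_nat_mult)
  also have "real r * ?x\<^sup>2 = (coef_sum c * t)\<^sup>2 / real r"
    using r by (simp add: segment_time_def power_divide power2_eq_square)
  finally show ?thesis .
qed

section \<open>Asymptotics of the truncation order\<close>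

text \<open>The elementary Stirling bound (q / e)^q, read off from the single term of order q in the
  series of exp q.\<close>

lemma fact_ge_exp:
  assumes "0 < q"
  shows "exp (real q * (ln (real q) - 1)) \<le> fact q"
proof -
  have "real q ^ q / fact q \<le> exp (real q)" using exp_sum_le[of "{q}" "real q"] by simp
  then have "real q ^ q / exp (real q) \<le> fact q" by (simp add: field_simps)
  moreover have "exp (real q * (ln (real q) - 1)) = real q ^ q / exp (real q)"
    using assms by (simp add: right_diff_distrib exp_diff exp_of_nat_mult)
  ultimately show ?thesis by simp
qed

text \<open>At u = 4 ln y / ln (ln y) the exponent u (ln u - 1) of the Stirling bound behaves like 4
  ln y, which leaves ample room above ln (2 y).\<close>

lemma truncation_order_sufficient:
  "\<forall>\<^sub>F y in at_top. \<forall>q. 4 * log_ratio y \<le> real q \<longrightarrow> 2 * y \<le> fact q"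
proof -
  have 1: "\<forall>\<^sub>F y::real in at_top. ln (2 * y) \<le> 4 * (ln y / ln (ln y)) * (ln (4 * (ln y / ln (ln y))) - 1)"
    by real_asymp
  have 2: "\<forall>\<^sub>F y::real in at_top. 3 \<le> 4 * (ln y / ln (ln y))"
    by real_asymp
  show ?thesis
    using 1 2 eventually_gt_at_top[of 0]
  proof eventually_elim
    case (elim y)
    show ?case
    proof (intro allI impI)
      fix q assume q: "4 * log_ratio y \<le> real q"
      let ?u = "4 * (ln y / ln (ln y))"
      have u: "?u \<le> real q" using q by (simp add: log_ratio_def)
      have q0: "0 < q" using u elim(2) by (cases q) auto
      \<comment> \<open>A value of at least 3, hence above e, makes the factor ln u - 1 nonnegative,
        so that u (ln u - 1) can be compared monotonically with its value at q.\<close>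
      have "1 \<le> ln ?u" using elim(2) exp_le by (subst ln_ge_iff) auto
      then have "?u * (ln ?u - 1) \<le> real q * (ln (real q) - 1)"
        using u elim(2) by (intro mult_mono) auto
      then have "ln (2 * y) \<le> real q * (ln (real q) - 1)" using elim(1) by linarith
      then have "exp (ln (2 * y)) \<le> exp (real q * (ln (real q) - 1))" by simp
      also have "\<dots> \<le> fact q" by (rule fact_ge_exp[OF q0])
      finally show "2 * y \<le> fact q" using elim(3) by simp
    qed
  qed
qed

text \<open>The function ln u / u decreases from u = e on. With u = ln x this is the threshold exp
  (exp 1).\<close>

lemma log_ratio_mono:
  assumes "exp (exp 1) \<le> x" "x \<le> y"
  shows "log_ratio x \<le> log_ratio y"
proof -
  have x0: "0 < x" using assms(1) exp_gt_zero less_le_trans by blast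
  have lx: "exp 1 \<le> ln x" using assms(1) x0 by (simp add: ln_ge_iff)
  have lxy: "ln x \<le> ln y" using assms x0 by simp
  have lx0: "0 < ln x" using lx exp_gt_zero less_le_trans by blast
  have llx: "1 \<le> ln (ln x)" using lx lx0 by (simp add: ln_ge_iff)
  have lly: "1 \<le> ln (ln y)" using llx lxy lx0 by (meson ln_mono order_trans)
  have "ln (ln y) / ln y \<le> ln (ln x) / ln x" by (rule ln_x_over_x_mono[OF lx lxy])
  then have "ln x / ln (ln x) \<le> ln y / ln (ln y)"
  proof -
    have "0 < ln (ln x)" "0 < ln (ln y)" "0 < ln y" using llx lly lx0 lxy by linarith+
    with \<open>ln (ln y) / ln y \<le> ln (ln x) / ln x\<close> lx0 show ?thesis by (simp add: field_simps)
  qed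
  then show ?thesis by (simp add: log_ratio_def)
qed

text \<open>Squaring doubles the logarithm and changes the iterated logarithm only additively, so
  the quotient tends to 2 and 4 is safe. The factor 12 is the one that arises in
  \<open>parameter_choice\<close>.\<close>

lemma log_ratio_square: "\<forall>\<^sub>F z in at_top. log_ratio (12 * z\<^sup>2) \<le> 4 * log_ratio z"
  unfolding log_ratio_def by real_asymp

lemma log_ratio_ge_one: "\<forall>\<^sub>F z in at_top. 1 \<le> log_ratio z"
  unfolding log_ratio_def by real_asymp

section \<open>The coherent run\<close>

lemma length_word_gates:
  assumes "set w \<subseteq> blocks q c"
  shows "word_gates w \<le> length w * (q + 1)"
  using assms
proof (induction w)
  case (Cons b w)
  obtain ls m where b: "b = (ls, m)" by (cases b)
  then have "length ls \<le> q" using Cons.prems by (auto simp: blocks_def)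
  then show ?case using Cons b by (simp add: word_gates_def)
qed (simp add: word_gates_def)

lemma word_gates_le: "w \<in> words r q c \<Longrightarrow> word_gates w \<le> r * (q + 1)"
  using length_word_gates[of w q c] by (auto simp: words_def)

text \<open>The product weight lets the two sums separate: the one over y assembles F on the left,
  the one over x its adjoint on the right. Real weights survive the adjoint unchanged.\<close>

lemma mat_trace_bilinear_sum:
  fixes g :: "'a \<Rightarrow> real"
  assumes f: "\<And>x. x \<in> J \<Longrightarrow> f x \<in> carrier_mat D D" and Z: "Z \<in> carrier_mat D D" and A: "A \<in> carrier_mat D D"
  defines "F \<equiv> mat_sum D J (\<lambda>x. complex_of_real (g x) \<cdot>\<^sub>m f x)"
  shows "(\<Sum>x\<in>J. \<Sum>y\<in>J. complex_of_real (g x * g y) * mat_trace (A * (f y * Z * (f x)\<^sup>\<dagger>))) = mat_trace (A * (F * Z * F\<^sup>\<dagger>))"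
proof -
  have gf: "x \<in> J \<Longrightarrow> complex_of_real (g x) \<cdot>\<^sub>m f x \<in> carrier_mat D D" for x using f by simp
  have fZ: "f x * Z \<in> carrier_mat D D" if "x \<in> J" for x using f[OF that] Z by (rule mult_carrier_mat)
  have f': "x \<in> J \<Longrightarrow> (f x)\<^sup>\<dagger> \<in> carrier_mat D D" for x using f by simp
  have c1: "y \<in> J \<Longrightarrow> complex_of_real (g y) \<cdot>\<^sub>m (f y * Z) \<in> carrier_mat D D" for y using fZ by simp
  have c2: "x \<in> J \<Longrightarrow> complex_of_real (g x) \<cdot>\<^sub>m (f x)\<^sup>\<dagger> \<in> carrier_mat D D" for x using f' by simp
  have FZ: "F * Z = mat_sum D J (\<lambda>y. complex_of_real (g y) \<cdot>\<^sub>m (f y * Z))"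
  proof -
    have "F * Z = mat_sum D J (\<lambda>y. (complex_of_real (g y) \<cdot>\<^sub>m f y) * Z)"
      unfolding F_def by (rule mat_sum_mult[OF Z]) (rule gf)
    also have "\<dots> = mat_sum D J (\<lambda>y. complex_of_real (g y) \<cdot>\<^sub>m (f y * Z))"
      by (intro mat_sum_cong mult_smult_assoc_mat[OF f Z])
    finally show ?thesis .
  qed
  have F': "F\<^sup>\<dagger> = mat_sum D J (\<lambda>x. complex_of_real (g x) \<cdot>\<^sub>m (f x)\<^sup>\<dagger>)"
  proof -
    have "F\<^sup>\<dagger> = mat_sum D J (\<lambda>x. (complex_of_real (g x) \<cdot>\<^sub>m f x)\<^sup>\<dagger>)"
      unfolding F_def by (rule adjoint_mat_sum) (rule gf)
    then show ?thesis by (simp add: adjoint_smult)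
  qed
  have fZf: "f y * Z * (f x)\<^sup>\<dagger> \<in> carrier_mat D D" if "x \<in> J" "y \<in> J" for x y
    using fZ[OF that(2)] f'[OF that(1)] by (rule mult_carrier_mat)
  have "F * Z * F\<^sup>\<dagger> = mat_sum D J (\<lambda>y. mat_sum D J (\<lambda>x. (complex_of_real (g y) \<cdot>\<^sub>m (f y * Z)) * (complex_of_real (g x) \<cdot>\<^sub>m (f x)\<^sup>\<dagger>)))"
    unfolding FZ F' by (rule mat_sum_product[symmetric]) (rule c1 c2, assumption)+
  also have "\<dots> = mat_sum D J (\<lambda>y. mat_sum D J (\<lambda>x. complex_of_real (g x * g y) \<cdot>\<^sub>m (f y * Z * (f x)\<^sup>\<dagger>)))"
  proof (intro mat_sum_cong)
    fix x y assume "y \<in> J" "x \<in> J"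
    then show "(complex_of_real (g y) \<cdot>\<^sub>m (f y * Z)) * (complex_of_real (g x) \<cdot>\<^sub>m (f x)\<^sup>\<dagger>) = complex_of_real (g x * g y) \<cdot>\<^sub>m (f y * Z * (f x)\<^sup>\<dagger>)"
      using smult_mult_smult[OF fZ f'] by (simp add: mult.commute)
  qed
  finally have E: "F * Z * F\<^sup>\<dagger> = mat_sum D J (\<lambda>y. mat_sum D J (\<lambda>x. complex_of_real (g x * g y) \<cdot>\<^sub>m (f y * Z * (f x)\<^sup>\<dagger>)))" .
  have "A * (F * Z * F\<^sup>\<dagger>) = mat_sum D J (\<lambda>y. A * mat_sum D J (\<lambda>x. complex_of_real (g x * g y) \<cdot>\<^sub>m (f y * Z * (f x)\<^sup>\<dagger>)))"
    unfolding E by (rule mult_mat_sum[OF A]) simp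
  also have "\<dots> = mat_sum D J (\<lambda>y. mat_sum D J (\<lambda>x. complex_of_real (g x * g y) \<cdot>\<^sub>m (A * (f y * Z * (f x)\<^sup>\<dagger>))))"
  proof (rule mat_sum_cong)
    fix y assume y: "y \<in> J"
    have "A * mat_sum D J (\<lambda>x. complex_of_real (g x * g y) \<cdot>\<^sub>m (f y * Z * (f x)\<^sup>\<dagger>)) = mat_sum D J (\<lambda>x. A * (complex_of_real (g x * g y) \<cdot>\<^sub>m (f y * Z * (f x)\<^sup>\<dagger>)))"
      by (rule mult_mat_sum[OF A]) (intro smult_carrier_mat fZf y)
    also have "\<dots> = mat_sum D J (\<lambda>x. complex_of_real (g x * g y) \<cdot>\<^sub>m (A * (f y * Z * (f x)\<^sup>\<dagger>)))"
      by (intro mat_sum_cong mult_smult_distrib[OF A fZf] y)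
    finally show "A * mat_sum D J (\<lambda>x. complex_of_real (g x * g y) \<cdot>\<^sub>m (f y * Z * (f x)\<^sup>\<dagger>)) = mat_sum D J (\<lambda>x. complex_of_real (g x * g y) \<cdot>\<^sub>m (A * (f y * Z * (f x)\<^sup>\<dagger>)))" .
  qed
  finally have "mat_trace (A * (F * Z * F\<^sup>\<dagger>)) = (\<Sum>y\<in>J. mat_trace (mat_sum D J (\<lambda>x. complex_of_real (g x * g y) \<cdot>\<^sub>m (A * (f y * Z * (f x)\<^sup>\<dagger>)))))"
    by (simp add: mat_trace_sum)
  also have "\<dots> = (\<Sum>y\<in>J. \<Sum>x\<in>J. complex_of_real (g x * g y) * mat_trace (A * (f y * Z * (f x)\<^sup>\<dagger>)))"
  proof (intro sum.cong refl)
    fix y assume y: "y \<in> J"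
    have AfZf: "A * (f y * Z * (f x)\<^sup>\<dagger>) \<in> carrier_mat D D" if "x \<in> J" for x
      using A fZf[OF that y] by (rule mult_carrier_mat)
    have "mat_trace (mat_sum D J (\<lambda>x. complex_of_real (g x * g y) \<cdot>\<^sub>m (A * (f y * Z * (f x)\<^sup>\<dagger>)))) = (\<Sum>x\<in>J. mat_trace (complex_of_real (g x * g y) \<cdot>\<^sub>m (A * (f y * Z * (f x)\<^sup>\<dagger>))))"
      by (rule mat_trace_sum) (intro smult_carrier_mat AfZf)
    also have "\<dots> = (\<Sum>x\<in>J. complex_of_real (g x * g y) * mat_trace (A * (f y * Z * (f x)\<^sup>\<dagger>)))"
      by (intro sum.cong refl mat_trace_smult[OF AfZf])
    finally show "mat_trace (mat_sum D J (\<lambda>x. complex_of_real (g x * g y) \<cdot>\<^sub>m (A * (f y * Z * (f x)\<^sup>\<dagger>)))) = (\<Sum>x\<in>J. complex_of_real (g x * g y) * mat_trace (A * (f y * Z * (f x)\<^sup>\<dagger>)))" .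
  qed
  also have "\<dots> = (\<Sum>x\<in>J. \<Sum>y\<in>J. complex_of_real (g x * g y) * mat_trace (A * (f y * Z * (f x)\<^sup>\<dagger>)))" by (rule sum.swap)
  finally show ?thesis ..
qed

text \<open>Independence gives the pair (x, y) a product probability, each factor normalised by the
  one-norm; hence the square of the one-norm. The arbitrary \<open>h\<close> stands for the depth
  recorded alongside the state.\<close>

lemma sampled_step_expectation:
  assumes valid: "valid_collision n HS c" and t: "0 < t" and r: "0 < r"
    and s: "\<sigma> \<in> carrier_mat (2 * 2 ^ n) (2 * 2 ^ n)" and A: "A \<in> carrier_mat (2 ^ n) (2 ^ n)"
  shows "measure_pmf.expectation (sample_word t r q c \<bind> (\<lambda>x. sample_word t r q c \<bind> (\<lambda>y.
        return_pmf (coherent_step n c (word_unitary n t r c x) (word_unitary n t r c y) \<sigma>, h x y))))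
      (\<lambda>z. mat_trace (A * blk (2 ^ n) 0 1 (fst z)))
    * (complex_of_real (lcu_norm t r q c))\<^sup>2
    = mat_trace (A * chan (2 ^ n) (2 ^ env_qubits c) (env_state c) (lcu_approx n t r q c) (lcu_approx n t r q c) (blk (2 ^ n) 0 1 \<sigma>))"
proof -
  let ?D = "joint_dim n c" and ?J = "words r q c" and ?W = "word_unitary n t r c" and ?g = "word_coef t r c"
  let ?e = "2 ^ env_qubits c" and ?R = "env_state c" and ?B = "blk (2 ^ n) 0 1 \<sigma>"
  let ?a = "lcu_norm t r q c"
  have D: "2 ^ n * ?e = ?D" by (simp add: joint_dim_def power_add)
  have R: "?R \<in> carrier_mat ?e ?e" using valid by (auto simp: valid_collision_def density_mat_def hermitian_mat_def)
  have W: "x \<in> ?J \<Longrightarrow> ?W x \<in> carrier_mat ?D ?D" for x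
    by (rule unitary_carrier[OF word_unitary_unitary[OF valid]])
  have fin: "finite ?J" by (rule finite_words[OF valid])
  have set: "set_pmf (sample_word t r q c) = ?J" by (rule set_sample_word[OF valid t r])
  have pmf: "x \<in> ?J \<Longrightarrow> pmf (sample_word t r q c) x = ?g x / ?a" for x
    by (simp add: pmf_sample_word[OF valid t r])
  have a: "0 < ?a" by (rule lcu_norm_pos[OF valid t r])
  have Z: "?B \<Otimes> ?R \<in> carrier_mat ?D ?D" using kron_carrier[OF blk_carrier[of "2 ^ n" 0 1 \<sigma>] R] by (simp only: D)
  have A1: "A \<Otimes> 1\<^sub>m ?e \<in> carrier_mat ?D ?D" using kron_carrier[OF A one_carrier_mat[of ?e]] by (simp only: D)
  have L: "lcu_approx n t r q c \<in> carrier_mat ?D ?D" unfolding lcu_approx_words[OF valid] by simp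
  have tr: "mat_trace (A * chan (2 ^ n) ?e ?R V V' ?B) = mat_trace ((A \<Otimes> 1\<^sub>m ?e) * (V * (?B \<Otimes> ?R) * V'\<^sup>\<dagger>))"
    if "V \<in> carrier_mat ?D ?D" "V' \<in> carrier_mat ?D ?D" for V V'
    by (rule mat_trace_chan_eq[OF A blk_carrier R]) (simp_all only: D that)
  have "measure_pmf.expectation (sample_word t r q c \<bind> (\<lambda>x. sample_word t r q c \<bind> (\<lambda>y.
        return_pmf (coherent_step n c (?W x) (?W y) \<sigma>, h x y)))) (\<lambda>z. mat_trace (A * blk (2 ^ n) 0 1 (fst z)))
     = (\<Sum>x\<in>?J. pmf (sample_word t r q c) x *\<^sub>R (\<Sum>y\<in>?J. pmf (sample_word t r q c) y *\<^sub>R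
          mat_trace (A * blk (2 ^ n) 0 1 (coherent_step n c (?W x) (?W y) \<sigma>))))"
    using fin set by (simp add: pmf_expectation_bind[OF fin])
  also have "\<dots> = (\<Sum>x\<in>?J. \<Sum>y\<in>?J. complex_of_real (?g x * ?g y) * mat_trace ((A \<Otimes> 1\<^sub>m ?e) * (?W y * (?B \<Otimes> ?R) * (?W x)\<^sup>\<dagger>)) / complex_of_real (?a\<^sup>2))"
    unfolding scaleR_sum_right
  proof (intro sum.cong refl)
    fix x y assume x: "x \<in> ?J" and y: "y \<in> ?J"
    show "pmf (sample_word t r q c) x *\<^sub>R pmf (sample_word t r q c) y *\<^sub>R mat_trace (A * blk (2 ^ n) 0 1 (coherent_step n c (?W x) (?W y) \<sigma>))
      = complex_of_real (?g x * ?g y) * mat_trace ((A \<Otimes> 1\<^sub>m ?e) * (?W y * (?B \<Otimes> ?R) * (?W x)\<^sup>\<dagger>)) / complex_of_real (?a\<^sup>2)"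
      unfolding blk_coherent_step[OF s R W[OF x] W[OF y]] tr[OF W[OF y] W[OF x]] pmf[OF x] pmf[OF y]
      by (simp add: scaleR_conv_of_real power2_eq_square)
  qed
  also have "\<dots> = mat_trace ((A \<Otimes> 1\<^sub>m ?e) * (lcu_approx n t r q c * (?B \<Otimes> ?R) * (lcu_approx n t r q c)\<^sup>\<dagger>)) / complex_of_real (?a\<^sup>2)"
    unfolding sum_divide_distrib[symmetric] lcu_approx_words[OF valid]
    by (subst mat_trace_bilinear_sum[OF W Z A1]) simp_all
  also have "\<dots> = mat_trace (A * chan (2 ^ n) ?e ?R (lcu_approx n t r q c) (lcu_approx n t r q c) ?B) / complex_of_real (?a\<^sup>2)"
    unfolding tr[OF L L] ..
  finally show ?thesis using a by simp
qed

text \<open>The recursion of \<open>markov_map\<close> with arbitrary matrices in place of the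
  collision unitaries, so that exact and approximate evolution are instances of one
  function.\<close>

primrec chan_iter :: "nat \<Rightarrow> (nat \<Rightarrow> collision) \<Rightarrow> (nat \<Rightarrow> complex mat) \<Rightarrow> nat \<Rightarrow> complex mat \<Rightarrow> complex mat" where
  "chan_iter n coll W 0 = id"
| "chan_iter n coll W (Suc k) = chan (2 ^ n) (2 ^ env_qubits (coll (Suc k))) (env_state (coll (Suc k))) (W (Suc k)) (W (Suc k))
     \<circ> chan_iter n coll W k"

lemma chan_iter_carrier: "X \<in> carrier_mat (2 ^ n) (2 ^ n) \<Longrightarrow> chan_iter n coll W k X \<in> carrier_mat (2 ^ n) (2 ^ n)"
  by (cases k) auto

lemma markov_map_chan_iter:
  "markov_map n HS t coll k = chan_iter n coll (\<lambda>j. collision_unitary n HS t (coll j)) k"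
  by (induction k) (auto simp: fun_eq_iff collision_map_def chan_def Let_def)

context
  fixes \<kappa> n K :: nat and HS :: "complex mat" and coll :: "nat \<Rightarrow> collision" and t :: real
    and \<rho>S :: "complex mat" and r q :: "nat \<Rightarrow> nat"
  assumes valid: "\<And>j. j \<in> {1..K} \<Longrightarrow> valid_collision n HS (coll j)"
    and t: "0 < t" and r: "\<And>j. j \<in> {1..K} \<Longrightarrow> 0 < r j"
    and state: "density_mat (2 ^ n) \<rho>S"
begin

lemma env_density: "j \<in> {1..K} \<Longrightarrow> density_mat (2 ^ env_qubits (coll j)) (env_state (coll j))"
  using valid by (auto simp: valid_collision_def)

lemma coherent_state_Suc:
  "coherent_state \<kappa> n t coll \<rho>S r q (Suc j) = coherent_state \<kappa> n t coll \<rho>S r q j \<bind> (\<lambda>z.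
     sample_word t (r (Suc j)) (q (Suc j)) (coll (Suc j)) \<bind> (\<lambda>x.
     sample_word t (r (Suc j)) (q (Suc j)) (coll (Suc j)) \<bind> (\<lambda>y.
       return_pmf (coherent_step n (coll (Suc j)) (word_unitary n t (r (Suc j)) (coll (Suc j)) x)
           (word_unitary n t (r (Suc j)) (coll (Suc j)) y) (fst z),
         snd z + prep_depth (coll (Suc j)) + \<kappa> * (word_gates x + word_gates y)))))"
  by (simp add: Let_def case_prod_unfold)

text \<open>Finite support turns expectations into finite sums, and the density property makes the
  final measurement meaningful. In the depth bound the factor 2 counts the two samples, each with r
  blocks of at most q + 1 gates.\<close>

lemma coherent_state_support:
  "j \<le> K \<Longrightarrow> finite (set_pmf (coherent_state \<kappa> n t coll \<rho>S r q j)) \<and>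
    (\<forall>z\<in>set_pmf (coherent_state \<kappa> n t coll \<rho>S r q j). density_mat (2 * 2 ^ n) (fst z) \<and>
      snd z \<le> (\<Sum>i=1..j. prep_depth (coll i) + \<kappa> * (2 * (r i * (q i + 1)))))"
proof (induction j)
  case 0
  show ?case using density_kron[OF density_plus_state state] by simp
next
  case (Suc j)
  let ?c = "coll (Suc j)" and ?r = "r (Suc j)" and ?q = "q (Suc j)"
  have j: "Suc j \<in> {1..K}" using Suc.prems by simp
  have set: "set_pmf (sample_word t ?r ?q ?c) = words ?r ?q ?c"
    by (rule set_sample_word[OF valid[OF j] t r[OF j]])
  have fin: "finite (words ?r ?q ?c)" by (rule finite_words[OF valid[OF j]])
  have IH: "finite (set_pmf (coherent_state \<kappa> n t coll \<rho>S r q j))"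
    "\<And>z. z \<in> set_pmf (coherent_state \<kappa> n t coll \<rho>S r q j) \<Longrightarrow> density_mat (2 * 2 ^ n) (fst z)"
    "\<And>z. z \<in> set_pmf (coherent_state \<kappa> n t coll \<rho>S r q j) \<Longrightarrow> snd z \<le> (\<Sum>i=1..j. prep_depth (coll i) + \<kappa> * (2 * (r i * (q i + 1))))"
    using Suc by auto
  show ?case
  proof (intro conjI ballI)
    show "finite (set_pmf (coherent_state \<kappa> n t coll \<rho>S r q (Suc j)))"
      unfolding coherent_state_Suc using IH(1) fin by (simp add: set)
    fix z assume "z \<in> set_pmf (coherent_state \<kappa> n t coll \<rho>S r q (Suc j))"
    then obtain y x1 x2 where y: "y \<in> set_pmf (coherent_state \<kappa> n t coll \<rho>S r q j)"
      and x: "x1 \<in> words ?r ?q ?c" "x2 \<in> words ?r ?q ?c"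
      and z: "z = (coherent_step n ?c (word_unitary n t ?r ?c x1) (word_unitary n t ?r ?c x2) (fst y),
         snd y + prep_depth ?c + \<kappa> * (word_gates x1 + word_gates x2))"
      unfolding coherent_state_Suc by (auto simp: set)
    show "density_mat (2 * 2 ^ n) (fst z)"
      unfolding z fst_conv using word_unitary_unitary[OF valid[OF j] x(1)] word_unitary_unitary[OF valid[OF j] x(2)]
      by (intro coherent_step_density[OF IH(2)[OF y] env_density[OF j]]) (auto simp: unitary_mat_def)
    have "word_gates x1 + word_gates x2 \<le> 2 * (?r * (?q + 1))"
      using word_gates_le[OF x(1)] word_gates_le[OF x(2)] by linarith
    then have "\<kappa> * (word_gates x1 + word_gates x2) \<le> \<kappa> * (2 * (?r * (?q + 1)))" by (rule mult_left_mono) simp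
    then show "snd z \<le> (\<Sum>i=1..Suc j. prep_depth (coll i) + \<kappa> * (2 * (r i * (q i + 1))))"
    proof -
      have "(\<Sum>i=1..Suc j. g i) = (\<Sum>i=1..j. g i) + g (Suc j)" for g :: "nat \<Rightarrow> nat" by simp
      from this[of "\<lambda>i. prep_depth (coll i) + \<kappa> * (2 * (r i * (q i + 1)))"] show ?thesis using IH(3)[OF y] \<open>\<kappa> * (word_gates x1 + word_gates x2) \<le> \<kappa> * (2 * (?r * (?q + 1)))\<close>
        unfolding z snd_conv by linarith
    qed
  qed
qed

text \<open>The induction ranges over all A, since the last collision is moved onto A as a dual
  channel before the hypothesis is applied. The final division by 2 comes from the initial ancilla
  state.\<close>

lemma coherent_state_expectation:
  "j \<le> K \<Longrightarrow> A \<in> carrier_mat (2 ^ n) (2 ^ n) \<Longrightarrow>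
    measure_pmf.expectation (coherent_state \<kappa> n t coll \<rho>S r q j) (\<lambda>z. mat_trace (A * blk (2 ^ n) 0 1 (fst z)))
      * (\<Prod>i=1..j. complex_of_real (lcu_norm t (r i) (q i) (coll i)))\<^sup>2
    = mat_trace (A * chan_iter n coll (\<lambda>i. lcu_approx n t (r i) (q i) (coll i)) j \<rho>S) / 2"
proof (induction j arbitrary: A)
  case 0
  have R: "\<rho>S \<in> carrier_mat (2 ^ n) (2 ^ n)" using state by (rule density_carrier)
  have "mat_trace (A * blk (2 ^ n) 0 1 (plus_state \<Otimes> \<rho>S)) = mat_trace (A * \<rho>S) / 2"
    unfolding blk_plus_state[OF R] mult_smult_distrib[OF 0(2) R] mat_trace_smult[OF mult_carrier_mat[OF 0(2) R]] by simp
  then show ?case by simp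
next
  case (Suc j)
  let ?c = "coll (Suc j)" and ?r = "r (Suc j)" and ?q = "q (Suc j)"
  let ?W = "\<lambda>i. lcu_approx n t (r i) (q i) (coll i)"
  let ?e = "2 ^ env_qubits ?c" and ?a = "complex_of_real (lcu_norm t ?r ?q ?c)"
  let ?prod = "\<Prod>i=1..j. complex_of_real (lcu_norm t (r i) (q i) (coll i))"
  let ?st = "coherent_state \<kappa> n t coll \<rho>S r q j"
  have j: "Suc j \<in> {1..K}" and jK: "j \<le> K" using Suc.prems by auto
  have A: "A \<in> carrier_mat (2 ^ n) (2 ^ n)" by fact
  have fin: "finite (set_pmf ?st)" and dens: "\<And>z. z \<in> set_pmf ?st \<Longrightarrow> density_mat (2 * 2 ^ n) (fst z)"
    using coherent_state_support[OF jK] by auto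
  have R: "env_state ?c \<in> carrier_mat ?e ?e" using env_density[OF j] by (rule density_carrier)
  have W: "?W (Suc j) \<in> carrier_mat (2 ^ n * ?e) (2 ^ n * ?e)"
    unfolding lcu_approx_words[OF valid[OF j]] by (simp add: joint_dim_def power_add)
  let ?A' = "dual_chan (2 ^ n) ?e (env_state ?c) (?W (Suc j)) (?W (Suc j)) A"
  have fsw: "finite (set_pmf (sample_word t ?r ?q ?c))"
    unfolding set_sample_word[OF valid[OF j] t r[OF j]] by (rule finite_words[OF valid[OF j]])
  let ?f = "\<lambda>z. sample_word t ?r ?q ?c \<bind> (\<lambda>x. sample_word t ?r ?q ?c \<bind> (\<lambda>y.
       return_pmf (coherent_step n ?c (word_unitary n t ?r ?c x) (word_unitary n t ?r ?c y) (fst z),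
         snd z + prep_depth ?c + \<kappa> * (word_gates x + word_gates y))))"
  let ?h = "\<lambda>z. mat_trace (A * blk (2 ^ n) 0 1 (fst z))"
  have step: "measure_pmf.expectation (?f z) ?h * ?a\<^sup>2 = mat_trace (?A' * blk (2 ^ n) 0 1 (fst z))" if "z \<in> set_pmf ?st" for z
    unfolding mat_trace_chan[OF A blk_carrier R W W, symmetric]
    by (rule sampled_step_expectation[OF valid[OF j] t r[OF j] density_carrier[OF dens[OF that]] A])
  have "measure_pmf.expectation (coherent_state \<kappa> n t coll \<rho>S r q (Suc j)) ?h
     = (\<Sum>z\<in>set_pmf ?st. pmf ?st z *\<^sub>R measure_pmf.expectation (?f z) ?h)"
    unfolding coherent_state_Suc by (rule pmf_expectation_bind[OF fin]) (simp_all add: fsw)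
  then have "measure_pmf.expectation (coherent_state \<kappa> n t coll \<rho>S r q (Suc j)) ?h * ?a\<^sup>2
     = (\<Sum>z\<in>set_pmf ?st. pmf ?st z *\<^sub>R (measure_pmf.expectation (?f z) ?h * ?a\<^sup>2))"
    by (simp only: sum_distrib_right mult_scaleR_left)
  also have "\<dots> = (\<Sum>z\<in>set_pmf ?st. pmf ?st z *\<^sub>R mat_trace (?A' * blk (2 ^ n) 0 1 (fst z)))"
    by (intro sum.cong refl) (simp only: step)
  also have "\<dots> = measure_pmf.expectation ?st (\<lambda>z. mat_trace (?A' * blk (2 ^ n) 0 1 (fst z)))"
    by (rule integral_measure_pmf[OF fin, symmetric]) auto
  finally have "measure_pmf.expectation (coherent_state \<kappa> n t coll \<rho>S r q (Suc j)) (\<lambda>z. mat_trace (A * blk (2 ^ n) 0 1 (fst z)))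
        * (\<Prod>i=1..Suc j. complex_of_real (lcu_norm t (r i) (q i) (coll i)))\<^sup>2
     = measure_pmf.expectation ?st (\<lambda>z. mat_trace (?A' * blk (2 ^ n) 0 1 (fst z))) * ?prod\<^sup>2"
    by (simp add: power_mult_distrib mult_ac)
  also have "\<dots> = mat_trace (?A' * chan_iter n coll ?W j \<rho>S) / 2" by (rule Suc.IH[OF jK dual_chan_carrier])
  also have "mat_trace (?A' * chan_iter n coll ?W j \<rho>S) = mat_trace (A * chan_iter n coll ?W (Suc j) \<rho>S)"
    using mat_trace_chan[OF A chan_iter_carrier[OF density_carrier[OF state]] R W W] by simp
  finally show ?case .
qed

lemma markov_map_density: "j \<le> K \<Longrightarrow> density_mat (2 ^ n) (markov_map n HS t coll j \<rho>S)"
proof (induction j)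
  case (Suc j)
  then have j: "Suc j \<in> {1..K}" by simp
  let ?c = "coll (Suc j)"
  have D: "2 ^ n * 2 ^ env_qubits ?c = joint_dim n ?c" by (simp add: joint_dim_def power_add)
  have "density_mat (2 ^ n * 2 ^ env_qubits ?c) (markov_map n HS t coll j \<rho>S \<Otimes> env_state ?c)"
    using Suc by (intro density_kron env_density[OF j]) simp
  then have "density_mat (2 ^ n * 2 ^ env_qubits ?c) (collision_unitary n HS t ?c * (markov_map n HS t coll j \<rho>S \<Otimes> env_state ?c) * (collision_unitary n HS t ?c)\<^sup>\<dagger>)"
    unfolding D using unitary_collision[OF valid[OF j]] by (intro density_conjugate) (auto simp: unitary_mat_def)
  then show ?case by (simp add: collision_map_def Let_def density_ptrace)
qed (simp add: state)

text \<open>Iterates \<open>chan_perturbation\<close>, under which the accumulated error plus 1 is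
  multiplied by (1 + \<epsilon>)^2 in each collision.\<close>

lemma channel_error:
  assumes err: "\<And>i. i \<in> {1..K} \<Longrightarrow> op_bound (lcu_approx n t (r i) (q i) (coll i) - collision_unitary n HS t (coll i)) \<epsilon>" "0 \<le> \<epsilon>"
  shows "j \<le> K \<Longrightarrow> A \<in> carrier_mat (2 ^ n) (2 ^ n) \<Longrightarrow> op_bound A a \<Longrightarrow> 0 \<le> a \<Longrightarrow>
    cmod (mat_trace (A * chan_iter n coll (\<lambda>i. lcu_approx n t (r i) (q i) (coll i)) j \<rho>S) - mat_trace (A * markov_map n HS t coll j \<rho>S))
      \<le> ((1 + \<epsilon>) ^ (2 * j) - 1) * a"
proof (induction j arbitrary: A a)
  case (Suc j)
  then have j: "Suc j \<in> {1..K}" and jK: "j \<le> K" by auto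
  let ?c = "coll (Suc j)"
  have D: "2 ^ n * 2 ^ env_qubits ?c = joint_dim n ?c" by (simp add: joint_dim_def power_add)
  let ?W = "\<lambda>i. lcu_approx n t (r i) (q i) (coll i)"
  let ?X = "chan_iter n coll ?W j \<rho>S" and ?Y = "markov_map n HS t coll j \<rho>S"
  have "cmod (mat_trace (A * chan (2 ^ n) (2 ^ env_qubits ?c) (env_state ?c) (?W (Suc j)) (?W (Suc j)) ?X)
      - mat_trace (A * chan (2 ^ n) (2 ^ env_qubits ?c) (env_state ?c) (collision_unitary n HS t ?c) (collision_unitary n HS t ?c) ?Y))
    \<le> (((1 + \<epsilon>) ^ (2 * j) - 1 + 1) * (1 + \<epsilon>)\<^sup>2 - 1) * a"
  proof (rule chan_perturbation[OF Suc.prems(2-4) env_density[OF j]])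
    show "?W (Suc j) \<in> carrier_mat (2 ^ n * 2 ^ env_qubits ?c) (2 ^ n * 2 ^ env_qubits ?c)"
      unfolding lcu_approx_words[OF valid[OF j]] D by simp
    show "collision_unitary n HS t ?c \<in> carrier_mat (2 ^ n * 2 ^ env_qubits ?c) (2 ^ n * 2 ^ env_qubits ?c)"
      unfolding D by (rule unitary_carrier[OF unitary_collision[OF valid[OF j]]])
    show "op_bound (collision_unitary n HS t ?c) 1" by (rule op_bound_unitary[OF unitary_collision[OF valid[OF j]]])
    show "op_bound (?W (Suc j) - collision_unitary n HS t ?c) \<epsilon>" by (rule err(1)[OF j])
    show "?X \<in> carrier_mat (2 ^ n) (2 ^ n)" by (rule chan_iter_carrier[OF density_carrier[OF state]])
    show "density_mat (2 ^ n) ?Y" by (rule markov_map_density[OF jK])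
  qed (use err(2) Suc.IH[OF jK] in auto)
  also have "(((1 + \<epsilon>) ^ (2 * j) - 1 + 1) * (1 + \<epsilon>)\<^sup>2 - 1) * a = ((1 + \<epsilon>) ^ (2 * Suc j) - 1) * a"
    by (simp add: power2_eq_square)
  finally show ?case unfolding markov_map_chan_iter by simp
qed simp

text \<open>Collects what the sampling argument requires of a single run: the range of its outcomes,
  its depth, and the mean that the rescaled outcome estimates.\<close>

lemma coherent_run_properties:
  assumes Obs: "hermitian_mat (2 ^ n) Obs" "op_bound Obs M" "0 \<le> M"
  shows "finite (set_pmf (coherent_run \<kappa> n K t coll \<rho>S Obs r q))"
    and "z \<in> set_pmf (coherent_run \<kappa> n K t coll \<rho>S Obs r q) \<Longrightarrow> \<bar>fst z\<bar> \<le> M"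
    and "z \<in> set_pmf (coherent_run \<kappa> n K t coll \<rho>S Obs r q) \<Longrightarrow>
      snd z \<le> (\<Sum>i=1..K. prep_depth (coll i) + \<kappa> * (2 * (r i * (q i + 1))))"
    and "(\<Prod>i=1..K. lcu_norm t (r i) (q i) (coll i))\<^sup>2 * measure_pmf.expectation (coherent_run \<kappa> n K t coll \<rho>S Obs r q) fst
      = Re (mat_trace (Obs * chan_iter n coll (\<lambda>i. lcu_approx n t (r i) (q i) (coll i)) K \<rho>S))"
proof -
  let ?X = "pauli_mat Pauli_X" and ?st = "coherent_state \<kappa> n t coll \<rho>S r q K"
  let ?A = "?X \<Otimes> Obs" and ?run = "coherent_run \<kappa> n K t coll \<rho>S Obs r q"
  have Oc: "Obs \<in> carrier_mat (2 ^ n) (2 ^ n)" "Obs\<^sup>\<dagger> = Obs" using Obs by (auto simp: hermitian_mat_def)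
  have run: "?run = ?st \<bind> (\<lambda>s. measure_observable ?A (fst s) \<bind> (\<lambda>x. return_pmf (x, snd s)))"
    unfolding coherent_run_def by (simp add: case_prod_unfold)
  have fin: "finite (set_pmf ?st)" and dens: "\<And>s. s \<in> set_pmf ?st \<Longrightarrow> density_mat (2 * 2 ^ n) (fst s)"
    and depth: "\<And>s. s \<in> set_pmf ?st \<Longrightarrow> snd s \<le> (\<Sum>i=1..K. prep_depth (coll i) + \<kappa> * (2 * (r i * (q i + 1))))"
    using coherent_state_support[OF order_refl] by auto
  have Ah: "hermitian_mat (2 * 2 ^ n) ?A"
    unfolding hermitian_mat_def kron_adjoint[OF pauli_carrier Oc(1)] pauli_adjoint Oc(2)
    using kron_carrier[OF pauli_carrier Oc(1), of Pauli_X] by (simp del: pauli_mat.simps)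
  \<comment> \<open>The observable factors into Pauli X on the ancilla, which is unitary, and
    \<open>Obs\<close> on the system, so the ancilla does not enlarge the range of outcomes.\<close>
  have Ab: "op_bound ?A M"
  proof -
    have "?A = (?X * 1\<^sub>m 2) \<Otimes> (1\<^sub>m (2 ^ n) * Obs)"
      by (simp only: right_mult_one_mat[OF pauli_carrier] left_mult_one_mat[OF Oc(1)])
    also have "\<dots> = (?X \<Otimes> 1\<^sub>m (2 ^ n)) * (1\<^sub>m 2 \<Otimes> Obs)"
      by (rule kron_mult[OF pauli_carrier one_carrier_mat one_carrier_mat Oc(1), symmetric])
    finally have eq: "?A = (?X \<Otimes> 1\<^sub>m (2 ^ n)) * (1\<^sub>m 2 \<Otimes> Obs)" .
    have "unitary_mat 2 ?X" using pauli_adjoint pauli_square pauli_carrier by (auto simp: unitary_mat_def simp del: pauli_mat.simps)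
    then have x: "op_bound (?X \<Otimes> 1\<^sub>m (2 ^ n)) 1" by (intro op_bound_kron_one[OF pauli_carrier] op_bound_unitary) auto
    have "op_bound ((?X \<Otimes> 1\<^sub>m (2 ^ n)) * (1\<^sub>m 2 \<Otimes> Obs)) (1 * M)"
      by (rule op_bound_mult[OF kron_carrier[OF pauli_carrier one_carrier_mat] kron_carrier[OF one_carrier_mat Oc(1)] x op_bound_one_kron[OF Oc(1) Obs(2,3)]]) simp
    then show ?thesis unfolding eq by simp
  qed
  note meas = measure_observable_outcome[OF Ah dens Ab]
  show finr: "finite (set_pmf ?run)" unfolding run using fin meas(1) by (auto simp del: pauli_mat.simps)
  show "\<bar>fst z\<bar> \<le> M" if "z \<in> set_pmf ?run"
    using that meas(3) unfolding run by (auto simp del: pauli_mat.simps)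
  show "snd z \<le> (\<Sum>i=1..K. prep_depth (coll i) + \<kappa> * (2 * (r i * (q i + 1))))" if "z \<in> set_pmf ?run"
    using that depth unfolding run by (auto simp del: pauli_mat.simps)
  have "measure_pmf.expectation ?run fst = (\<Sum>s\<in>set_pmf ?st. pmf ?st s *\<^sub>R measure_pmf.expectation (measure_observable ?A (fst s)) (\<lambda>x. x))"
    unfolding run
  proof (subst pmf_expectation_bind[OF fin])
    show "finite (set_pmf (measure_observable ?A (fst s) \<bind> (\<lambda>x. return_pmf (x, snd s))))" if "s \<in> set_pmf ?st" for s
      using meas(1)[OF that] by simp
    show "(\<Sum>s\<in>set_pmf ?st. pmf ?st s *\<^sub>R measure_pmf.expectation (measure_observable ?A (fst s) \<bind> (\<lambda>x. return_pmf (x, snd s))) fst)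
       = (\<Sum>s\<in>set_pmf ?st. pmf ?st s *\<^sub>R measure_pmf.expectation (measure_observable ?A (fst s)) (\<lambda>x. x))"
      by (simp only: map_pmf_def[symmetric] integral_map_pmf fst_conv)
  qed simp
  also have "\<dots> = (\<Sum>s\<in>set_pmf ?st. pmf ?st s *\<^sub>R Re (2 * mat_trace (Obs * blk (2 ^ n) 0 1 (fst s))))"
    using meas(2) trace_pauli_x_kron[OF density_hermitian[OF dens] Obs(1)] by (intro sum.cong refl) (simp del: pauli_mat.simps)
  also have "\<dots> = Re (2 * (\<Sum>s\<in>set_pmf ?st. pmf ?st s *\<^sub>R mat_trace (Obs * blk (2 ^ n) 0 1 (fst s))))"
    by (simp add: sum_distrib_left mult_ac)
  also have "(\<Sum>s\<in>set_pmf ?st. pmf ?st s *\<^sub>R mat_trace (Obs * blk (2 ^ n) 0 1 (fst s))) = measure_pmf.expectation ?st (\<lambda>z. mat_trace (Obs * blk (2 ^ n) 0 1 (fst z)))"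
    by (rule integral_measure_pmf[OF fin, symmetric]) auto
  finally have E: "measure_pmf.expectation ?run fst = Re (2 * measure_pmf.expectation ?st (\<lambda>z. mat_trace (Obs * blk (2 ^ n) 0 1 (fst z))))" .
  let ?E = "measure_pmf.expectation ?st (\<lambda>z. mat_trace (Obs * blk (2 ^ n) 0 1 (fst z)))"
  let ?p = "\<Prod>i=1..K. lcu_norm t (r i) (q i) (coll i)"
  have gen: "x\<^sup>2 * Re (2 * y) = Re (2 * (y * (complex_of_real x)\<^sup>2))" for x y
    by (simp add: power2_eq_square)
  have "?p\<^sup>2 * measure_pmf.expectation ?run fst = Re (2 * (?E * (complex_of_real ?p)\<^sup>2))"
    unfolding E by (rule gen)
  also have "?E * (complex_of_real ?p)\<^sup>2 = mat_trace (Obs * chan_iter n coll (\<lambda>i. lcu_approx n t (r i) (q i) (coll i)) K \<rho>S) / 2"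
    using coherent_state_expectation[OF order_refl Oc(1)] by simp
  finally show "?p\<^sup>2 * measure_pmf.expectation ?run fst = Re (mat_trace (Obs * chan_iter n coll (\<lambda>i. lcu_approx n t (r i) (q i) (coll i)) K \<rho>S))"
    by simp
qed

end

section \<open>Concentration of the empirical mean\<close>

lemma empirical_mean_concentration:
  fixes p :: "'a pmf" and f :: "'a \<Rightarrow> real"
  assumes bound: "\<And>x. x \<in> set_pmf p \<Longrightarrow> \<bar>f x\<bar> \<le> B" and B: "0 < B" and T: "0 < T" and s: "0 \<le> s"
  shows "measure_pmf.prob (Pi_pmf {1..T} d (\<lambda>_. p))
      {\<omega>. s \<le> \<bar>(\<Sum>i=1..T. f (\<omega> i)) / real T - measure_pmf.expectation p f\<bar>} \<le> 2 * exp (- (real T * s\<^sup>2 / (2 * B\<^sup>2)))"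
proof -
  let ?P = "Pi_pmf {1..T} d (\<lambda>_. p)"
  have comp: "map_pmf (\<lambda>\<omega>. \<omega> i) ?P = p" if "i \<in> {1..T}" for i
    using that by (simp add: Pi_pmf_component)
  have E: "measure_pmf.expectation ?P (\<lambda>\<omega>. f (\<omega> i)) = measure_pmf.expectation p f" if "i \<in> {1..T}" for i
  proof -
    have "measure_pmf.expectation ?P (\<lambda>\<omega>. f (\<omega> i)) = measure_pmf.expectation (map_pmf (\<lambda>\<omega>. \<omega> i) ?P) f"
      by simp
    then show ?thesis unfolding comp[OF that] .
  qed
  interpret H: Hoeffding_ineq "measure_pmf ?P" "{1..T}" "\<lambda>i \<omega>. f (\<omega> i)" "\<lambda>_. - B" "\<lambda>_. B"
    "\<Sum>i\<in>{1..T}. measure_pmf.expectation ?P (\<lambda>\<omega>. f (\<omega> i))"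
  proof unfold_locales
    show "prob_space.indep_vars (measure_pmf ?P) (\<lambda>_. borel) (\<lambda>i \<omega>. f (\<omega> i)) {1..T}"
      by (rule prob_space.indep_vars_compose2[OF measure_pmf.prob_space_axioms indep_vars_Pi_pmf]) auto
    show "AE \<omega> in measure_pmf ?P. f (\<omega> i) \<in> {- B..B}" if i: "i \<in> {1..T}" for i
    proof (rule AE_pmfI)
      fix \<omega> assume "\<omega> \<in> set_pmf ?P"
      then have "\<omega> i \<in> set_pmf (map_pmf (\<lambda>\<omega>. \<omega> i) ?P)" by auto
      then have "\<bar>f (\<omega> i)\<bar> \<le> B" unfolding comp[OF i] by (rule bound)
      then show "f (\<omega> i) \<in> {- B..B}" by auto
    qed
  qed simp
  have pos: "0 < (\<Sum>i\<in>{1..T}. (B - - B)\<^sup>2)" using B T by simp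
  have "{\<omega>. s \<le> \<bar>(\<Sum>i=1..T. f (\<omega> i)) / real T - measure_pmf.expectation p f\<bar>}
     = {\<omega> \<in> space (measure_pmf ?P). real T * s \<le> \<bar>(\<Sum>i\<in>{1..T}. f (\<omega> i)) - (\<Sum>i\<in>{1..T}. measure_pmf.expectation ?P (\<lambda>\<omega>. f (\<omega> i)))\<bar>}"
  proof (intro Collect_cong)
    fix \<omega>
    have "(\<Sum>i\<in>{1..T}. f (\<omega> i)) - (\<Sum>i\<in>{1..T}. measure_pmf.expectation ?P (\<lambda>\<omega>. f (\<omega> i)))
       = real T * ((\<Sum>i=1..T. f (\<omega> i)) / real T - measure_pmf.expectation p f)"
      using T E by (simp add: right_diff_distrib)
    then show "(s \<le> \<bar>(\<Sum>i=1..T. f (\<omega> i)) / real T - measure_pmf.expectation p f\<bar>) =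
      (\<omega> \<in> space (measure_pmf ?P) \<and> real T * s \<le> \<bar>(\<Sum>i\<in>{1..T}. f (\<omega> i)) - (\<Sum>i\<in>{1..T}. measure_pmf.expectation ?P (\<lambda>\<omega>. f (\<omega> i)))\<bar>)"
      using T by (simp add: abs_mult)
  qed
  then have "measure_pmf.prob ?P {\<omega>. s \<le> \<bar>(\<Sum>i=1..T. f (\<omega> i)) / real T - measure_pmf.expectation p f\<bar>}
     \<le> 2 * exp (- 2 * (real T * s)\<^sup>2 / (\<Sum>i\<in>{1..T}. (B - - B)\<^sup>2))"
    using H.Hoeffding_ineq_abs_ge[OF _ pos, of "real T * s"] s by simp
  \<comment> \<open>Each summand ranges over an interval of length 2 B, and a deviation s of the
    mean is a deviation T s of the sum.\<close>
  also have "- 2 * (real T * s)\<^sup>2 / (\<Sum>i\<in>{1..T}. (B - - B)\<^sup>2) = - (real T * s\<^sup>2 / (2 * B\<^sup>2))"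
    using T B by (simp add: field_simps power2_eq_square)
  finally show ?thesis .
qed

section \<open>Choice of the parameters\<close>

text \<open>Here b stands for \<beta> \<Delta>t. The first component of the minimum is the required
  precision; the second keeps 2 K e below 1, so that the accumulated error stays linear in e even
  when the norm M is smaller than \<epsilon>.\<close>

lemma parameter_choice:
  fixes N b M \<epsilon> :: real and K :: nat
  assumes order: "\<And>y q. N \<le> y \<Longrightarrow> 4 * log_ratio y \<le> real q \<Longrightarrow> 2 * y \<le> fact q"
    and ge_one: "\<And>y. N \<le> y \<Longrightarrow> 1 \<le> log_ratio y"
    and square: "\<And>z. N \<le> z \<Longrightarrow> log_ratio (12 * z\<^sup>2) \<le> 4 * log_ratio z"
    and N: "exp (exp 1) \<le> N"
    and K: "1 \<le> K" and b: "0 < b" and M: "0 < M" and \<epsilon>: "0 < \<epsilon>"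
  defines "\<epsilon>' \<equiv> \<epsilon> / (6 * real K * M)"
  obtains R m :: nat where "0 < R" "b < real R"
    "2 * (real R * ((b / real R) ^ (2 * m + 2) / fact (2 * m + 2))) \<le> min \<epsilon>' (1 / (6 * real K))"
    "real K * b\<^sup>2 / real R \<le> 1"
    "N \<le> real R / \<epsilon>' \<Longrightarrow> real (2 * m) \<le> 6 * log_ratio (real R / \<epsilon>')"
    "N \<le> M / \<epsilon> \<Longrightarrow> N \<le> real K * b\<^sup>2 \<Longrightarrow> real (R * (2 * m + 1)) \<le> 56 * (real K * b\<^sup>2 * log_ratio (b * real K * M / \<epsilon>))"
proof (cases "N \<le> M / \<epsilon> \<and> N \<le> real K * b\<^sup>2")
  case True
  have N1: "1 < N"
  proof -
    have "1 < exp (exp (1::real))" by simp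
    then show ?thesis using N by linarith
  qed
  let ?Kb = "real K * b\<^sup>2"
  \<comment> \<open>The smallest number of segments that keeps the exponent K b^2 / R of the total
    one-norm at most 1; rounding at most doubles it because K b^2 exceeds 1.\<close>
  define R where "R = nat \<lceil>?Kb\<rceil>"
  have R: "?Kb \<le> real R" "real R \<le> 2 * ?Kb" using True N1 unfolding R_def by linarith+
  have Me: "1 \<le> M / \<epsilon>" using True N1 by linarith
  then have eM: "\<epsilon> \<le> M" using \<epsilon> by simp
  have \<epsilon>'0: "0 < \<epsilon>'" using \<epsilon> M K by (simp add: \<epsilon>'_def)
  have \<epsilon>'K: "\<epsilon>' \<le> 1 / (6 * real K)" using eM \<epsilon> M K by (simp add: \<epsilon>'_def field_simps)
  also have "1 / (6 * real K) \<le> 1" using K by simp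
  finally have \<epsilon>'1: "\<epsilon>' \<le> 1" .
  define y where "y = real R / \<epsilon>'"
  have "real R \<le> y" using \<epsilon>'0 \<epsilon>'1 by (simp add: y_def le_divide_eq mult_left_le)
  then have y: "N \<le> y" using R True by linarith
  \<comment> \<open>Order 2 m is at least 4 \<open>log_ratio y\<close>, as \<open>order\<close>
    requires, and at most 6 \<open>log_ratio y\<close>, because rounding costs 2 and
    \<open>log_ratio y\<close> is at least 1.\<close>
  define m where "m = nat \<lceil>2 * log_ratio y\<rceil>"
  have lr1: "1 \<le> log_ratio y" by (rule ge_one[OF y])
  have m: "2 * log_ratio y \<le> real m" "real m \<le> 2 * log_ratio y + 1" using lr1 unfolding m_def by linarith+
  have R0: "0 < real R" using R True N1 by linarith
  \<comment> \<open>Gives b < R, that is segments shorter than 1, since R is at least b times K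
    b.\<close>
  have Kb1: "1 < real K * b"
  proof (cases "b \<le> 1")
    case True
    then have "?Kb \<le> real K * b" using b K by (simp add: power2_eq_square)
    then show ?thesis using \<open>N \<le> M / \<epsilon> \<and> N \<le> ?Kb\<close> N1 by linarith
  next
    case False
    then have "1 * 1 < real K * b" using K by (intro mult_le_less_imp_less) auto
    then show ?thesis by simp
  qed
  show ?thesis
  proof (rule that[of R m])
    show "0 < R" using R0 by simp
    have "b * 1 < b * (real K * b)" using Kb1 b by (intro mult_strict_left_mono)
    then show bR: "b < real R" using R by (simp add: power2_eq_square mult_ac)
    have "2 * y \<le> fact (2 * m)" using m by (intro order[OF y]) simp
    also have "\<dots> \<le> fact (2 * m + 2)" by (intro fact_mono) simp
    finally have f: "2 * y \<le> fact (2 * m + 2)" .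
    \<comment> \<open>The power is only bounded by 1; the decay comes from the factorial alone,
      which is what makes the order grow like ln y / ln (ln y).\<close>
    have "(b / real R) ^ (2 * m + 2) \<le> 1" using b bR by (intro power_le_one) auto
    then have "(b / real R) ^ (2 * m + 2) / fact (2 * m + 2) \<le> 1 / (2 * y)"
      using f y N1 by (intro frac_le) auto
    then have "2 * (real R * ((b / real R) ^ (2 * m + 2) / fact (2 * m + 2))) \<le> 2 * (real R * (1 / (2 * y)))"
      using R0 by (intro mult_left_mono) auto
    also have "\<dots> = \<epsilon>'" using R0 \<epsilon>'0 by (simp add: y_def)
    finally show "2 * (real R * ((b / real R) ^ (2 * m + 2) / fact (2 * m + 2))) \<le> min \<epsilon>' (1 / (6 * real K))"
      using \<epsilon>'K by simp
    show "?Kb / real R \<le> 1" using R R0 by simp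
    have q: "real (2 * m) \<le> 6 * log_ratio y" using m lr1 by simp
    then show "real (2 * m) \<le> 6 * log_ratio (real R / \<epsilon>')" by (simp add: y_def)
    \<comment> \<open>The quantity in the depth bound. Since M / \<epsilon> and K b both exceed 1, y
      is at most 12 z^2, with 12 from the rounding factor 2 and the 6 in \<epsilon>'.\<close>
    define z where "z = b * real K * M / \<epsilon>"
    have z: "N \<le> z"
    proof -
      have "1 * N \<le> (real K * b) * (M / \<epsilon>)" using True Kb1 N1 by (intro mult_mono) auto
      then show ?thesis by (simp add: z_def mult_ac)
    qed
    have "y = real R * (6 * real K * M / \<epsilon>)" by (simp add: y_def \<epsilon>'_def)
    also have "\<dots> \<le> 2 * ?Kb * (6 * real K * M / \<epsilon>)" using R M \<epsilon> by (intro mult_right_mono) auto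
    also have "\<dots> = 12 * ((real K)\<^sup>2 * b\<^sup>2 * (M / \<epsilon>)) * 1" by (simp add: power2_eq_square)
    also have "\<dots> \<le> 12 * ((real K)\<^sup>2 * b\<^sup>2 * (M / \<epsilon>)) * (M / \<epsilon>)" using Me M \<epsilon> by (intro mult_left_mono) auto
    also have "\<dots> = 12 * z\<^sup>2" by (simp add: z_def power2_eq_square)
    finally have "log_ratio y \<le> log_ratio (12 * z\<^sup>2)" using N y by (intro log_ratio_mono) auto
    also have "\<dots> \<le> 4 * log_ratio z" by (rule square[OF z])
    \<comment> \<open>Here 2 m + 1 is at most 7 \<open>log_ratio y\<close>, and passing from y to z
      costs a factor 4.\<close>
    finally have "real (2 * m + 1) \<le> 28 * log_ratio z" using q lr1 by simp
    then have "real R * real (2 * m + 1) \<le> (2 * ?Kb) * (28 * log_ratio z)"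
      using R by (intro mult_mono) auto
    then show "real (R * (2 * m + 1)) \<le> 56 * (?Kb * log_ratio (b * real K * M / \<epsilon>))"
      by (simp add: z_def algebra_simps)
  qed
next
  case False
  \<comment> \<open>Outside the asymptotic regime only the accuracy matters: order 0 with many segments.\<close>
  have \<epsilon>'0: "0 < \<epsilon>'" using \<epsilon> M K by (simp add: \<epsilon>'_def)
  define e where "e = min \<epsilon>' (1 / (6 * real K))"
  have e: "0 < e" using \<epsilon>'0 K by (simp add: e_def)
  \<comment> \<open>The three lower bounds guarantee segments shorter than 1, a total error b^2 / R
    of at most \<open>e\<close>, and the one-norm condition.\<close>
  define R where "R = nat \<lceil>max (b + 1) (max (b\<^sup>2 / e) (real K * b\<^sup>2))\<rceil>"
  have R: "b + 1 \<le> real R" "b\<^sup>2 / e \<le> real R" "real K * b\<^sup>2 \<le> real R" unfolding R_def by linarith+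
  then have R0: "0 < real R" using b by linarith
  show ?thesis
  proof (rule that[of R 0])
    show "0 < R" "b < real R" "real K * b\<^sup>2 / real R \<le> 1" using R R0 by auto
    have "2 * (real R * ((b / real R) ^ (2 * 0 + 2) / fact (2 * 0 + 2))) = b\<^sup>2 / real R"
      using R0 by (simp add: power2_eq_square)
    also have "\<dots> \<le> e" using R(2) R0 e by (simp add: field_simps)
    finally show "2 * (real R * ((b / real R) ^ (2 * 0 + 2) / fact (2 * 0 + 2))) \<le> min \<epsilon>' (1 / (6 * real K))"
      by (simp add: e_def)
    show "real (2 * 0) \<le> 6 * log_ratio (real R / \<epsilon>')" if "N \<le> real R / \<epsilon>'" using ge_one[OF that] by simp
  qed (use False in auto)
qed

text \<open>The error splits into a deterministic bias of at most 2 \<epsilon>/3 from the LCU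
  approximation and a statistical deviation of at most \<epsilon>/3, the latter failing with
  probability at most \<delta>.\<close>

lemma algorithm_accuracy:
  fixes \<kappa> n K :: nat and r m :: "nat \<Rightarrow> nat" and T :: nat
  assumes K: "1 \<le> K" and valid: "\<And>j. j \<in> {1..K} \<Longrightarrow> valid_collision n HS (coll j)"
    and t: "0 < t" and r: "\<And>j. j \<in> {1..K} \<Longrightarrow> 0 < r j" and state: "density_mat (2 ^ n) \<rho>S"
    and Obs: "hermitian_mat (2 ^ n) Obs" "op_bound Obs M" "0 < M"
    and err: "\<And>j. j \<in> {1..K} \<Longrightarrow> op_bound (lcu_approx n t (r j) (q j) (coll j) - collision_unitary n HS t (coll j)) e"
    and e: "0 \<le> e" "e \<le> \<epsilon> / (6 * real K * M)" "e \<le> 1 / (6 * real K)"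
    and norm: "(\<Prod>j=1..K. lcu_norm t (r j) (q j) (coll j)) \<le> exp 1"
    and \<epsilon>: "0 < \<epsilon>" and \<delta>: "0 < \<delta>" "\<delta> < 1" and T: "18 * exp 4 * M\<^sup>2 * ln (2 / \<delta>) / \<epsilon>\<^sup>2 \<le> real T" "0 < T"
  shows "1 - \<delta> \<le> measure_pmf.prob (algorithm_output \<kappa> n K t coll \<rho>S Obs r q T)
    {\<mu>. cmod (complex_of_real \<mu> - mat_trace (Obs * markov_map n HS t coll K \<rho>S)) \<le> \<epsilon>}"
proof -
  let ?run = "coherent_run \<kappa> n K t coll \<rho>S Obs r q"
  let ?z = "mat_trace (Obs * markov_map n HS t coll K \<rho>S)"
  define \<zeta> where "\<zeta> = (\<Prod>j=1..K. lcu_norm t (r j) (q j) (coll j))"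
  define E where "E = measure_pmf.expectation ?run fst"
  have Oc: "Obs \<in> carrier_mat (2 ^ n) (2 ^ n)" using Obs(1) by (rule hermitian_carrier)
  have \<zeta>: "0 < \<zeta>" "\<zeta> \<le> exp 1"
    using norm valid lcu_norm_pos[OF valid t r] by (auto simp: \<zeta>_def intro!: prod_pos)
  have z: "complex_of_real (Re ?z) = ?z"
    using hermitian_trace_real[OF Obs(1) density_hermitian[OF markov_map_density[OF valid t r state order_refl]]] .
  have "\<zeta>\<^sup>2 * E = Re (mat_trace (Obs * chan_iter n coll (\<lambda>i. lcu_approx n t (r i) (q i) (coll i)) K \<rho>S))"
    unfolding \<zeta>_def E_def using coherent_run_properties(4)[OF valid t r state Obs(1,2)] Obs(3) by simp
  then have "\<bar>\<zeta>\<^sup>2 * E - Re ?z\<bar> \<le> cmod (mat_trace (Obs * chan_iter n coll (\<lambda>i. lcu_approx n t (r i) (q i) (coll i)) K \<rho>S) - ?z)"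
    using abs_Re_le_cmod[of "mat_trace (Obs * chan_iter n coll (\<lambda>i. lcu_approx n t (r i) (q i) (coll i)) K \<rho>S) - ?z"] by simp
  also have "\<dots> \<le> ((1 + e) ^ (2 * K) - 1) * M"
    using channel_error[OF valid t r state err e(1) order_refl Oc Obs(2)] Obs(3) by simp
  \<comment> \<open>Here e at most 1/(6 K) gives 2 K e at most 1/3, so the power may be linearised;
    the result 4 K e M is at most 2 \<epsilon>/3.\<close>
  also have "\<dots> \<le> 2 * (real (2 * K) * e) * M"
    using e K Obs(3) by (intro mult_right_mono one_plus_power_le) (auto simp: field_simps)
  also have "\<dots> \<le> 2 * \<epsilon> / 3"
    using e(2) K Obs(3) by (simp add: field_simps)
  finally have bias: "\<bar>\<zeta>\<^sup>2 * E - Re ?z\<bar> \<le> 2 * \<epsilon> / 3" .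
  \<comment> \<open>The deviation of the unscaled mean that becomes \<epsilon>/3 after
    multiplication by \<zeta>^2.\<close>
  define s where "s = \<epsilon> / (3 * \<zeta>\<^sup>2)"
  have s: "0 < s" using \<epsilon> \<zeta> by (simp add: s_def)
  let ?P = "Pi_pmf {1..T} (0, 0) (\<lambda>_. ?run)"
  let ?bad = "{\<omega> :: nat \<Rightarrow> real \<times> nat. s \<le> \<bar>(\<Sum>i=1..T. fst (\<omega> i)) / real T - E\<bar>}"
  have "measure_pmf.prob ?P ?bad \<le> 2 * exp (- (real T * s\<^sup>2 / (2 * M\<^sup>2)))"
    unfolding E_def using coherent_run_properties(2)[OF valid t r state Obs(1,2)] Obs(3) T s
    by (intro empirical_mean_concentration) auto
  also have "\<dots> \<le> \<delta>"
  proof -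
    have "\<zeta> ^ 4 \<le> exp 1 ^ 4" using \<zeta> by (intro power_mono) auto
    also have "exp (1::real) ^ 4 = exp 4" by (simp flip: exp_of_nat_mult)
    finally have z4: "\<zeta> ^ 4 \<le> exp 4" .
    have l: "0 < ln (2 / \<delta>)" using \<delta> by simp
    have "18 * \<zeta> ^ 4 * M\<^sup>2 * ln (2 / \<delta>) / \<epsilon>\<^sup>2 \<le> 18 * exp 4 * M\<^sup>2 * ln (2 / \<delta>) / \<epsilon>\<^sup>2"
      using z4 l by (intro divide_right_mono mult_right_mono mult_left_mono) auto
    then have "18 * \<zeta> ^ 4 * M\<^sup>2 * ln (2 / \<delta>) / \<epsilon>\<^sup>2 \<le> real T" using T by linarith
    \<comment> \<open>The constant 18 is the 2 of the Hoeffding exponent times the 9 from s^2, which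
      also brings in \<zeta>^4.\<close>
    then have "ln (2 / \<delta>) \<le> real T * \<epsilon>\<^sup>2 / (18 * \<zeta> ^ 4 * M\<^sup>2)"
      using \<zeta> \<epsilon> Obs(3) by (simp add: field_simps)
    also have "\<dots> = real T * s\<^sup>2 / (2 * M\<^sup>2)"
      by (simp add: s_def power_divide power_mult_distrib flip: power_mult)
    finally have "- (real T * s\<^sup>2 / (2 * M\<^sup>2)) \<le> - ln (2 / \<delta>)" by simp
    then have "exp (- (real T * s\<^sup>2 / (2 * M\<^sup>2))) \<le> exp (- ln (2 / \<delta>))" by simp
    also have "\<dots> = \<delta> / 2" using \<delta> by (simp add: exp_minus)
    finally show ?thesis by simp
  qed
  finally have bad: "measure_pmf.prob ?P ?bad \<le> \<delta>" .
  let ?good = "{\<mu>. cmod (complex_of_real \<mu> - ?z) \<le> \<epsilon>}"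
  have sub: "- ?bad \<subseteq> (\<lambda>\<omega>. \<zeta>\<^sup>2 / real T * (\<Sum>i=1..T. fst (\<omega> i))) -` ?good"
  proof
    fix \<omega> :: "nat \<Rightarrow> real \<times> nat" assume "\<omega> \<in> - ?bad"
    then have w: "\<bar>(\<Sum>i=1..T. fst (\<omega> i)) / real T - E\<bar> < s" by simp
    let ?m = "\<zeta>\<^sup>2 / real T * (\<Sum>i=1..T. fst (\<omega> i))"
    have "?m - \<zeta>\<^sup>2 * E = \<zeta>\<^sup>2 * ((\<Sum>i=1..T. fst (\<omega> i)) / real T - E)" by (simp add: right_diff_distrib)
    then have "\<bar>?m - \<zeta>\<^sup>2 * E\<bar> = \<zeta>\<^sup>2 * \<bar>(\<Sum>i=1..T. fst (\<omega> i)) / real T - E\<bar>" by (simp add: abs_mult)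
    also have "\<dots> \<le> \<zeta>\<^sup>2 * s" using w by (intro mult_left_mono) auto
    also have "\<dots> = \<epsilon> / 3" using \<zeta> by (simp add: s_def)
    finally have "\<bar>?m - Re ?z\<bar> \<le> \<epsilon>" using bias by linarith
    moreover have "complex_of_real ?m - ?z = complex_of_real (?m - Re ?z)" unfolding of_real_diff z ..
    ultimately show "\<omega> \<in> (\<lambda>\<omega>. \<zeta>\<^sup>2 / real T * (\<Sum>i=1..T. fst (\<omega> i))) -` ?good"
      by (simp only: vimage_eq mem_Collect_eq norm_of_real)
  qed
  have "1 - \<delta> \<le> 1 - measure_pmf.prob ?P ?bad" using bad by simp
  also have "\<dots> = measure_pmf.prob ?P (- ?bad)"
    using measure_pmf.prob_compl[of ?bad ?P] by (simp add: Compl_eq_Diff_UNIV)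
  also have "\<dots> \<le> measure_pmf.prob ?P ((\<lambda>\<omega>. \<zeta>\<^sup>2 / real T * (\<Sum>i=1..T. fst (\<omega> i))) -` ?good)"
    by (rule measure_pmf.finite_measure_mono[OF sub]) simp
  also have "\<dots> = measure_pmf.prob (algorithm_output \<kappa> n K t coll \<rho>S Obs r q T) ?good"
    unfolding algorithm_output_def Let_def \<zeta>_def by simp
  finally show ?thesis .
qed

text \<open>The gate cost \<kappa> is fixed first because it is the O(1) of the depth convention; C
  and N are then uniform in all remaining data. Accuracy is asserted for all admissible parameters,
  while each cost bound has its own threshold condition, as its O-notation prescribes. The depth
  bound holds for every possible run, not only on average.\<close>

theorem theorem1:
  fixes \<kappa> :: nat
  shows "\<exists>C>0. \<exists>N\<ge>1.
    \<forall>(n::nat) (K::nat) HS (coll :: nat \<Rightarrow> collision) (\<Delta>t::real) \<rho>S Obs (\<epsilon>::real) (\<delta>::real).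
      1 \<le> K \<and> hermitian_mat (2 ^ n) HS \<and> (\<forall>j\<in>{1..K}. valid_collision n HS (coll j)) \<and> 0 < \<Delta>t \<and>
      density_mat (2 ^ n) \<rho>S \<and> hermitian_mat (2 ^ n) Obs \<and> 0 < spectral_norm Obs \<and>
      0 < \<epsilon> \<and> \<epsilon> < 1 \<and> 0 < \<delta> \<and> \<delta> < 1 \<longrightarrow>
      (let \<epsilon>' = \<epsilon> / (6 * real K * spectral_norm Obs);
           \<beta> = Max ((\<lambda>j. coef_sum (coll j)) ` {1..K});
           \<tau>E = Max ((\<lambda>j. prep_depth (coll j)) ` {1..K})
       in \<exists>(r :: nat \<Rightarrow> nat) (q :: nat \<Rightarrow> nat) (T :: nat).
            (\<forall>j\<in>{1..K}. 0 < r j \<and> segment_time \<Delta>t (r j) (coll j) < 1 \<and>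
               spectral_norm (lcu_approx n \<Delta>t (r j) (q j) (coll j) - collision_unitary n HS \<Delta>t (coll j)) \<le> \<epsilon>' \<and>
               (N \<le> real (r j) / \<epsilon>' \<longrightarrow> real (q j) \<le> C * log_ratio (real (r j) / \<epsilon>'))) \<and>
            0 < T \<and>
            1 - \<delta> \<le> measure_pmf.prob (algorithm_output \<kappa> n K \<Delta>t coll \<rho>S Obs r q T)
              {\<mu>. cmod (complex_of_real \<mu> - mat_trace (Obs * markov_map n HS \<Delta>t coll K \<rho>S)) \<le> \<epsilon>} \<and>
            (N \<le> spectral_norm Obs / \<epsilon> \<and> N \<le> 1 / \<delta> \<longrightarrow>
               real T \<le> C * ((spectral_norm Obs)\<^sup>2 * ln (1 / \<delta>) / \<epsilon>\<^sup>2)) \<and>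
            (N \<le> spectral_norm Obs / \<epsilon> \<and> N \<le> real K * (\<beta> * \<Delta>t)\<^sup>2 \<longrightarrow>
               (\<forall>(\<mu>, d) \<in> set_pmf (coherent_run \<kappa> n K \<Delta>t coll \<rho>S Obs r q).
                  real d \<le> C * (\<beta>\<^sup>2 * (real K)\<^sup>2 * \<Delta>t\<^sup>2
                                 * log_ratio (\<beta> * real K * spectral_norm Obs * \<Delta>t / \<epsilon>)
                               + real K * real \<tau>E))))"
proof -
  obtain N1 :: real where N1: "\<And>y q. N1 \<le> y \<Longrightarrow> 4 * log_ratio y \<le> real q \<Longrightarrow> 2 * y \<le> fact q"
    using truncation_order_sufficient unfolding eventually_at_top_linorder by blast
  obtain N2 :: real where N2: "\<And>y. N2 \<le> y \<Longrightarrow> 1 \<le> log_ratio y"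
    using log_ratio_ge_one unfolding eventually_at_top_linorder by blast
  obtain N3 :: real where N3: "\<And>z. N3 \<le> z \<Longrightarrow> log_ratio (12 * z\<^sup>2) \<le> 4 * log_ratio z"
    using log_ratio_square unfolding eventually_at_top_linorder by blast
  define N where "N = max (exp (exp 1)) (max N1 (max N2 N3))"
  have N: "exp (exp 1) \<le> N" "N1 \<le> N" "N2 \<le> N" "N3 \<le> N" by (auto simp: N_def)
  have N_ge_2: "2 \<le> N"
  proof -
    have "exp 1 + 1 \<le> exp (exp (1::real))" using exp_ge_add_one_self[of "exp (1::real)"] by linarith
    moreover have "(1::real) \<le> exp 1" by simp
    ultimately show ?thesis using N(1) by linarith
  qed
  \<comment> \<open>The summands cover the depth bound, with 112 twice the 56 of
    \<open>parameter_choice\<close> for the two samples, the number of runs with its rounding, and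
    the factor 6 of the truncation order.\<close>
  define C where "C = 112 * real \<kappa> + 36 * exp 4 + 7"
  have C: "112 * real \<kappa> \<le> C" "36 * exp 4 + 1 \<le> C" "6 \<le> C" "1 \<le> C" "0 < C"
    by (auto simp: C_def add_pos_nonneg intro: add_nonneg_pos)
  show ?thesis
  proof (rule exI[of _ C], intro conjI C(5) exI[of _ N], goal_cases)
    case 1
    show ?case using N_ge_2 by simp
  next
    case 2
    show ?case
    proof (intro allI impI, goal_cases)
      case (1 n K HS coll t \<rho>S Obs \<epsilon> \<delta>)
      then have K: "1 \<le> K" and valid: "\<And>j. j \<in> {1..K} \<Longrightarrow> valid_collision n HS (coll j)" and t: "0 < t"
        and state: "density_mat (2 ^ n) \<rho>S" and Obs: "hermitian_mat (2 ^ n) Obs" and M: "0 < spectral_norm Obs"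
        and \<epsilon>: "0 < \<epsilon>" "\<epsilon> < 1" and \<delta>: "0 < \<delta>" "\<delta> < 1" by auto
      let ?M = "spectral_norm Obs"
      let ?\<epsilon>' = "\<epsilon> / (6 * real K * ?M)"
      define \<beta> where "\<beta> = Max ((\<lambda>j. coef_sum (coll j)) ` {1..K})"
      define \<tau>E where "\<tau>E = Max ((\<lambda>j. prep_depth (coll j)) ` {1..K})"
      have \<beta>j: "coef_sum (coll j) \<le> \<beta>" if "j \<in> {1..K}" for j
        unfolding \<beta>_def using that by (intro Max_ge) auto
      have prep: "prep_depth (coll j) \<le> \<tau>E" if "j \<in> {1..K}" for j
        unfolding \<tau>E_def using that by (intro Max_ge) auto
      have "1 \<in> {1..K}" using K by simp
      then have \<beta>0: "0 < \<beta>" using \<beta>j[of 1] coef_sum_pos[OF valid[of 1]] by linarith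
      then have b: "0 < \<beta> * t" using t by simp
      \<comment> \<open>One choice made for the maximum \<beta> serves all collisions, since tail,
        segment length and one-norm only improve for smaller coefficient sums.\<close>
      obtain R m :: nat where R: "0 < R" "\<beta> * t < real R"
        and tail: "2 * (real R * ((\<beta> * t / real R) ^ (2 * m + 2) / fact (2 * m + 2))) \<le> min ?\<epsilon>' (1 / (6 * real K))"
        and Kb: "real K * (\<beta> * t)\<^sup>2 / real R \<le> 1"
        and order: "N \<le> real R / ?\<epsilon>' \<Longrightarrow> real (2 * m) \<le> 6 * log_ratio (real R / ?\<epsilon>')"
        and gates: "N \<le> ?M / \<epsilon> \<Longrightarrow> N \<le> real K * (\<beta> * t)\<^sup>2 \<Longrightarrow>
          real (R * (2 * m + 1)) \<le> 56 * (real K * (\<beta> * t)\<^sup>2 * log_ratio (\<beta> * t * real K * ?M / \<epsilon>))"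
        by (rule parameter_choice[of N K "\<beta> * t" ?M \<epsilon>]) (use N1 N2 N3 N K b M \<epsilon> in \<open>force+\<close>)
      define e where "e = min ?\<epsilon>' (1 / (6 * real K))"
      have e: "0 \<le> e" "e \<le> ?\<epsilon>'" "e \<le> 1 / (6 * real K)" using \<epsilon> M K by (auto simp: e_def)
      have "1 / (6 * real K) \<le> 1" using K by simp
      then have e1: "e \<le> 1" using e(3) by linarith
      define T where "T = nat \<lceil>18 * exp 4 * ?M\<^sup>2 * ln (2 / \<delta>) / \<epsilon>\<^sup>2\<rceil>"
      have ln2: "0 < ln (2 / \<delta>)" using \<delta> by simp
      have T0: "0 < 18 * exp 4 * ?M\<^sup>2 * ln (2 / \<delta>) / \<epsilon>\<^sup>2" using ln2 M \<epsilon> by simp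
      then have T: "18 * exp 4 * ?M\<^sup>2 * ln (2 / \<delta>) / \<epsilon>\<^sup>2 \<le> real T" "0 < T"
        "real T \<le> 18 * exp 4 * ?M\<^sup>2 * ln (2 / \<delta>) / \<epsilon>\<^sup>2 + 1"
        unfolding T_def by linarith+
      have x: "0 < segment_time t R (coll j)" "segment_time t R (coll j) \<le> \<beta> * t / real R" if j: "j \<in> {1..K}" for j
        using \<beta>j[OF j] coef_sum_pos[OF valid[OF j]] t R by (auto simp: segment_time_def intro!: divide_right_mono mult_right_mono)
      have x1: "segment_time t R (coll j) < 1" if j: "j \<in> {1..K}" for j
      proof -
        have "\<beta> * t / real R < 1" using R by simp
        then show ?thesis using x(2)[OF j] by linarith
      qed
      have err: "op_bound (lcu_approx n t R (2 * m) (coll j) - collision_unitary n HS t (coll j)) e" if j: "j \<in> {1..K}" for j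
      proof (rule lcu_approx_error[OF valid[OF j] t R(1) x1[OF j] _ e1])
        have "2 * (real R * (segment_time t R (coll j) ^ (2 * m + 2) / fact (2 * m + 2)))
           \<le> 2 * (real R * ((\<beta> * t / real R) ^ (2 * m + 2) / fact (2 * m + 2)))"
          using x[OF j] by (intro mult_left_mono divide_right_mono power_mono) auto
        also have "\<dots> \<le> e" unfolding e_def by (rule tail)
        finally show "2 * (real R * (segment_time t R (coll j) ^ (2 * m + 2) / fact (2 * m + 2))) \<le> e" .
      qed
      have norm: "(\<Prod>j=1..K. lcu_norm t R (2 * m) (coll j)) \<le> exp 1"
      proof -
        have "(\<Prod>j=1..K. lcu_norm t R (2 * m) (coll j)) \<le> (\<Prod>j=1..K. exp ((\<beta> * t)\<^sup>2 / real R))"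
        proof (rule prod_mono)
          fix j assume j: "j \<in> {1..K}"
          have "lcu_norm t R (2 * m) (coll j) \<le> exp ((coef_sum (coll j) * t)\<^sup>2 / real R)"
            by (rule lcu_norm_le[OF valid[OF j] t R(1)])
          also have "\<dots> \<le> exp ((\<beta> * t)\<^sup>2 / real R)"
            using \<beta>j[OF j] coef_sum_pos[OF valid[OF j]] t
            by (intro exp_mono divide_right_mono power_mono mult_right_mono) auto
          finally show "0 \<le> lcu_norm t R (2 * m) (coll j) \<and> lcu_norm t R (2 * m) (coll j) \<le> exp ((\<beta> * t)\<^sup>2 / real R)"
            using lcu_norm_pos[OF valid[OF j] t R(1)] by (simp add: less_imp_le)
        qed
        also have "\<dots> = exp (real K * (\<beta> * t)\<^sup>2 / real R)" by (simp flip: exp_of_nat_mult)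
        also have "\<dots> \<le> exp 1" using Kb by simp
        finally show ?thesis .
      qed
      have acc: "1 - \<delta> \<le> measure_pmf.prob (algorithm_output \<kappa> n K t coll \<rho>S Obs (\<lambda>_. R) (\<lambda>_. 2 * m) T)
          {\<mu>. cmod (complex_of_real \<mu> - mat_trace (Obs * markov_map n HS t coll K \<rho>S)) \<le> \<epsilon>}"
        by (rule algorithm_accuracy[OF K valid t R(1) state Obs op_bound_spectral_norm M err e norm \<epsilon>(1) \<delta> T(1,2)])
      \<comment> \<open>For \<delta> at most 1/2, ln (2/\<delta>) is at most 2 ln (1/\<delta>),
        which turns 18 into 36. The rounding is absorbed because the bound itself is at least 1
        beyond the thresholds.\<close>
      have T_bound: "real T \<le> C * (?M\<^sup>2 * ln (1 / \<delta>) / \<epsilon>\<^sup>2)" if h: "N \<le> ?M / \<epsilon>" "N \<le> 1 / \<delta>"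
      proof -
        have "exp 1 \<le> 1 / \<delta>"
        proof -
          have "exp (1::real) \<le> exp (exp 1)" by simp
          then show ?thesis using h N(1) by linarith
        qed
        then have l1: "1 \<le> ln (1 / \<delta>)" using \<delta> by (subst ln_ge_iff) auto
        have "2 \<le> 1 / \<delta>" using h N_ge_2 by linarith
        then have "ln 2 \<le> ln (1 / \<delta>)" by (rule ln_mono) simp
        moreover have "ln (2 / \<delta>) = ln 2 + ln (1 / \<delta>)" using \<delta> ln_mult[of 2 "1 / \<delta>"] by simp
        ultimately have l2: "ln (2 / \<delta>) \<le> 2 * ln (1 / \<delta>)" by simp
        have "1 \<le> ?M / \<epsilon>" using h N_ge_2 by linarith
        then have "1 \<le> (?M / \<epsilon>)\<^sup>2" by (simp add: one_le_power)
        then have "1 * 1 \<le> (?M / \<epsilon>)\<^sup>2 * ln (1 / \<delta>)" using l1 by (intro mult_mono) auto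
        then have one: "1 \<le> ?M\<^sup>2 * ln (1 / \<delta>) / \<epsilon>\<^sup>2" by (simp add: power_divide)
        have "18 * exp 4 * ?M\<^sup>2 * ln (2 / \<delta>) / \<epsilon>\<^sup>2 \<le> 18 * exp 4 * ?M\<^sup>2 * (2 * ln (1 / \<delta>)) / \<epsilon>\<^sup>2"
          using l2 by (intro divide_right_mono mult_left_mono) auto
        also have "\<dots> = 36 * exp 4 * (?M\<^sup>2 * ln (1 / \<delta>) / \<epsilon>\<^sup>2)" by simp
        finally have "real T \<le> (36 * exp 4 + 1) * (?M\<^sup>2 * ln (1 / \<delta>) / \<epsilon>\<^sup>2)"
          using T(3) one unfolding distrib_right mult_1 by linarith
        also have "\<dots> \<le> C * (?M\<^sup>2 * ln (1 / \<delta>) / \<epsilon>\<^sup>2)" using C(2) one by (intro mult_right_mono) auto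
        finally show ?thesis .
      qed
      have depth: "real (snd z) \<le> C * (\<beta>\<^sup>2 * (real K)\<^sup>2 * t\<^sup>2 * log_ratio (\<beta> * real K * ?M * t / \<epsilon>) + real K * real \<tau>E)"
        if h: "N \<le> ?M / \<epsilon>" "N \<le> real K * (\<beta> * t)\<^sup>2" and z: "z \<in> set_pmf (coherent_run \<kappa> n K t coll \<rho>S Obs (\<lambda>_. R) (\<lambda>_. 2 * m))" for z
      proof -
        have "snd z \<le> (\<Sum>i=1..K. prep_depth (coll i) + \<kappa> * (2 * (R * (2 * m + 1))))"
          by (rule coherent_run_properties(3)[OF valid t R(1) state Obs op_bound_spectral_norm spectral_norm_nonneg z])
        also have "\<dots> \<le> (\<Sum>i=1..K. \<tau>E + \<kappa> * (2 * (R * (2 * m + 1))))"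
          using prep by (intro sum_mono add_right_mono)
        also have "\<dots> = K * (\<tau>E + \<kappa> * (2 * (R * (2 * m + 1))))" by simp
        finally have "real (snd z) \<le> real (K * (\<tau>E + \<kappa> * (2 * (R * (2 * m + 1)))))" by (simp only: of_nat_le_iff)
        also have "\<dots> = real K * real \<tau>E + 2 * real K * real \<kappa> * real (R * (2 * m + 1))" by (simp add: algebra_simps)
        also have "\<dots> \<le> real K * real \<tau>E + 2 * real K * real \<kappa> * (56 * (real K * (\<beta> * t)\<^sup>2 * log_ratio (\<beta> * t * real K * ?M / \<epsilon>)))"
          by (intro add_left_mono mult_left_mono gates[OF h]) auto
        also have "\<dots> = real K * real \<tau>E + 112 * real \<kappa> * (\<beta>\<^sup>2 * (real K)\<^sup>2 * t\<^sup>2 * log_ratio (\<beta> * real K * ?M * t / \<epsilon>))"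
          by (simp add: power_mult_distrib power2_eq_square mult_ac)
        also have "\<dots> \<le> C * (real K * real \<tau>E) + C * (\<beta>\<^sup>2 * (real K)\<^sup>2 * t\<^sup>2 * log_ratio (\<beta> * real K * ?M * t / \<epsilon>))"
        proof -
          \<comment> \<open>Nonnegativity of \<open>log_ratio\<close> at this argument is recovered
            from \<open>gates\<close>, where a positive multiple of it bounds a natural
            number.\<close>
          have "0 \<le> 56 * (real K * (\<beta> * t)\<^sup>2 * log_ratio (\<beta> * t * real K * ?M / \<epsilon>))"
            using gates[OF h] order_trans[OF of_nat_0_le_iff] by blast
          moreover have "0 < 56 * (real K * (\<beta> * t)\<^sup>2)" using K b by (intro mult_pos_pos) auto
          ultimately have "0 \<le> log_ratio (\<beta> * t * real K * ?M / \<epsilon>)"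
            unfolding mult.assoc[of 56, symmetric] zero_le_mult_iff by linarith
          then have "0 \<le> log_ratio (\<beta> * real K * ?M * t / \<epsilon>)" by (simp add: mult_ac)
          then have "0 \<le> \<beta>\<^sup>2 * (real K)\<^sup>2 * t\<^sup>2 * log_ratio (\<beta> * real K * ?M * t / \<epsilon>)" by simp
          moreover have "1 * (real K * real \<tau>E) \<le> C * (real K * real \<tau>E)" using C(4) by (intro mult_right_mono) auto
          ultimately show ?thesis using C(1) by (intro add_mono mult_right_mono) auto
        qed
        finally show ?thesis by (simp add: algebra_simps)
      qed
      show ?case
        unfolding Let_def \<beta>_def[symmetric] \<tau>E_def[symmetric]
      proof (rule exI[of _ "\<lambda>_. R"], rule exI[of _ "\<lambda>_. 2 * m"], rule exI[of _ T], intro conjI ballI impI)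
        fix j assume j: "j \<in> {1..K}"
        show "0 < R" "segment_time t R (coll j) < 1" using R x1[OF j] by auto
        have "spectral_norm (lcu_approx n t R (2 * m) (coll j) - collision_unitary n HS t (coll j)) \<le> e"
          by (rule spectral_norm_le[OF err[OF j] e(1)])
        then show "spectral_norm (lcu_approx n t R (2 * m) (coll j) - collision_unitary n HS t (coll j)) \<le> ?\<epsilon>'"
          using e(2) by linarith
        assume h: "N \<le> real R / ?\<epsilon>'"
        have "0 \<le> log_ratio (real R / ?\<epsilon>')" using N2[of "real R / ?\<epsilon>'"] N(3) h by linarith
        then have "6 * log_ratio (real R / ?\<epsilon>') \<le> C * log_ratio (real R / ?\<epsilon>')" using C(3) by (intro mult_right_mono)
        then show "real (2 * m) \<le> C * log_ratio (real R / ?\<epsilon>')" using order[OF h] by linarith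
      next
        show "0 < T" by (rule T(2))
        show "1 - \<delta> \<le> measure_pmf.prob (algorithm_output \<kappa> n K t coll \<rho>S Obs (\<lambda>_. R) (\<lambda>_. 2 * m) T)
          {\<mu>. cmod (complex_of_real \<mu> - mat_trace (Obs * markov_map n HS t coll K \<rho>S)) \<le> \<epsilon>}" by (rule acc)
        show "real T \<le> C * (?M\<^sup>2 * ln (1 / \<delta>) / \<epsilon>\<^sup>2)" if "N \<le> ?M / \<epsilon> \<and> N \<le> 1 / \<delta>"
          using T_bound that by blast
        show "case z of (\<mu>, d) \<Rightarrow> real d \<le> C * (\<beta>\<^sup>2 * (real K)\<^sup>2 * t\<^sup>2 * log_ratio (\<beta> * real K * ?M * t / \<epsilon>) + real K * real \<tau>E)"
          if "N \<le> ?M / \<epsilon> \<and> N \<le> real K * (\<beta> * t)\<^sup>2" "z \<in> set_pmf (coherent_run \<kappa> n K t coll \<rho>S Obs (\<lambda>_. R) (\<lambda>_. 2 * m))" for z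
          using depth[of z] that by (simp add: case_prod_unfold)
      qed
    qed
  qed
qed

end
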